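(* Let $g:\mathbb{R}^d\to\mathbb{R}^d$ be such that $g'(x)$ is symmetric and $h(x):=x-g(x)$ satisfies Assumption (H) stated in the context, with associated $x^*$ and constants $\hat\rho,\hat\kappa,\mu,L>0$. Consider Process I (restarted ST-AM) and Process II described in the context (both Type-I or both Type-II), and let $k$ be such that $m_{k+1}\ge2$. Assume that there are positive constants $\eta_0,\tau_0$ such that $\|h(x_j)\|_2\le\eta_0\|h(x_0)\|_2$ for $0\le j\le k+1$ and $|1-\Gamma_j^{(m_j)}|\ge\tau_0$ for $1\le j\le k$ (with $m_j\ge1$). Let $T_k$ and $\hat T_k$ be the tridiagonal matrices of Process I and Process II defined in the context, and let $\lambda\in\sigma(T_k)$. Then for $x_0$ sufficiently close to $x^*$, $$\min_{\hat\lambda\in\sigma(\hat T_k)}|\hat\lambda-\lambda|=\hat\kappa\,\mathcal{O}(\|x_{k-m_k}-x^*\|_2).$$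
   Context: Notation. $\sigma(\cdot)$ is the spectrum; $\Delta x_k=x_{k+1}-x_k$, and similarly for other sequences; $\mathcal{S}(B)=(B+B^{\mathrm T})/2$. A real square matrix $B$ is positive definite if all eigenvalues of $\mathcal{S}(B)$ are positive. Symmetry of $g'(x)$ is meant for all $x$ in the neighbourhood of $x^*$ where $g$ is differentiable. Assumption (H) on $h(x)=x-g(x)$: (i) there exists $x^*$ with $h(x^* )=0$; (ii) $h$ is Lipschitz continuously differentiable in a neighbourhood of $x^*$; (iii) $h'(x^* )$ is positive definite. Consequently there are positive constants $\hat\rho,\hat\kappa,\mu,L$, which are fixed, such that for all $x\in\mathcal{B}_{\hat\rho}(x^* ):=\{z:\|z-x^*\|_2\le\hat\rho\}$ and all $y\in\mathbb{R}^d$: $\mu\|y\|_2\le\|h'(x)y\|_2\le L\|y\|_2$; $\mu\|y\|_2^2\le y^{\mathrm T}h'(x)y\le L\|y\|_2^2$; $\|h(x)-h'(x^* )(x-x^* )\|_2\le\frac12\hat\kappa\|x-x^*\|_2^2$. Restarted ST-AM. Inputs: $x_0\in\mathbb{R}^d$, mixing parameters $\beta_k$, an integer $m$ with $0<m\le d$, $\tau\in(0,1)$, $\eta>0$. Put $v_j:=p_j$ for the Type-I method and $v_j:=q_j$ for the Type-II method. Set $m_0=0$. For $k=0,1,\dots$ until convergence (i.e. as long as $r_k\ne0$): (1) $r_k:=g(x_k)-x_k$. If $m_k>m$ or $\|r_k\|_2>\eta\|r_{k-m_k}\|_2$, reset $m_k:=0$. (2) If $m_k>0$: set $p_k:=x_k-x_{k-1}$,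 $q_k:=r_k-r_{k-1}$; for $j=\max\{1,m_k-2\},\dots,m_k-1$ successively set $\zeta_k^{(j)}:=\frac{v_{k-m_k+j}^{\mathrm T}q_k}{v_{k-m_k+j}^{\mathrm T}q_{k-m_k+j}}$ and replace $p_k$ by $p_k-p_{k-m_k+j}\zeta_k^{(j)}$ and $q_k$ by $q_k-q_{k-m_k+j}\zeta_k^{(j)}$. Then, if $|v_k^{\mathrm T}q_k|<\tau|v_{k-m_k+1}^{\mathrm T}q_{k-m_k+1}|$, reset $m_k:=0$. (3) Set $\bar x_k:=x_k$, $\bar r_k:=r_k$; for $j=\max\{1,m_k-1\},\dots,m_k$ (no step if $m_k=0$) successively set $\Gamma_k^{(j)}:=\frac{v_{k-m_k+j}^{\mathrm T}\bar r_k}{v_{k-m_k+j}^{\mathrm T}q_{k-m_k+j}}$ and replace $\bar x_k$ by $\bar x_k-p_{k-m_k+j}\Gamma_k^{(j)}$ and $\bar r_k$ by $\bar r_k-q_{k-m_k+j}\Gamma_k^{(j)}$. (4) $x_{k+1}:=\bar x_k+\beta_k\bar r_k$, $m_{k+1}:=m_k+1$ (possibly reset to $0$ in iteration $k+1$). $m_k$ denotes the final value in iteration $k$. Process I: restarted ST-AM applied to $x=g(x)$, with mixing parameters satisfying $\beta\le|\beta_k|\le\beta'$ for positive constants $\beta,\beta'$; it yields $\{x_k\}$. Process II: let $\hat h(x)=h'(x^* )(x-x^* )$, use the same $m_k,\beta_k$ as in Process I, and put $\hat r_k=-\hat h(\hat x_k)$. If $m_k=0$: $\hat x_k=x_k$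 and $\hat x_{k+1}=\hat x_k+\beta_k\hat r_k$. If $m_k>0$: $\hat x_{k+1}=\hat x_k+\beta_k\hat r_k-(\hat P_k+\beta_k\hat Q_k)\hat\Gamma_k$, where $\hat P_k=(\hat p_{k-m_k+1},\dots,\hat p_k)$, $\hat Q_k=(\hat q_{k-m_k+1},\dots,\hat q_k)$, $\hat V_k=\hat P_k$ (Type-I) or $\hat V_k=\hat Q_k$ (Type-II), and $\hat\Gamma_k=(\hat\Gamma_k^{(1)},\dots,\hat\Gamma_k^{(m_k)})^{\mathrm T}$ is such that $\hat r_k-\hat Q_k\hat\Gamma_k\perp\mathrm{range}(\hat V_k)$. Here $\hat p_k=\Delta\hat x_{k-1}$, $\hat q_k=\Delta\hat r_{k-1}$ if $m_k=1$; and $\hat p_k=\Delta\hat x_{k-1}-\hat P_{k-1}\hat\zeta_k$, $\hat q_k=\Delta\hat r_{k-1}-\hat Q_{k-1}\hat\zeta_k$ if $m_k\ge2$, with $\hat\zeta_k=(\hat\zeta_k^{(1)},\dots,\hat\zeta_k^{(m_k-1)})^{\mathrm T}$ such that $\hat q_k\perp\mathrm{range}(\hat V_{k-1})$. Tridiagonal matrix $T_k\in\mathbb{R}^{m_k\times m_k}$ (defined when $m_{k+1}\ge2$). Put $\phi_j:=0$ if $m_j=0$ and $\phi_j:=\Gamma_j^{(m_j)}+\zeta_{j+1}^{(m_j)}$ if $m_j\ge1$. For an index $j$ with $m_j\ge1$ in the current cycle set $$t_j^{(m_j-1)}=\frac{\phi_{j-1}}{\beta_{j-1}(1-\Gamma_j^{(m_j)})},\quad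 t_j^{(m_j)}=\frac{1}{1-\Gamma_j^{(m_j)}}\Bigl(\frac1{\beta_{j-1}}-\frac{\phi_j}{\beta_j}\Bigr),\quad t_j^{(m_j+1)}=-\frac{1}{\beta_j(1-\Gamma_j^{(m_j)})}.$$ For $i=1,\dots,m_k$ and $j=k-m_k+i$ (so $m_j=i$), the $i$-th column of $T_k$ has entries $t_j^{(i-1)},t_j^{(i)},t_j^{(i+1)}$ in rows $i-1,i,i+1$ (those rows lying in $\{1,\dots,m_k\}$) and zeros elsewhere. $\hat T_k$ is defined by the same formulas with $\Gamma,\zeta$ replaced by $\hat\Gamma,\hat\zeta$ of Process II. Convention. "For $x_0$ sufficiently close to $x^*$ ... $\hat\kappa\,\mathcal{O}(t)$" means: there are $\varepsilon>0$ and $C>0$, depending on $g$, $x^*$, the fixed constants and the parameters ($m,\tau,\eta,\beta,\beta',\eta_0,\tau_0$) but not on $x_0$ or $k$, such that whenever $\|x_0-x^*\|_2\le\varepsilon$ the assertion holds with $\hat\kappa\,\mathcal{O}(t)$ bounded in absolute value by $\hat\kappa Ct$. *)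

theory Defs
  imports "Jordan_Normal_Form.Spectral_Radius" "HOL-Analysis.Analysis"
begin

(* Positive definiteness of a not necessarily symmetric real matrix is a condition on its
   symmetric part. The latter is real symmetric, so all its eigenvalues are real and
   quantifying over real eigenpairs covers the whole spectrum. *)

definition sym_part :: "real^'n^'n \<Rightarrow> real^'n^'n" where
  "sym_part B = (1/2) *\<^sub>R (B + transpose B)"

definition pos_def :: "real^'n^'n \<Rightarrow> bool" where
  "pos_def B \<longleftrightarrow> (\<forall>(c::real) v. v \<noteq> 0 \<and> sym_part B *v v = c *\<^sub>R v \<longrightarrow> c > 0)"

(* The Lipschitz condition on the Jacobian is with respect to the Frobenius norm (the norm of
   the type real^'n^'n); being Lipschitz does not depend on the choice of the matrix norm. *)

definition assumption_H :: "(real^'n \<Rightarrow> real^'n) \<Rightarrow> real^'n \<Rightarrow> (real^'n) set \<Rightarrow> bool" where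
  "assumption_H h xs U \<longleftrightarrow>
     h xs = 0 \<and>
     open U \<and> xs \<in> U \<and> (\<forall>x\<in>U. h differentiable (at x)) \<and>
     (\<exists>K. K-lipschitz_on U (\<lambda>x. jacobian h (at x))) \<and>
     pos_def (jacobian h (at xs))"

definition local_constants ::
  "(real^'n \<Rightarrow> real^'n) \<Rightarrow> real^'n \<Rightarrow> real \<Rightarrow> real \<Rightarrow> real \<Rightarrow> real \<Rightarrow> bool" where
  "local_constants h xs \<rho> \<kappa> \<mu> L \<longleftrightarrow>
     0 < \<rho> \<and> 0 < \<kappa> \<and> 0 < \<mu> \<and> 0 < L \<and>
     (\<forall>x\<in>cball xs \<rho>.
        h differentiable (at x) \<and>
        (\<forall>y. \<mu> * norm y \<le> norm (jacobian h (at x) *v y) \<and>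
             norm (jacobian h (at x) *v y) \<le> L * norm y \<and>
             \<mu> * (norm y)^2 \<le> y \<bullet> (jacobian h (at x) *v y) \<and>
             y \<bullet> (jacobian h (at x) *v y) \<le> L * (norm y)^2) \<and>
        norm (h x - jacobian h (at xs) *v (x - xs)) \<le> 1/2 * \<kappa> * (norm (x - xs))^2)"

datatype am_type = Type_I | Type_II

fun vsel :: "am_type \<Rightarrow> (nat \<Rightarrow> 'a) \<Rightarrow> (nat \<Rightarrow> 'a) \<Rightarrow> nat \<Rightarrow> 'a" where
  "vsel Type_I p q = p"
| "vsel Type_II p q = q"

(* Both inner loops of the method have the same shape: a pair (u, w) is updated for
   i = a, ..., b - 1 with the coefficient (v_i, w) / (v_i, q_i), taken at the current w.
   sweep_coeff is the coefficient used at index i of the sweep that starts at a. *)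

definition sweep ::
  "(nat \<Rightarrow> real^'n) \<Rightarrow> (nat \<Rightarrow> real^'n) \<Rightarrow> (nat \<Rightarrow> real^'n) \<Rightarrow> nat \<Rightarrow> nat \<Rightarrow>
    (real^'n) \<times> (real^'n) \<Rightarrow> (real^'n) \<times> (real^'n)" where
  "sweep v p q a b uw =
     foldl (\<lambda>(u, w) i. let c = (v i \<bullet> w) / (v i \<bullet> q i) in (u - c *\<^sub>R p i, w - c *\<^sub>R q i))
       uw [a..<b]"

definition sweep_coeff ::
  "(nat \<Rightarrow> real^'n) \<Rightarrow> (nat \<Rightarrow> real^'n) \<Rightarrow> (nat \<Rightarrow> real^'n) \<Rightarrow> nat \<Rightarrow>
    (real^'n) \<times> (real^'n) \<Rightarrow> nat \<Rightarrow> real" where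
  "sweep_coeff v p q a uw i = (v i \<bullet> snd (sweep v p q a i uw)) / (v i \<bullet> q i)"

(* Iteration k. M k is the final value of the counter, m1 its value on entry and m2 its value
   after the first restart test. The loop counter j runs over the absolute index k - m2 + j
   (in the second loop, k - M k + j). If m2 = 0 then p k, q k and \<zeta> k are left unspecified; they are not
   used later. Truncated subtraction is harmless below: max 1 (n - 2) and max 1 (n - 1) agree
   with their integer versions, and the sweeps are over empty ranges where the method
   prescribes no step. *)

definition st_am_iteration ::
  "am_type \<Rightarrow> (real^'n \<Rightarrow> real^'n) \<Rightarrow> (nat \<Rightarrow> real) \<Rightarrow> nat \<Rightarrow> real \<Rightarrow> real \<Rightarrow>
    (nat \<Rightarrow> real^'n) \<Rightarrow> (nat \<Rightarrow> real^'n) \<Rightarrow> (nat \<Rightarrow> real^'n) \<Rightarrow> (nat \<Rightarrow> nat) \<Rightarrow>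
    (nat \<Rightarrow> nat \<Rightarrow> real) \<Rightarrow> (nat \<Rightarrow> nat \<Rightarrow> real) \<Rightarrow> nat \<Rightarrow> bool" where
  "st_am_iteration ty g bt m \<tau> \<eta> x p q M \<zeta> \<Gamma> k \<longleftrightarrow>
     (let r = (\<lambda>i. g (x i) - x i);
          v = vsel ty p q;
          m1 = (if k = 0 then 0 else M (k - 1) + 1);
          m2 = (if m1 > m \<or> norm (r k) > \<eta> * norm (r (k - m1)) then 0 else m1);
          a = k - m2 + max 1 (m2 - 2);
          dxr = (x k - x (k - 1), r k - r (k - 1));
          c = k - M k + max 1 (M k - 1)
      in (m2 > 0 \<longrightarrow>
            (p k, q k) = sweep v p q a k dxr \<and>
            (\<forall>j\<in>{max 1 (m2 - 2)..m2 - 1}. \<zeta> k j = sweep_coeff v p q a dxr (k - m2 + j))) \<and>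
         M k = (if m2 > 0 \<and> \<bar>v k \<bullet> q k\<bar> < \<tau> * \<bar>v (k - m2 + 1) \<bullet> q (k - m2 + 1)\<bar>
                then 0 else m2) \<and>
         (\<forall>j\<in>{max 1 (M k - 1)..M k}. \<Gamma> k j = sweep_coeff v p q c (x k, r k) (k - M k + j)) \<and>
         (let (xb, rb) = sweep v p q c (k + 1) (x k, r k) in x (k + 1) = xb + bt k *\<^sub>R rb))"

(* The iterations 0, ..., K are carried out, i.e. the method has not stopped before or at K. *)

definition restarted_st_am ::
  "am_type \<Rightarrow> (real^'n \<Rightarrow> real^'n) \<Rightarrow> (nat \<Rightarrow> real) \<Rightarrow> nat \<Rightarrow> real \<Rightarrow> real \<Rightarrow>
    (nat \<Rightarrow> real^'n) \<Rightarrow> (nat \<Rightarrow> real^'n) \<Rightarrow> (nat \<Rightarrow> real^'n) \<Rightarrow> (nat \<Rightarrow> nat) \<Rightarrow>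
    (nat \<Rightarrow> nat \<Rightarrow> real) \<Rightarrow> (nat \<Rightarrow> nat \<Rightarrow> real) \<Rightarrow> nat \<Rightarrow> bool" where
  "restarted_st_am ty g bt m \<tau> \<eta> x p q M \<zeta> \<Gamma> K \<longleftrightarrow>
     (\<forall>k\<le>K. g (x k) - x k \<noteq> 0 \<and> st_am_iteration ty g bt m \<tau> \<eta> x p q M \<zeta> \<Gamma> k)"

(* Process II for the linear map A (x - xs), with the counters M, the parameters bt and the
   restart points x of Process I, through iteration K. Products of a matrix of columns with a
   coefficient vector are written as sums, which are empty for M k = 0 (resp. M k = 1), and the
   range of such a matrix is the span of its columns. At a restart (M k = 0) the value
   xh k = x k replaces the one the update formula of iteration k - 1 would give. *)

definition process_II ::
  "am_type \<Rightarrow> real^'n^'n \<Rightarrow> real^'n \<Rightarrow> (nat \<Rightarrow> real) \<Rightarrow> (nat \<Rightarrow> nat) \<Rightarrow> (nat \<Rightarrow> real^'n) \<Rightarrow>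
    (nat \<Rightarrow> real^'n) \<Rightarrow> (nat \<Rightarrow> real^'n) \<Rightarrow> (nat \<Rightarrow> real^'n) \<Rightarrow>
    (nat \<Rightarrow> nat \<Rightarrow> real) \<Rightarrow> (nat \<Rightarrow> nat \<Rightarrow> real) \<Rightarrow> nat \<Rightarrow> bool" where
  "process_II ty A xs bt M x xh ph qh \<zeta>h \<Gamma>h K \<longleftrightarrow>
     (let rh = (\<lambda>i. - (A *v (xh i - xs)));
          vh = vsel ty ph qh
      in (\<forall>k\<le>K. M k = 0 \<longrightarrow> xh k = x k) \<and>
         (\<forall>k<K. M (k + 1) \<noteq> 0 \<longrightarrow>
            xh (k + 1) = xh k + bt k *\<^sub>R rh k
              - (\<Sum>j=1..M k. \<Gamma>h k j *\<^sub>R (ph (k - M k + j) + bt k *\<^sub>R qh (k - M k + j)))) \<and>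
         (\<forall>k\<le>K. M k \<ge> 1 \<longrightarrow>
            ph k = (xh k - xh (k - 1)) - (\<Sum>j=1..M k - 1. \<zeta>h k j *\<^sub>R ph (k - M k + j)) \<and>
            qh k = (rh k - rh (k - 1)) - (\<Sum>j=1..M k - 1. \<zeta>h k j *\<^sub>R qh (k - M k + j)) \<and>
            (\<forall>w\<in>span (vh ` {k - M k + 1..k - 1}). w \<bullet> qh k = 0) \<and>
            (\<forall>w\<in>span (vh ` {k - M k + 1..k}).
               w \<bullet> (rh k - (\<Sum>j=1..M k. \<Gamma>h k j *\<^sub>R qh (k - M k + j))) = 0)))"

definition phi ::
  "(nat \<Rightarrow> nat) \<Rightarrow> (nat \<Rightarrow> nat \<Rightarrow> real) \<Rightarrow> (nat \<Rightarrow> nat \<Rightarrow> real) \<Rightarrow> nat \<Rightarrow> real" where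
  "phi M \<zeta> \<Gamma> j = (if M j = 0 then 0 else \<Gamma> j (M j) + \<zeta> (j + 1) (M j))"

(* Matrix indices of the type mat are 0-based: the (0-based) column c is column i = c + 1
   and belongs to the iteration j = k - M k + i. The matrix is taken over the complex numbers
   so that spectrum is the full spectrum. *)

definition tridiag ::
  "(nat \<Rightarrow> real) \<Rightarrow> (nat \<Rightarrow> nat) \<Rightarrow> (nat \<Rightarrow> nat \<Rightarrow> real) \<Rightarrow> (nat \<Rightarrow> nat \<Rightarrow> real) \<Rightarrow> nat \<Rightarrow>
    complex Matrix.mat" where
  "tridiag bt M \<zeta> \<Gamma> k = Matrix.mat (M k) (M k) (\<lambda>(a, c).
     let i = c + 1; j = k - M k + i; e = 1 - \<Gamma> j (M j) in
     complex_of_real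
      (if a + 1 = c then phi M \<zeta> \<Gamma> (j - 1) / (bt (j - 1) * e)
       else if a = c then 1 / e * (1 / bt (j - 1) - phi M \<zeta> \<Gamma> j / bt j)
       else if a = c + 1 then - 1 / (bt j * e)
       else 0))"

end

theory Submission
  imports Defs
begin

text \<open>Under a perturbation of size \<open>\<epsilon>\<close> the eigenvalues of a matrix of order \<open>n\<close> move, in general, by
  \<open>\<epsilon>\<^sup>1\<^sup>/\<^sup>n\<close>. The estimate here is linear in \<open>\<delta> = norm (x s - xs)\<close>, where \<open>s\<close> is the index of the last
  restart, because the matrix of Process II is symmetric up to a diagonal scaling that is well
  conditioned, uniformly in \<open>\<delta>\<close>.

  Symmetry. Write \<open>A\<close> for the Jacobian of \<open>h\<close> at \<open>xs\<close>, a symmetric matrix. The directions of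
  Process II satisfy \<open>q j = - A p j\<close> and \<open>v i \<bullet> q j = 0\<close> for \<open>i \<noteq> j\<close>, and \<open>A q j\<close> is the combination of
  \<open>q (j - 1)\<close>, \<open>q j\<close>, \<open>q (j + 1)\<close> whose coefficients are the entries of column \<open>j\<close> of the matrix
  (\<open>three_term\<close>). Taking inner products, entry \<open>(i, j)\<close> times \<open>v i \<bullet> q i\<close> equals \<open>v i \<bullet> A q j\<close>, which is
  symmetric in \<open>i\<close> and \<open>j\<close>. So the matrix is self-adjoint for the inner product with weights
  \<open>\<bar>v i \<bullet> q i\<bar>\<close> (\<open>tri_weighted_symmetric\<close>). For such a matrix the residual of an approximate
  eigenvector bounds the distance to the spectrum, up to the square root of the quotient of the
  extreme weights (\<open>eigenvalue_perturbation_weighted_symmetric\<close>). All weights are of exact order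
  \<open>\<delta>\<^sup>2\<close>: strong monotonicity of \<open>h\<close> gives this for the first direction of a cycle, and the second
  restart test of the method, \<open>\<tau> \<bar>v 1 \<bullet> q 1\<bar> \<le> \<bar>v i \<bullet> q i\<bar>\<close>, carries it to the others.

  Closeness of the entries. For a symmetric linear map the full-memory recurrences of Process II
  collapse to the short recurrences of the method (\<open>pq_sweep\<close>, \<open>x_sweep\<close>). Hence both processes
  perform the same arithmetic operations, started from the same point, and their only difference
  is that one evaluates \<open>h\<close> and the other its linearisation, with an error of order \<open>\<delta>\<^sup>2\<close>. The
  relation \<open>near e f f'\<close>, meaning that \<open>f\<close> has order \<open>\<delta>\<^sup>e\<close> and \<open>f - f'\<close> is smaller by one order, is
  preserved by sums, products, and division by quantities bounded below by their order. An
  induction along the cycle, which has at most \<open>m\<close> steps, propagates it from the iterates to the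
  entries of the two matrices, which therefore differ by a quantity of order \<open>\<delta>\<close>.

  Uniformity. The constants may depend neither on \<open>x 0\<close> nor on \<open>k\<close>. Therefore the orders are
  taken along a filter on the set of all possible cycles of a given length, directed towards
  \<open>\<delta> = 0\<close>. It remains to know that every iterate is close to \<open>xs\<close>. The hypothesis on the residuals
  bounds the error only of points that are already known to be near \<open>xs\<close>, since \<open>h\<close> may be small
  elsewhere; but within a cycle the next iterate is at most a constant times as far away as the
  restart point (\<open>next_iterate_bound\<close>), so it still lies in the ball where \<open>h\<close> is controlled, and
  there the hypothesis on the residuals yields a bound that does not deteriorate with the number of
  iterations.\<close>


no_notation Matrix.scalar_prod (infix "\<bullet>" 70)

section \<open>Eigenvalues near approximate eigenvalues of symmetric operators\<close>

lemma quadratic_perturbation_zero: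
  fixes b c :: real
  assumes "\<And>t. 0 \<le> 2 * t * b + t\<^sup>2 * c"
  shows "b = 0"
proof (rule ccontr)
  assume "b \<noteq> 0"
  define C where "C = \<bar>c\<bar> + 1"
  have C: "C > 0" "c \<le> C" by (auto simp: C_def)
  define t where "t = - b / C"
  have "t\<^sup>2 * c \<le> t\<^sup>2 * C" using C(2) by (rule mult_left_mono) simp
  with assms[of t] have "0 \<le> 2 * t * b + t\<^sup>2 * C" by linarith
  also have "\<dots> = - b\<^sup>2 / C"
    using C(1) by (simp add: t_def field_simps power2_eq_square)
  finally show False using \<open>b \<noteq> 0\<close> C(1) by (simp add: field_simps)
qed

text \<open>Let \<open>B = f - s\<close> and let \<open>e\<close> minimise \<open>norm (B u)\<close> on the unit sphere of \<open>W\<close>, with minimum \<open>\<sigma>\<close>. First-order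
  optimality reads \<open>B (B e) = \<sigma>\<^sup>2 e\<close>, that is, \<open>(B + \<sigma>) (B - \<sigma>) e = 0\<close>. So either \<open>e\<close> or \<open>B e - \<sigma> e\<close> is an
  eigenvector, and the eigenvalue of \<open>f\<close> is at distance exactly \<open>\<sigma>\<close> from \<open>s\<close>. This gives the bound that
  one would usually read off from a spectral decomposition.\<close>

lemma symmetric_eigenvalue_near:
  fixes f :: "'a::euclidean_space \<Rightarrow> 'a"
  assumes f: "linear f" and W: "Real_Vector_Spaces.subspace W" "W \<noteq> {0}"
    and inv: "\<And>u. u \<in> W \<Longrightarrow> f u \<in> W"
    and sym: "\<And>u z. u \<in> W \<Longrightarrow> z \<in> W \<Longrightarrow> f u \<bullet> z = u \<bullet> f z"
  shows "\<exists>c e. e \<in> W \<and> e \<noteq> 0 \<and> f e = c *\<^sub>R e \<and>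
    (\<forall>u\<in>W. \<bar>c - s\<bar> * norm u \<le> norm (f u - s *\<^sub>R u))"
proof -
  define B where "B u = f u - s *\<^sub>R u" for u
  have B: "linear B" unfolding B_def
    by (intro linear_compose_sub f linear_scale_self)
  have Binv: "B u \<in> W" if "u \<in> W" for u
    unfolding B_def using that inv W(1) by (auto intro: subspace_diff subspace_scale)
  have Bsym: "B u \<bullet> z = u \<bullet> B z" if "u \<in> W" "z \<in> W" for u z
    using sym[OF that] by (simp add: B_def inner_diff_left inner_diff_right)
  let ?S = "W \<inter> sphere 0 1"
  obtain w where w: "w \<in> W" "w \<noteq> 0" using W subspace_0 by blast
  then have "w /\<^sub>R norm w \<in> ?S" using W(1) by (auto intro: subspace_scale)
  then have "?S \<noteq> {}" by blast
  moreover have "compact ?S"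
    using closed_subspace[OF W(1)] by (intro closed_Int_compact) auto
  moreover have "continuous_on ?S (\<lambda>u. norm (B u))"
    using B by (intro continuous_on_norm linear_continuous_on linear_conv_bounded_linear[THEN iffD1])
  ultimately obtain e where e: "e \<in> ?S" and emin: "\<And>u. u \<in> ?S \<Longrightarrow> norm (B e) \<le> norm (B u)"
    by (meson continuous_attains_inf)
  have eW: "e \<in> W" and e1: "norm e = 1" using e by auto
  define \<sigma> where "\<sigma> = norm (B e)"
  have min: "\<sigma> * norm u \<le> norm (B u)" if "u \<in> W" for u
  proof (cases "u = 0")
    case False
    have "\<sigma> \<le> norm (B (u /\<^sub>R norm u))" unfolding \<sigma>_def
      by (rule emin) (use that False W(1) in \<open>auto intro: subspace_scale\<close>)
    also have "\<dots> = norm (B u) / norm u"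
      by (simp add: linear_cmul[OF B] divide_inverse)
    finally show ?thesis using False by (simp add: field_simps)
  qed simp
  \<comment> \<open>First-order optimality of the minimiser \<open>e\<close>, tested in every direction of \<open>W\<close>.\<close>
  have "(B (B e) - \<sigma>\<^sup>2 *\<^sub>R e) \<bullet> u = 0" if u: "u \<in> W" for u
  proof (rule quadratic_perturbation_zero)
    fix t :: real
    have "(\<sigma> * norm (e + t *\<^sub>R u))\<^sup>2 \<le> (norm (B (e + t *\<^sub>R u)))\<^sup>2"
      by (rule power_mono[OF min]) (use eW u W(1) in \<open>auto simp: \<sigma>_def intro: subspace_add subspace_scale\<close>)
    moreover have "(\<sigma> * norm (e + t *\<^sub>R u))\<^sup>2 = \<sigma>\<^sup>2 * (1 + 2 * t * (e \<bullet> u) + t\<^sup>2 * (u \<bullet> u))"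
      unfolding power_mult_distrib power2_norm_eq_inner
      using e1 by (simp add: inner_add_left inner_add_right norm_eq_1 inner_commute[of u e]
          power2_eq_square algebra_simps)
    moreover have "(norm (B (e + t *\<^sub>R u)))\<^sup>2 = \<sigma>\<^sup>2 + 2 * t * (B e \<bullet> B u) + t\<^sup>2 * (B u \<bullet> B u)"
      unfolding \<sigma>_def power2_norm_eq_inner linear_add[OF B] linear_cmul[OF B]
      by (simp add: inner_add_left inner_add_right inner_commute[of "B u" "B e"]
          power2_eq_square algebra_simps)
    moreover have "B (B e) \<bullet> u = B e \<bullet> B u" using Bsym[OF Binv[OF eW] u] .
    ultimately show "0 \<le> 2 * t * ((B (B e) - \<sigma>\<^sup>2 *\<^sub>R e) \<bullet> u) + t\<^sup>2 * (B u \<bullet> B u - \<sigma>\<^sup>2 * (u \<bullet> u))"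
      by (simp add: inner_diff_left algebra_simps)
  qed
  moreover have "B (B e) - \<sigma>\<^sup>2 *\<^sub>R e \<in> W"
    using Binv[OF Binv[OF eW]] eW W(1) by (intro subspace_diff subspace_scale)
  ultimately have "(B (B e) - \<sigma>\<^sup>2 *\<^sub>R e) \<bullet> (B (B e) - \<sigma>\<^sup>2 *\<^sub>R e) = 0" by blast
  then have BB: "B (B e) = \<sigma>\<^sup>2 *\<^sub>R e" by simp
  define z where "z = B e - \<sigma> *\<^sub>R e"
  have Bz: "B z = - \<sigma> *\<^sub>R z"
    unfolding z_def by (simp add: linear_diff[OF B] linear_cmul[OF B] BB algebra_simps power2_eq_square)
  have zW: "z \<in> W" unfolding z_def using Binv eW W(1) by (auto intro: subspace_diff subspace_scale)
  have \<sigma>0: "\<sigma> \<ge> 0" by (simp add: \<sigma>_def)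
  show ?thesis
  proof (cases "z = 0")
    case True
    then have "f e = (s + \<sigma>) *\<^sub>R e" by (simp add: z_def B_def algebra_simps)
    moreover have "e \<noteq> 0" using e1 by auto
    ultimately show ?thesis using eW min \<sigma>0 by (intro exI[of _ "s + \<sigma>"] exI[of _ e]) (auto simp: B_def)
  next
    case False
    have "f z = (s - \<sigma>) *\<^sub>R z" using Bz by (simp add: B_def algebra_simps)
    then show ?thesis using zW False min \<sigma>0
      by (intro exI[of _ "s - \<sigma>"] exI[of _ z]) (auto simp: B_def)
  qed
qed

definition mat_app :: "nat \<Rightarrow> (nat \<Rightarrow> nat \<Rightarrow> 'a) \<Rightarrow> (nat \<Rightarrow> 'a) \<Rightarrow> nat \<Rightarrow> 'a::comm_ring_1" where
  "mat_app n t y a = (\<Sum>c<n. t a c * y c)"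

text \<open>Conjugation by the square roots of the weights \<open>d\<close> makes the matrix \<open>t\<close> symmetric. The coordinates are
  realised as the span of \<open>n\<close> basis vectors of some Euclidean space of sufficient dimension, so
  that \<open>n\<close> can remain a variable.\<close>

lemma weighted_symmetric_eigenvalue_near:
  fixes t :: "nat \<Rightarrow> nat \<Rightarrow> real" and d :: "nat \<Rightarrow> real" and E :: "nat \<Rightarrow> 'a::euclidean_space"
  assumes n: "0 < n" "n \<le> DIM('a)"
    and d: "\<And>a. a < n \<Longrightarrow> d a > 0"
    and sym: "\<And>a c. a < n \<Longrightarrow> c < n \<Longrightarrow> d a * t a c = d c * t c a"
  shows "\<exists>c y. (\<exists>a<n. y a \<noteq> 0) \<and> (\<forall>a<n. mat_app n t y a = c * y a) \<and>
     (\<forall>u. (c - s)\<^sup>2 * (\<Sum>a<n. d a * (u a)\<^sup>2) \<le> (\<Sum>a<n. d a * (mat_app n t u a - s * u a)\<^sup>2))"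
proof -
  obtain E :: "nat \<Rightarrow> 'a" where E: "inj_on E {..<n}" "E ` {..<n} \<subseteq> Basis"
    using n(2) card_le_inj[of "{..<n}" "Basis :: 'a set"] by auto
  have ort: "E a \<bullet> E c = (if a = c then 1 else 0)" if "a < n" "c < n" for a c
    using that E by (auto simp: inner_Basis inj_on_eq_iff image_subset_iff)
  define D where "D a = sqrt (d a)" for a
  have D: "D a > 0" "D a * D a = d a" if "a < n" for a using d[OF that] by (auto simp: D_def)
  define W where "W = span (E ` {..<n})"
  define vec where "vec y = (\<Sum>a<n. (D a * y a) *\<^sub>R E a)" for y
  define f where "f u = (\<Sum>a<n. (\<Sum>c<n. D a * t a c / D c * (E c \<bullet> u)) *\<^sub>R E a)" for u
  have coord: "E a \<bullet> vec y = D a * y a" if "a < n" for a y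
    unfolding vec_def inner_sum_right using that by (simp add: ort if_distrib cong: if_cong)
  have vecW: "vec y \<in> W" for y
    unfolding vec_def W_def by (intro span_sum span_scale span_base) auto
  have Wvec: "\<exists>y. u = vec y" if "u \<in> W" for u
  proof -
    obtain r where "u = (\<Sum>w\<in>E ` {..<n}. r w *\<^sub>R w)"
      using \<open>u \<in> W\<close> unfolding W_def by (auto simp: span_finite)
    then have "u = (\<Sum>a<n. r (E a) *\<^sub>R E a)" using sum.reindex[OF E(1)] by (simp add: o_def)
    also have "\<dots> = vec (\<lambda>a. r (E a) / D a)" unfolding vec_def
      by (rule sum.cong) (use D in force)+
    finally show ?thesis by blast
  qed
  have fvec: "f (vec y) = vec (mat_app n t y)" for y
  proof -
    have "(\<Sum>c<n. D a * t a c / D c * (E c \<bullet> vec y)) = D a * mat_app n t y a" for a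
      unfolding mat_app_def sum_distrib_left
    proof (rule sum.cong)
      fix c assume "c \<in> {..<n}"
      then have "c < n" by simp
      then show "D a * t a c / D c * (E c \<bullet> vec y) = D a * (t a c * y c)"
        using D(1)[of c] by (simp add: coord)
    qed simp
    then show ?thesis by (simp add: f_def vec_def[of "mat_app n t y"])
  qed
  have vec_inner: "vec y \<bullet> vec z = (\<Sum>a<n. d a * (y a * z a))" for y z
    by (subst vec_def, unfold inner_sum_left)
       (auto intro!: sum.cong simp: coord D(2)[symmetric] algebra_simps)
  have "\<exists>c e. e \<in> W \<and> e \<noteq> 0 \<and> f e = c *\<^sub>R e \<and>
    (\<forall>u\<in>W. \<bar>c - s\<bar> * norm u \<le> norm (f u - s *\<^sub>R u))"
  proof (rule symmetric_eigenvalue_near)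
    show "linear f"
    proof (rule linearI)
      show "f (u + z) = f u + f z" for u z
        unfolding f_def inner_add_right distrib_left sum.distrib scaleR_add_left ..
      show "f (r *\<^sub>R u) = r *\<^sub>R f u" for r u
        unfolding f_def scaleR_sum_right inner_scaleR_right scaleR_scaleR sum_distrib_left
        by (simp add: mult.left_commute)
    qed
    show "Real_Vector_Spaces.subspace W" by (simp add: W_def)
    have "E 0 \<in> W" "E 0 \<noteq> 0" using n(1) ort[of 0 0] by (auto simp: W_def intro: span_base)
    then show "W \<noteq> {0}" by auto
    show "f u \<in> W" if "u \<in> W" for u using Wvec[OF that] by (auto simp: fvec vecW)
    show "f u \<bullet> z = u \<bullet> f z" if uz: "u \<in> W" "z \<in> W" for u z
    proof -
      obtain y y' where y: "u = vec y" "z = vec y'" using Wvec uz by meson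
      have "f u \<bullet> z = (\<Sum>a<n. \<Sum>c<n. (d a * t a c) * y c * y' a)"
        by (simp add: y fvec vec_inner mat_app_def sum_distrib_left sum_distrib_right algebra_simps)
      also have "\<dots> = (\<Sum>a<n. \<Sum>c<n. (d c * t c a) * y c * y' a)"
        using sym by (intro sum.cong refl) simp
      also have "\<dots> = (\<Sum>c<n. \<Sum>a<n. (d c * t c a) * y c * y' a)" by (rule sum.swap)
      also have "\<dots> = u \<bullet> f z"
        by (simp add: y fvec vec_inner mat_app_def sum_distrib_left sum_distrib_right algebra_simps)
      finally show ?thesis .
    qed
  qed
  then obtain c e where ce: "e \<in> W" "e \<noteq> 0" "f e = c *\<^sub>R e"
    and bound: "\<And>u. u \<in> W \<Longrightarrow> \<bar>c - s\<bar> * norm u \<le> norm (f u - s *\<^sub>R u)" by blast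
  obtain y where y: "e = vec y" using Wvec[OF ce(1)] by blast
  have "\<exists>a<n. y a \<noteq> 0"
  proof (rule ccontr)
    assume "\<not> (\<exists>a<n. y a \<noteq> 0)"
    then have "vec y = 0" unfolding vec_def by (intro sum.neutral) auto
    then show False using ce(2) y by simp
  qed
  moreover have "mat_app n t y a = c * y a" if "a < n" for a
  proof -
    have "E a \<bullet> vec (mat_app n t y) = E a \<bullet> (c *\<^sub>R vec y)" using ce(3) by (simp add: y fvec)
    then have "D a * mat_app n t y a = D a * (c * y a)"
      by (simp add: coord that)
    then show ?thesis using D(1)[OF that] by simp
  qed
  moreover have "(c - s)\<^sup>2 * (\<Sum>a<n. d a * (u a)\<^sup>2) \<le> (\<Sum>a<n. d a * (mat_app n t u a - s * u a)\<^sup>2)" for u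
  proof -
    have "f (vec u) - s *\<^sub>R vec u = vec (\<lambda>a. mat_app n t u a - s * u a)"
      unfolding fvec by (simp add: vec_def scaleR_sum_right algebra_simps flip: sum_subtractf)
    then have "(\<bar>c - s\<bar> * norm (vec u))\<^sup>2 \<le> (norm (vec (\<lambda>a. mat_app n t u a - s * u a)))\<^sup>2"
      using bound[OF vecW[of u]] by (intro power_mono) auto
    then show ?thesis
      by (simp add: power_mult_distrib power2_norm_eq_inner vec_inner flip: power2_eq_square)
  qed
  ultimately show ?thesis by blast
qed

text \<open>An eigenvector \<open>w\<close> of \<open>t\<close> is an approximate eigenvector of \<open>t'\<close>. Its real and imaginary parts are
  treated by the real lemma; for self-adjoint \<open>t'\<close> the imaginary part of \<open>lam\<close> contributes a square of
  its own to the residual, so the approximation of a complex \<open>lam\<close> by a real eigenvalue costs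
  nothing. The number \<open>R\<close> bounds the quotient of the weights, and its square root is the condition
  number of the scaling.\<close>

lemma eigenvalue_perturbation_weighted_symmetric:
  fixes t t' :: "nat \<Rightarrow> nat \<Rightarrow> real" and d :: "nat \<Rightarrow> real" and lam :: complex
  assumes n: "0 < n" "n \<le> DIM('a::euclidean_space)"
    and dpos: "0 < dmin" and d: "\<And>a. a < n \<Longrightarrow> dmin \<le> d a \<and> d a \<le> R * dmin"
    and sym: "\<And>a c. a < n \<Longrightarrow> c < n \<Longrightarrow> d a * t' a c = d c * t' c a"
    and close: "\<And>a c. a < n \<Longrightarrow> c < n \<Longrightarrow> \<bar>t' a c - t a c\<bar> \<le> \<epsilon>"
    and w: "\<exists>a<n. w a \<noteq> 0" "\<And>a. a < n \<Longrightarrow> mat_app n (\<lambda>a c. complex_of_real (t a c)) w a = lam * w a"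
  shows "\<exists>c y. (\<exists>a<n. y a \<noteq> 0) \<and> (\<forall>a<n. mat_app n t' y a = c * y a) \<and>
     cmod (complex_of_real c - lam) \<le> real n * sqrt R * \<epsilon>"
proof -
  define s b where "s = Re lam" and "b = Im lam"
  define y z where "y a = Re (w a)" and "z a = Im (w a)" for a
  have d0: "d a > 0" if "a < n" for a using d[OF that] dpos by linarith
  obtain c yc where c: "(\<exists>a<n. yc a \<noteq> 0) \<and> (\<forall>a<n. mat_app n t' yc a = c * yc a) \<and>
     (\<forall>u. (c - s)\<^sup>2 * (\<Sum>a<n. d a * (u a)\<^sup>2) \<le> (\<Sum>a<n. d a * (mat_app n t' u a - s * u a)\<^sup>2))"
  proof -
    have "\<exists>c y. (\<exists>a<n. y a \<noteq> 0) \<and> (\<forall>a<n. mat_app n t' y a = c * y a) \<and>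
     (\<forall>u. (c - s)\<^sup>2 * (\<Sum>a<n. d a * (u a)\<^sup>2) \<le> (\<Sum>a<n. d a * (mat_app n t' u a - s * u a)\<^sup>2))"
      by (rule weighted_symmetric_eigenvalue_near[where 'a='a]) (fact n | erule d0 | erule (1) sym)+
    then show ?thesis by (elim exE) (rule that)
  qed
  note cb = c[THEN conjunct2, THEN conjunct2, rule_format]
  define g where "g a = mat_app n (\<lambda>a c. complex_of_real (t' a c)) w a - lam * w a" for a
  define S where "S = (\<Sum>a<n. d a * (cmod (w a))\<^sup>2)"
  have R0: "R \<ge> 1" 
  proof -
    have "1 * dmin \<le> R * dmin" using d[OF n(1)] by linarith
    then show ?thesis using dpos by (simp only: mult_le_cancel_right_pos)
  qed
  have e0: "\<epsilon> \<ge> 0" using close[of 0 0] n(1) by linarith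
  have S0: "S \<ge> 0" unfolding S_def
    by (intro sum_nonneg mult_nonneg_nonneg) (auto intro: less_imp_le d0)
  define Y Z where "Y a = mat_app n t' y a - s * y a" and "Z a = mat_app n t' z a - s * z a" for a
  have Reg: "Re (g a) = Y a + b * z a" and Img: "Im (g a) = Z a - b * y a" for a
    unfolding g_def mat_app_def Y_def Z_def y_def z_def s_def b_def by simp_all
  \<comment> \<open>The cross terms cancel because \<open>t'\<close> is symmetric for the weighted inner product.\<close>
  have cross: "(\<Sum>a<n. d a * (Y a * z a)) = (\<Sum>a<n. d a * (Z a * y a))"
  proof -
    have "(\<Sum>a<n. d a * (mat_app n t' y a * z a)) = (\<Sum>a<n. \<Sum>c<n. (d a * t' a c) * y c * z a)"
      by (simp add: mat_app_def sum_distrib_left sum_distrib_right algebra_simps)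
    also have "\<dots> = (\<Sum>a<n. \<Sum>c<n. (d c * t' c a) * y c * z a)"
      using sym by (intro sum.cong refl) simp
    also have "\<dots> = (\<Sum>c<n. \<Sum>a<n. (d c * t' c a) * y c * z a)" by (rule sum.swap)
    also have "\<dots> = (\<Sum>a<n. d a * (mat_app n t' z a * y a))"
      by (simp add: mat_app_def sum_distrib_left sum_distrib_right algebra_simps)
    finally show ?thesis by (simp add: Y_def Z_def algebra_simps sum_subtractf)
  qed
  have S: "S = (\<Sum>a<n. d a * (y a)\<^sup>2) + (\<Sum>a<n. d a * (z a)\<^sup>2)"
    unfolding S_def cmod_power2 y_def z_def distrib_left sum.distrib ..
  have "(cmod (of_real c - lam))\<^sup>2 * S = ((c - s)\<^sup>2 + b\<^sup>2) * S"
    by (simp add: cmod_power2 s_def b_def)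
  also have "\<dots> = (c - s)\<^sup>2 * (\<Sum>a<n. d a * (y a)\<^sup>2) + (c - s)\<^sup>2 * (\<Sum>a<n. d a * (z a)\<^sup>2)
      + b\<^sup>2 * (\<Sum>a<n. d a * (y a)\<^sup>2) + b\<^sup>2 * (\<Sum>a<n. d a * (z a)\<^sup>2)"
    unfolding S distrib_left distrib_right by simp
  also have "\<dots> \<le> (\<Sum>a<n. d a * (Y a)\<^sup>2) + (\<Sum>a<n. d a * (Z a)\<^sup>2)
      + b\<^sup>2 * (\<Sum>a<n. d a * (y a)\<^sup>2) + b\<^sup>2 * (\<Sum>a<n. d a * (z a)\<^sup>2)"
    using cb[of y] cb[of z] by (simp add: Y_def Z_def)
  also have "\<dots> = (\<Sum>a<n. d a * (Y a)\<^sup>2) + (\<Sum>a<n. d a * (Z a)\<^sup>2)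
      + b\<^sup>2 * (\<Sum>a<n. d a * (y a)\<^sup>2) + b\<^sup>2 * (\<Sum>a<n. d a * (z a)\<^sup>2)
      + 2 * b * (\<Sum>a<n. d a * (Y a * z a)) - 2 * b * (\<Sum>a<n. d a * (Z a * y a))"
    using cross by simp
  also have "\<dots> = (\<Sum>a<n. d a * (cmod (g a))\<^sup>2)"
    unfolding cmod_power2 Reg Img sum_distrib_left sum.distrib[symmetric] sum_subtractf[symmetric]
    by (intro sum.cong refl) (simp add: algebra_simps power2_eq_square)
  also have "\<dots> \<le> (\<Sum>a<n. d a * (\<epsilon>\<^sup>2 * (real n * (S / dmin))))"
  proof (intro sum_mono mult_left_mono)
    fix a assume "a \<in> {..<n}" then have a: "a < n" by simp
    have "g a = (\<Sum>c<n. complex_of_real (t' a c - t a c) * w c)"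
      using w(2)[OF a] by (simp add: g_def mat_app_def algebra_simps sum_subtractf)
    then have "cmod (g a) \<le> (\<Sum>c<n. \<bar>t' a c - t a c\<bar> * cmod (w c))"
      by (simp add: order_trans[OF norm_sum] norm_mult del: of_real_diff)
    also have "\<dots> \<le> (\<Sum>c<n. \<epsilon> * cmod (w c))"
      using close[OF a] by (intro sum_mono mult_right_mono) auto
    finally have "(cmod (g a))\<^sup>2 \<le> (\<epsilon> * (\<Sum>c<n. cmod (w c)))\<^sup>2"
      by (intro power_mono) (auto simp: sum_distrib_left)
    also have "\<dots> \<le> \<epsilon>\<^sup>2 * (real n * (\<Sum>c<n. (cmod (w c))\<^sup>2))"
      unfolding power_mult_distrib
      using sum_squared_le_sum_of_squares[of "\<lambda>c. cmod (w c)" "{..<n}"]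
      by (intro mult_left_mono) (auto simp: mult.commute)
    also have "\<dots> \<le> \<epsilon>\<^sup>2 * (real n * (S / dmin))"
    proof (intro mult_left_mono)
      have "dmin * (\<Sum>c<n. (cmod (w c))\<^sup>2) \<le> S" unfolding S_def sum_distrib_left
        using d by (intro sum_mono mult_right_mono) auto
      then show "(\<Sum>c<n. (cmod (w c))\<^sup>2) \<le> S / dmin" using dpos by (simp add: field_simps)
    qed auto
    finally show "(cmod (g a))\<^sup>2 \<le> \<epsilon>\<^sup>2 * (real n * (S / dmin))" .
    show "0 \<le> d a" using d0[OF a] by simp
  qed
  also have "\<dots> \<le> (\<Sum>a<n. (R * dmin) * (\<epsilon>\<^sup>2 * (real n * (S / dmin))))"
    using d S0 dpos by (intro sum_mono mult_right_mono) auto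
  also have "\<dots> = (real n * sqrt R * \<epsilon>)\<^sup>2 * S"
    using R0 dpos by (simp add: power_mult_distrib power2_eq_square)
  finally have "(cmod (of_real c - lam))\<^sup>2 * S \<le> (real n * sqrt R * \<epsilon>)\<^sup>2 * S" .
  moreover have "S > 0"
  proof -
    obtain a where a: "a < n" "w a \<noteq> 0" using w(1) by blast
    then have "0 < d a * (cmod (w a))\<^sup>2" using d0 by simp
    moreover have "0 \<le> d i * (cmod (w i))\<^sup>2" if "i < n" for i
      using d0[OF that] by simp
    ultimately show ?thesis unfolding S_def using \<open>a < n\<close> by (intro sum_pos2[of _ a]) auto
  qed
  ultimately have "(cmod (of_real c - lam))\<^sup>2 \<le> (real n * sqrt R * \<epsilon>)\<^sup>2" by simp
  then have "cmod (of_real c - lam) \<le> real n * sqrt R * \<epsilon>"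
    by (rule power2_le_imp_le) (use R0 e0 in auto)
  with c show ?thesis by blast
qed

lemma spectrum_mat_iff:
  "lam \<in> spectrum (Matrix.mat n n (\<lambda>(a, c). t a c)) \<longleftrightarrow>
     (\<exists>w. (\<exists>a<n. w a \<noteq> 0) \<and> (\<forall>a<n. mat_app n t w a = lam * w a))"
    (is "?L \<longleftrightarrow> ?R")
proof
  assume ?L
  then obtain x where x: "x \<in> carrier_vec n" "x \<noteq> 0\<^sub>v n"
    "Matrix.mat n n (\<lambda>(a, c). t a c) *\<^sub>v x = lam \<cdot>\<^sub>v x"
    by (auto simp: spectrum_def eigenvalue_def eigenvector_def)
  have "\<exists>a<n. vec_index x a \<noteq> 0"
    using x(1,2) by (metis carrier_vecD eq_vecI index_zero_vec(1) index_zero_vec(2))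
  moreover have "mat_app n t (vec_index x) a = lam * vec_index x a" if "a < n" for a
  proof -
    have "vec_index (Matrix.mat n n (\<lambda>(a, c). t a c) *\<^sub>v x) a = vec_index (lam \<cdot>\<^sub>v x) a"
      using x(3) by simp
    then show ?thesis using that x(1)
      by (simp add: mat_app_def scalar_prod_def lessThan_atLeast0)
  qed
  ultimately show ?R by blast
next
  assume ?R
  then obtain w where w: "\<exists>a<n. w a \<noteq> 0" "\<And>a. a < n \<Longrightarrow> mat_app n t w a = lam * w a" by blast
  have "eigenvector (Matrix.mat n n (\<lambda>(a, c). t a c)) (Matrix.vec n w) lam"
    unfolding eigenvector_def
  proof (intro conjI)
    show "Matrix.vec n w \<noteq> 0\<^sub>v (dim_row (Matrix.mat n n (\<lambda>(a, c). t a c)))"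
      using w(1) by (metis dim_row_mat(1) index_vec index_zero_vec(1))
    show "Matrix.mat n n (\<lambda>(a, c). t a c) *\<^sub>v Matrix.vec n w = lam \<cdot>\<^sub>v Matrix.vec n w"
      using w(2) by (intro eq_vecI) (auto simp: mat_app_def scalar_prod_def lessThan_atLeast0)
  qed simp
  then show ?L by (auto simp: spectrum_def eigenvalue_def)
qed

section \<open>Quantities of prescribed order in a small parameter\<close>

locale small_scale =
  fixes F :: "'w filter" and \<delta> :: "'w \<Rightarrow> real"
  assumes pos: "\<forall>\<^sub>F w in F. 0 < \<delta> w" and tends: "(\<delta> \<longlongrightarrow> 0) F"
begin

definition ord :: "nat \<Rightarrow> ('w \<Rightarrow> 'a::real_normed_vector) \<Rightarrow> bool" where
  "ord e f \<longleftrightarrow> (\<exists>C>0. \<forall>\<^sub>F w in F. norm (f w) \<le> C * \<delta> w ^ e)"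

text \<open>Equality up to a higher order, for two quantities of order \<open>e\<close>. The absolute size is part of the
  relation because it is needed for the error of a product.\<close>

definition near :: "nat \<Rightarrow> ('w \<Rightarrow> 'a::real_normed_vector) \<Rightarrow> ('w \<Rightarrow> 'a) \<Rightarrow> bool" where
  "near e f f' \<longleftrightarrow> ord e f \<and> ord (Suc e) (\<lambda>w. f w - f' w)"

definition lower :: "nat \<Rightarrow> ('w \<Rightarrow> real) \<Rightarrow> bool" where
  "lower e f \<longleftrightarrow> (\<exists>c>0. \<forall>\<^sub>F w in F. c * \<delta> w ^ e \<le> \<bar>f w\<bar>)"

lemma ordI: "\<forall>\<^sub>F w in F. norm (f w) \<le> C * \<delta> w ^ e \<Longrightarrow> ord e f"
  unfolding ord_def
proof (intro exI[of _ "\<bar>C\<bar> + 1"] conjI)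
  assume "\<forall>\<^sub>F w in F. norm (f w) \<le> C * \<delta> w ^ e"
  with pos show "\<forall>\<^sub>F w in F. norm (f w) \<le> (\<bar>C\<bar> + 1) * \<delta> w ^ e"
  proof eventually_elim
    case (elim w)
    have "C * \<delta> w ^ e \<le> (\<bar>C\<bar> + 1) * \<delta> w ^ e" using elim(1) by (intro mult_right_mono) auto
    with elim(2) show ?case by linarith
  qed
qed simp

lemma ord_mono:
  assumes "ord e g" "\<forall>\<^sub>F w in F. norm (f w) \<le> C * norm (g w)"
  shows "ord e f"
proof -
  obtain D where D: "D > 0" "\<forall>\<^sub>F w in F. norm (g w) \<le> D * \<delta> w ^ e"
    using assms(1) by (auto simp: ord_def)
  have "\<forall>\<^sub>F w in F. norm (f w) \<le> (\<bar>C\<bar> * D) * \<delta> w ^ e"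
    using D(2) assms(2)
  proof eventually_elim
    case (elim w)
    have "norm (f w) \<le> \<bar>C\<bar> * norm (g w)"
      by (rule order_trans[OF elim(2) mult_right_mono[OF abs_ge_self norm_ge_zero]])
    also have "\<dots> \<le> \<bar>C\<bar> * (D * \<delta> w ^ e)"
      by (rule mult_left_mono) (use elim in auto)
    finally show ?case by (simp add: mult.assoc)
  qed
  then show ?thesis by (rule ordI)
qed

lemma ord_cong: "ord e g \<Longrightarrow> \<forall>\<^sub>F w in F. f w = g w \<Longrightarrow> ord e f"
  by (erule ord_mono[where C = 1]) (auto elim: eventually_mono)

lemma ord_minus: "ord e f \<Longrightarrow> ord e (\<lambda>w. - f w)"
  by (simp add: ord_def)

lemma ord_zero [simp]: "ord e (\<lambda>w. 0 :: 'a::real_normed_vector)"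
proof (rule ordI[of _ 1])
  show "\<forall>\<^sub>F w in F. norm (0::'a) \<le> 1 * \<delta> w ^ e"
    using pos by eventually_elim simp
qed

lemma ord_add:
  assumes "ord e f" "ord e g"
  shows "ord e (\<lambda>w. f w + g w)"
proof -
  obtain C where C: "\<forall>\<^sub>F w in F. norm (f w) \<le> C * \<delta> w ^ e" using assms(1) by (auto simp: ord_def)
  obtain D where D: "\<forall>\<^sub>F w in F. norm (g w) \<le> D * \<delta> w ^ e" using assms(2) by (auto simp: ord_def)
  show ?thesis
    by (rule ordI[where C = "C + D"], use C D in eventually_elim)
       (simp add: algebra_simps norm_triangle_le)
qed

lemma ord_diff: "ord e f \<Longrightarrow> ord e g \<Longrightarrow> ord e (\<lambda>w. f w - g w)"
  using ord_add[OF _ ord_minus, of e f g] by simp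

lemma ord_bilinear:
  assumes "ord a f" "ord b g"
    and "\<And>w. norm (h w) \<le> norm (f w) * norm (g w)"
  shows "ord (a + b) h"
proof -
  obtain C where C: "C > 0" "\<forall>\<^sub>F w in F. norm (f w) \<le> C * \<delta> w ^ a"
    using assms(1) by (auto simp: ord_def)
  obtain D where D: "D > 0" "\<forall>\<^sub>F w in F. norm (g w) \<le> D * \<delta> w ^ b"
    using assms(2) by (auto simp: ord_def)
  show ?thesis
  proof (rule ordI[where C = "C * D"], use C(2) D(2) pos in eventually_elim)
    fix w assume *: "norm (f w) \<le> C * \<delta> w ^ a" "norm (g w) \<le> D * \<delta> w ^ b" "0 < \<delta> w"
    have "norm (h w) \<le> (C * \<delta> w ^ a) * (D * \<delta> w ^ b)"
      by (rule order_trans[OF assms(3)]) (use * C(1) in \<open>auto intro!: mult_mono\<close>)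
    then show "norm (h w) \<le> C * D * \<delta> w ^ (a + b)"
      by (simp add: power_add algebra_simps)
  qed
qed

lemma ord_scaleR: "ord a f \<Longrightarrow> ord b g \<Longrightarrow> ord (a + b) (\<lambda>w. f w *\<^sub>R g w)"
  by (erule (1) ord_bilinear) simp

lemma ord_mult: "ord a f \<Longrightarrow> ord b g \<Longrightarrow> ord (a + b) (\<lambda>w. f w * g w :: real)"
  by (erule (1) ord_bilinear) (simp add: abs_mult)

lemma ord_inner:
  "ord a f \<Longrightarrow> ord b g \<Longrightarrow> ord (a + b) (\<lambda>w. f w \<bullet> g w)"
  by (erule (1) ord_bilinear) (simp add: Cauchy_Schwarz_ineq2)

lemma ord_decrease: "ord (Suc e) f \<Longrightarrow> ord e f"
proof -
  assume "ord (Suc e) f"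
  then obtain C where C: "C > 0" "\<forall>\<^sub>F w in F. norm (f w) \<le> C * \<delta> w ^ Suc e"
    by (auto simp: ord_def)
  have "\<forall>\<^sub>F w in F. \<delta> w < 1" using tends by (rule order_tendstoD) simp
  with C(2) pos show ?thesis
    apply (intro ordI[where C = C], eventually_elim)
    by (erule order_trans) (use C(1) in \<open>simp add: mult_le_cancel_left mult_le_cancel_right\<close>)
qed

lemma lower_nonzero: "lower e f \<Longrightarrow> \<forall>\<^sub>F w in F. f w \<noteq> 0"
proof -
  assume "lower e f"
  then obtain c where "c > 0" "\<forall>\<^sub>F w in F. c * \<delta> w ^ e \<le> \<bar>f w\<bar>" by (auto simp: lower_def)
  from this(2) pos show ?thesis
  proof eventually_elim
    case (elim w)
    have "0 < c * \<delta> w ^ e" using \<open>c > 0\<close> elim(2) by simp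
    with elim(1) show ?case by auto
  qed
qed

lemma lower_mono:
  assumes "lower e g" "c > 0" "\<forall>\<^sub>F w in F. c * \<bar>g w\<bar> \<le> \<bar>f w\<bar>"
  shows "lower e f"
proof -
  obtain d where d: "d > 0" "\<forall>\<^sub>F w in F. d * \<delta> w ^ e \<le> \<bar>g w\<bar>"
    using assms(1) by (auto simp: lower_def)
  have "\<forall>\<^sub>F w in F. (c * d) * \<delta> w ^ e \<le> \<bar>f w\<bar>"
    using d(2) assms(3)
  proof eventually_elim
    case (elim w)
    have "c * (d * \<delta> w ^ e) \<le> c * \<bar>g w\<bar>" by (rule mult_left_mono) (use elim assms in auto)
    with elim show ?case by (simp add: mult.assoc)
  qed
  then show ?thesis unfolding lower_def using d(1) assms(2) by (intro exI[of _ "c * d"]) auto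
qed

lemma ord_inverse:
  assumes "lower b g" "ord (b + e) f" shows "ord e (\<lambda>w. f w / g w)"
proof -
  obtain C where C: "C > 0" "\<forall>\<^sub>F w in F. norm (f w) \<le> C * \<delta> w ^ (b + e)"
    using assms(2) by (auto simp: ord_def)
  obtain c where c: "c > 0" "\<forall>\<^sub>F w in F. c * \<delta> w ^ b \<le> \<bar>g w\<bar>"
    using assms(1) by (auto simp: lower_def)
  show ?thesis
  proof (rule ordI[where C = "C / c"], use C(2) c(2) pos in eventually_elim)
    fix w assume *: "norm (f w) \<le> C * \<delta> w ^ (b + e)" "c * \<delta> w ^ b \<le> \<bar>g w\<bar>" "0 < \<delta> w"
    have "norm (f w / g w) \<le> (C * \<delta> w ^ (b + e)) / (c * \<delta> w ^ b)"
      unfolding norm_divide unfolding real_norm_def using * c(1) C(1) by (intro frac_le) auto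
    then show "norm (f w / g w) \<le> C / c * \<delta> w ^ e"
      using *(3) c(1) by (simp add: power_add)
  qed
qed

lemma near_ord:
  assumes "near e f f'" shows "ord e f" "ord e f'" "ord (Suc e) (\<lambda>w. f w - f' w)"
proof -
  show 1: "ord e f" and 2: "ord (Suc e) (\<lambda>w. f w - f' w)" using assms by (auto simp: near_def)
  show "ord e f'" using ord_diff[OF 1 ord_decrease[OF 2]] by simp
qed

lemma near_refl: "ord e f \<Longrightarrow> near e f f" by (simp add: near_def)

lemma near_cong:
  assumes "near e f f'" "\<forall>\<^sub>F w in F. g w = f w" "\<forall>\<^sub>F w in F. g' w = f' w"
  shows "near e g g'"
  unfolding near_def
proof
  show "ord e g" using near_ord(1)[OF assms(1)] assms(2) by (rule ord_cong)
  show "ord (Suc e) (\<lambda>w. g w - g' w)"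
    by (rule ord_cong[OF near_ord(3)[OF assms(1)]])
       (use assms(2,3) in eventually_elim, simp)
qed

lemma near_minus: "near e f f' \<Longrightarrow> near e (\<lambda>w. - f w) (\<lambda>w. - f' w)"
  unfolding near_def using ord_minus[of "Suc e" "\<lambda>w. f w - f' w"] by (auto intro: ord_minus)

lemma near_add:
  "near e f f' \<Longrightarrow> near e g g' \<Longrightarrow> near e (\<lambda>w. f w + g w) (\<lambda>w. f' w + g' w)"
  unfolding near_def
  using ord_add[of "Suc e" "\<lambda>w. f w - f' w" "\<lambda>w. g w - g' w"]
  by (auto intro: ord_add simp: add_diff_add)

lemma near_diff:
  "near e f f' \<Longrightarrow> near e g g' \<Longrightarrow> near e (\<lambda>w. f w - g w) (\<lambda>w. f' w - g' w)"
  using near_add[OF _ near_minus, of e f f' g g'] by simp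

lemma near_scaleR:
  assumes "near a f f'" "near b g g'"
  shows "near (a + b) (\<lambda>w. f w *\<^sub>R g w) (\<lambda>w. f' w *\<^sub>R g' w)"
proof -
  have "ord (Suc (a + b)) (\<lambda>w. (f w - f' w) *\<^sub>R g w + f' w *\<^sub>R (g w - g' w))"
    using ord_scaleR[OF near_ord(3)[OF assms(1)] near_ord(1)[OF assms(2)]]
      ord_scaleR[OF near_ord(2)[OF assms(1)] near_ord(3)[OF assms(2)]]
    by (intro ord_add) simp_all
  then show ?thesis
    unfolding near_def using ord_scaleR[OF near_ord(1)[OF assms(1)] near_ord(1)[OF assms(2)]]
    by (simp add: algebra_simps)
qed

lemma near_mult:
  "near a f f' \<Longrightarrow> near b g g' \<Longrightarrow> near (a + b) (\<lambda>w. f w * g w :: real) (\<lambda>w. f' w * g' w)"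
  using near_scaleR[of a f f' b g g'] by simp

lemma near_inner:
  assumes "near a f f'" "near b g g'"
  shows "near (a + b) (\<lambda>w. f w \<bullet> g w) (\<lambda>w. f' w \<bullet> g' w)"
proof -
  have "ord (Suc (a + b)) (\<lambda>w. (f w - f' w) \<bullet> g w + f' w \<bullet> (g w - g' w))"
    using ord_inner[OF near_ord(3)[OF assms(1)] near_ord(1)[OF assms(2)]]
      ord_inner[OF near_ord(2)[OF assms(1)] near_ord(3)[OF assms(2)]]
    by (intro ord_add) simp_all
  then show ?thesis
    unfolding near_def using ord_inner[OF near_ord(1)[OF assms(1)] near_ord(1)[OF assms(2)]]
    by (simp add: algebra_simps inner_diff_left inner_diff_right)
qed

lemma near_lower:
  assumes "near e f f'" "lower e f" shows "lower e f'"
proof -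
  obtain c where c: "c > 0" "\<forall>\<^sub>F w in F. c * \<delta> w ^ e \<le> \<bar>f w\<bar>"
    using assms(2) by (auto simp: lower_def)
  obtain C where C: "C > 0" "\<forall>\<^sub>F w in F. norm (f w - f' w) \<le> C * \<delta> w ^ Suc e"
    using near_ord(3)[OF assms(1)] by (auto simp: ord_def)
  have "\<forall>\<^sub>F w in F. \<delta> w < c / (2 * C)"
    using tends by (rule order_tendstoD) (use c C in simp)
  with c(2) C(2) pos have "\<forall>\<^sub>F w in F. (c / 2) * \<delta> w ^ e \<le> \<bar>f' w\<bar>"
  proof eventually_elim
    case (elim w)
    have "C * \<delta> w ^ Suc e = (C * \<delta> w) * \<delta> w ^ e" by simp
    also have "\<dots> \<le> (c / 2) * \<delta> w ^ e"
      by (rule mult_right_mono) (use elim C(1) in \<open>auto simp: field_simps\<close>)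
    finally show ?case using elim(1,2) by auto
  qed
  then show ?thesis unfolding lower_def using c(1) by (intro exI[of _ "c / 2"]) auto
qed

text \<open>With \<open>f / g - f' / g' = (f - f') / g - (f' / g') (g - g') / g\<close>, each term gains one order from the
  difference it contains.\<close>

lemma near_divide:
  assumes f: "near (b + e) f f'" and g: "near b g g'" "lower b g"
  shows "near e (\<lambda>w. f w / g w) (\<lambda>w. f' w / g' w)"
proof -
  note g' = near_lower[OF g]
  have "ord (Suc e) (\<lambda>w. (f w - f' w) / g w)"
    by (rule ord_inverse[OF g(2)]) (use near_ord(3)[OF f] in simp)
  moreover have "ord e (\<lambda>w. f' w / g' w)" by (rule ord_inverse[OF g' near_ord(2)[OF f]])
  moreover have "ord 1 (\<lambda>w. (g w - g' w) / g w)"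
    by (rule ord_inverse[OF g(2)]) (use near_ord(3)[OF g(1)] in simp)
  ultimately have "ord (Suc e) (\<lambda>w. (f w - f' w) / g w - f' w / g' w * ((g w - g' w) / g w))"
    using ord_mult[of e "\<lambda>w. f' w / g' w" 1 "\<lambda>w. (g w - g' w) / g w"]
    by (intro ord_diff) (simp_all del: times_divide_eq_left times_divide_eq_right)
  moreover have "\<forall>\<^sub>F w in F. f w / g w - f' w / g' w
      = (f w - f' w) / g w - f' w / g' w * ((g w - g' w) / g w)"
    using lower_nonzero[OF g(2)] lower_nonzero[OF g']
    by eventually_elim (simp add: field_simps)
  ultimately have "ord (Suc e) (\<lambda>w. f w / g w - f' w / g' w)" by (rule ord_cong)
  then show ?thesis unfolding near_def using ord_inverse[OF g(2) near_ord(1)[OF f]] by simp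
qed

end

section \<open>Sweeps\<close>

lemma sweep_empty [simp]: "b \<le> a \<Longrightarrow> sweep v p q a b uw = uw"
  by (simp add: sweep_def)

lemma sweep_Suc:
  "a \<le> b \<Longrightarrow> sweep v p q a (Suc b) uw =
     (fst (sweep v p q a b uw) - sweep_coeff v p q a uw b *\<^sub>R p b,
      snd (sweep v p q a b uw) - sweep_coeff v p q a uw b *\<^sub>R q b)"
  by (simp add: sweep_def sweep_coeff_def Let_def split_beta)

lemma sweep_shift:
  "sweep v p q (s + a) (s + b) uw =
     sweep (\<lambda>i. v (s + i)) (\<lambda>i. p (s + i)) (\<lambda>i. q (s + i)) a b uw"
proof -
  have "[s + a..<s + b] = map ((+) s) [a..<b]"
    by (induction b) (auto simp: not_le)
  then show ?thesis by (simp add: sweep_def foldl_map case_prod_unfold)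
qed

lemma sweep_coeff_shift:
  "sweep_coeff v p q (s + a) uw (s + i) =
     sweep_coeff (\<lambda>i. v (s + i)) (\<lambda>i. p (s + i)) (\<lambda>i. q (s + i)) a uw i"
  by (simp add: sweep_coeff_def sweep_shift)

lemma sweep_translate:
  "sweep v p q a b (u - c, w) = (fst (sweep v p q a b (u, w)) - c, snd (sweep v p q a b (u, w)))"
proof (induction b)
  case (Suc b)
  then show ?case
    by (cases "a \<le> b") (simp_all add: sweep_Suc sweep_coeff_def)
qed simp

lemma sweep_coeff_translate:
  "sweep_coeff v p q a (u - c, w) i = sweep_coeff v p q a (u, w) i"
  by (simp add: sweep_coeff_def sweep_translate)

text \<open>Subtracting a multiple of \<open>q j\<close> does not affect the later coefficients if the \<open>v i\<close> are orthogonal to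
  it. The successive projections of a sweep are then a simultaneous one, which is the form in which
  Process II is given.\<close>

lemma sweep_biorthogonal:
  assumes "\<And>i j. i \<in> {a..<b} \<Longrightarrow> j \<in> {a..<b} \<Longrightarrow> i \<noteq> j \<Longrightarrow> v i \<bullet> q j = 0"
  shows "sweep v p q a b (u, w) =
      (u - (\<Sum>i\<in>{a..<b}. ((v i \<bullet> w) / (v i \<bullet> q i)) *\<^sub>R p i),
       w - (\<Sum>i\<in>{a..<b}. ((v i \<bullet> w) / (v i \<bullet> q i)) *\<^sub>R q i)) \<and>
    (\<forall>i\<in>{a..<b}. sweep_coeff v p q a (u, w) i = (v i \<bullet> w) / (v i \<bullet> q i))"
  using assms
proof (induction b)
  case (Suc b)
  show ?case
  proof (cases "a \<le> b")
    case True
    have IH: "sweep v p q a b (u, w) =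
      (u - (\<Sum>i\<in>{a..<b}. ((v i \<bullet> w) / (v i \<bullet> q i)) *\<^sub>R p i),
       w - (\<Sum>i\<in>{a..<b}. ((v i \<bullet> w) / (v i \<bullet> q i)) *\<^sub>R q i))"
      "\<forall>i\<in>{a..<b}. sweep_coeff v p q a (u, w) i = (v i \<bullet> w) / (v i \<bullet> q i)"
      using Suc by auto
    have "v b \<bullet> (\<Sum>i\<in>{a..<b}. ((v i \<bullet> w) / (v i \<bullet> q i)) *\<^sub>R q i) = 0"
      unfolding inner_sum_right by (rule sum.neutral) (use Suc.prems True in auto)
    then have "sweep_coeff v p q a (u, w) b = (v b \<bullet> w) / (v b \<bullet> q b)"
      by (simp add: sweep_coeff_def IH inner_diff_right)
    with True IH show ?thesis
      by (auto simp: sweep_Suc less_Suc_eq atLeastLessThanSuc algebra_simps)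
  qed simp
qed simp

context small_scale begin

definition near_directions ::
  "('w \<Rightarrow> nat \<Rightarrow> real^'n) \<Rightarrow> ('w \<Rightarrow> nat \<Rightarrow> real^'n) \<Rightarrow> ('w \<Rightarrow> nat \<Rightarrow> real^'n) \<Rightarrow> ('w \<Rightarrow> nat \<Rightarrow> real^'n) \<Rightarrow>
    ('w \<Rightarrow> nat \<Rightarrow> real^'n) \<Rightarrow> ('w \<Rightarrow> nat \<Rightarrow> real^'n) \<Rightarrow> nat \<Rightarrow> bool" where
  "near_directions v v' p p' q q' i \<longleftrightarrow>
      near 1 (\<lambda>w. v w i) (\<lambda>w. v' w i) \<and> near 1 (\<lambda>w. p w i) (\<lambda>w. p' w i) \<and>
      near 1 (\<lambda>w. q w i) (\<lambda>w. q' w i) \<and> lower 2 (\<lambda>w. v w i \<bullet> q w i)"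

text \<open>The coefficients of a sweep are quotients of two inner products of order \<open>2\<close>, hence of order \<open>0\<close>; the
  lower bound on \<open>v i \<bullet> q i\<close> is what makes the division harmless.\<close>

lemma near_sweep:
  assumes fam: "\<forall>i\<in>{a..<b}. near_directions v v' p p' q q' i"
    and u: "near 1 u u'" and z: "near 1 z z'"
  shows "near 1 (\<lambda>w. fst (sweep (v w) (p w) (q w) a b (u w, z w)))
                (\<lambda>w. fst (sweep (v' w) (p' w) (q' w) a b (u' w, z' w))) \<and>
         near 1 (\<lambda>w. snd (sweep (v w) (p w) (q w) a b (u w, z w)))
                (\<lambda>w. snd (sweep (v' w) (p' w) (q' w) a b (u' w, z' w))) \<and>
         (\<forall>i\<in>{a..<b}. near 0 (\<lambda>w. sweep_coeff (v w) (p w) (q w) a (u w, z w) i)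
                            (\<lambda>w. sweep_coeff (v' w) (p' w) (q' w) a (u' w, z' w) i))"
  using fam
proof (induction b)
  case 0
  then show ?case using u z by simp
next
  case (Suc b)
  show ?case
  proof (cases "a \<le> b")
    case False
    then show ?thesis using u z by simp
  next
    case True
    have "\<forall>i\<in>{a..<b}. near_directions v v' p p' q q' i" using Suc.prems by auto
  note IH = Suc.IH[OF this]
    have b: "near 1 (\<lambda>w. v w b) (\<lambda>w. v' w b)" "near 1 (\<lambda>w. p w b) (\<lambda>w. p' w b)"
      "near 1 (\<lambda>w. q w b) (\<lambda>w. q' w b)" "lower 2 (\<lambda>w. v w b \<bullet> q w b)"
      using Suc.prems True by (auto simp: near_directions_def)
    have s: "near 1 (\<lambda>w. snd (sweep (v w) (p w) (q w) a b (u w, z w)))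
                (\<lambda>w. snd (sweep (v' w) (p' w) (q' w) a b (u' w, z' w)))"
      and f: "near 1 (\<lambda>w. fst (sweep (v w) (p w) (q w) a b (u w, z w)))
                (\<lambda>w. fst (sweep (v' w) (p' w) (q' w) a b (u' w, z' w)))"
      using IH by auto
    have c: "near 0 (\<lambda>w. sweep_coeff (v w) (p w) (q w) a (u w, z w) b)
                  (\<lambda>w. sweep_coeff (v' w) (p' w) (q' w) a (u' w, z' w) b)"
      unfolding sweep_coeff_def
      by (rule near_divide[where b = 2])
         (use near_inner[OF b(1) s] near_inner[OF b(1,3)] b(4) in \<open>simp_all add: numeral_2_eq_2\<close>)
    show ?thesis
      unfolding sweep_Suc[OF True] fst_conv snd_conv
      using near_diff[OF f near_scaleR[OF c b(2), unfolded add_0_left]]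
        near_diff[OF s near_scaleR[OF c b(3), unfolded add_0_left]] c IH
      by (auto simp: less_Suc_eq)
  qed
qed

end

section \<open>A cycle of the full-memory method for a symmetric linear map\<close>

text \<open>The numbers \<open>\<phi>\<close> and the entries of the tridiagonal matrix, with iterations numbered from the
  restart: the index \<open>i\<close> is both the iteration and the value of the counter.\<close>

definition cycle_phi :: "(nat \<Rightarrow> nat \<Rightarrow> real) \<Rightarrow> (nat \<Rightarrow> nat \<Rightarrow> real) \<Rightarrow> nat \<Rightarrow> real" where
  "cycle_phi \<zeta> \<Gamma> i = (if i = 0 then 0 else \<Gamma> i i + \<zeta> (Suc i) i)"

definition tri_entry ::
  "(nat \<Rightarrow> real) \<Rightarrow> (nat \<Rightarrow> nat \<Rightarrow> real) \<Rightarrow> (nat \<Rightarrow> nat \<Rightarrow> real) \<Rightarrow> nat \<Rightarrow> nat \<Rightarrow> real" where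
  "tri_entry b \<zeta> \<Gamma> a c = (let i = c + 1; e = 1 - \<Gamma> i i in
     if a + 1 = c then cycle_phi \<zeta> \<Gamma> (i - 1) / (b (i - 1) * e)
     else if a = c then 1 / e * (1 / b (i - 1) - cycle_phi \<zeta> \<Gamma> i / b i)
     else if a = c + 1 then - 1 / (b i * e) else 0)"

text \<open>One cycle of Process II, numbered from its restart and with the fixed point moved to the origin,
  so that \<open>y i\<close> is the error of the iterate. The conditions on spans are replaced by those on the
  spanning vectors.\<close>

locale linear_cycle =
  fixes ty :: am_type and A :: "real^'n^'n" and b :: "nat \<Rightarrow> real"
    and y p q r v :: "nat \<Rightarrow> real^'n" and \<zeta> \<Gamma> :: "nat \<Rightarrow> nat \<Rightarrow> real" and N :: nat
  assumes self_adjoint: "\<And>u z. (A *v u) \<bullet> z = u \<bullet> (A *v z)"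
    and r_def: "\<And>i. r i = - (A *v y i)"
    and v_def: "v = vsel ty p q"
    and b0: "\<And>i. b i \<noteq> 0"
    and y_step: "\<And>i. i < N \<Longrightarrow>
      y (Suc i) = y i + b i *\<^sub>R r i - (\<Sum>j=1..i. \<Gamma> i j *\<^sub>R (p j + b i *\<^sub>R q j))"
    and p_def: "\<And>i. 1 \<le> i \<Longrightarrow> i \<le> N \<Longrightarrow> p i = (y i - y (i - 1)) - (\<Sum>j=1..i - 1. \<zeta> i j *\<^sub>R p j)"
    and q_def: "\<And>i. 1 \<le> i \<Longrightarrow> i \<le> N \<Longrightarrow> q i = (r i - r (i - 1)) - (\<Sum>j=1..i - 1. \<zeta> i j *\<^sub>R q j)"
    and orth_lower: "\<And>i j. 1 \<le> j \<Longrightarrow> j < i \<Longrightarrow> i \<le> N \<Longrightarrow> v j \<bullet> q i = 0"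
    and orth_r: "\<And>i j. 1 \<le> j \<Longrightarrow> j \<le> i \<Longrightarrow> i \<le> N \<Longrightarrow>
      v j \<bullet> (r i - (\<Sum>l=1..i. \<Gamma> i l *\<^sub>R q l)) = 0"
begin

text \<open>The residual that the method combines with the mixing parameter; it is orthogonal to all \<open>v j\<close> of
  the cycle so far. Called the projected residual below.\<close>

definition rb :: "nat \<Rightarrow> real^'n" where "rb i = r i - (\<Sum>j=1..i. \<Gamma> i j *\<^sub>R q j)"

definition \<phi> :: "nat \<Rightarrow> nat \<Rightarrow> real" where "\<phi> l j = \<Gamma> l j + \<zeta> (Suc l) j"

definition nondeg :: "nat \<Rightarrow> bool" where "nondeg l \<longleftrightarrow> (\<forall>j\<in>{1..l}. v j \<bullet> q j \<noteq> 0)"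

definition gain_ok :: "nat \<Rightarrow> bool" where "gain_ok l \<longleftrightarrow> (\<forall>j\<in>{1..l}. \<Gamma> j j \<noteq> 1)"

lemma mv_simps: "A *v (u + z) = A *v u + A *v z" "A *v (u - z) = A *v u - A *v z"
  "A *v (c *\<^sub>R u) = c *\<^sub>R (A *v u)" "A *v (- u) = - (A *v u)"
  "A *v (\<Sum>j\<in>S. g j) = (\<Sum>j\<in>S. A *v g j)"
  by (simp_all add: matrix_vector_right_distrib matrix_vector_mult_diff_distrib
      scaleR_matrix_vector_assoc[symmetric] matrix_vector_mult_scaleR
      linear_neg[OF matrix_vector_mul_linear] linear_sum[OF matrix_vector_mul_linear])

lemma q_eq: "1 \<le> i \<Longrightarrow> i \<le> N \<Longrightarrow> q i = - (A *v p i)"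
proof (induction i rule: less_induct)
  case (less i)
  have "(\<Sum>j=1..i - 1. \<zeta> i j *\<^sub>R q j) = (\<Sum>j=1..i - 1. - (\<zeta> i j *\<^sub>R (A *v p j)))"
    by (rule sum.cong) (use less in auto)
  then show ?case
    by (simp add: q_def[OF less.prems] p_def[OF less.prems] r_def mv_simps sum_negf)
qed

text \<open>For Type-I the orthogonality is conjugacy of the \<open>p i\<close> with respect to \<open>A\<close>, for Type-II it is
  orthogonality of the \<open>q i\<close>; both are symmetric relations, so the one-sided conditions of the process
  imply it for all pairs.\<close>

lemma orth: "i \<in> {1..N} \<Longrightarrow> j \<in> {1..N} \<Longrightarrow> i \<noteq> j \<Longrightarrow> v i \<bullet> q j = 0"
proof (cases "i < j")
  case False
  assume *: "i \<in> {1..N}" "j \<in> {1..N}" "i \<noteq> j"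
  then have "v j \<bullet> q i = 0" using orth_lower[of j i] False by auto
  then show ?thesis using * self_adjoint[of "p i" "p j"]
    by (cases ty) (auto simp: v_def q_eq inner_commute)
qed (use orth_lower in auto)

lemma v_A_sym: "i \<in> {1..N} \<Longrightarrow> j \<in> {1..N} \<Longrightarrow> v i \<bullet> (A *v q j) = v j \<bullet> (A *v q i)"
  using self_adjoint[of "p i" "A *v p j"] self_adjoint[of "p j" "A *v p i"] self_adjoint[of "q i" "q j"]
  by (cases ty) (simp_all add: v_def q_eq mv_simps inner_commute)

lemma y_Suc: "i < N \<Longrightarrow> y (Suc i) - y i = b i *\<^sub>R rb i - (\<Sum>j=1..i. \<Gamma> i j *\<^sub>R p j)"
  by (simp add: y_step rb_def algebra_simps sum.distrib scaleR_sum_right)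

lemma p_Suc: "i < N \<Longrightarrow> p (Suc i) = b i *\<^sub>R rb i - (\<Sum>j=1..i. \<phi> i j *\<^sub>R p j)"
  using p_def[of "Suc i"] y_Suc[of i] by (simp add: \<phi>_def algebra_simps sum.distrib)

lemma A_rb: "i < N \<Longrightarrow> b i *\<^sub>R (A *v rb i) = - q (Suc i) - (\<Sum>j=1..i. \<phi> i j *\<^sub>R q j)"
proof -
  assume i: "i < N"
  have "b i *\<^sub>R rb i = p (Suc i) + (\<Sum>j=1..i. \<phi> i j *\<^sub>R p j)" using p_Suc[OF i] by simp
  then have "b i *\<^sub>R (A *v rb i) = A *v p (Suc i) + (\<Sum>j=1..i. \<phi> i j *\<^sub>R (A *v p j))"
    by (metis (no_types, lifting) mv_simps(1,3,5) sum.cong)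
  also have "A *v p (Suc i) = - q (Suc i)" using q_eq[of "Suc i"] i by simp
  also have "(\<Sum>j=1..i. \<phi> i j *\<^sub>R (A *v p j)) = - (\<Sum>j=1..i. \<phi> i j *\<^sub>R q j)"
    unfolding sum_negf[symmetric] by (rule sum.cong) (use i q_eq in auto)
  finally show ?thesis by simp
qed

lemma orth_rb: "j \<in> {1..i} \<Longrightarrow> i \<le> N \<Longrightarrow> v j \<bullet> rb i = 0"
  using orth_r[of j i] by (simp add: rb_def)

lemma inner_sum_diag:
  assumes "j \<in> {1..N}" "i \<le> N"
  shows "v j \<bullet> (\<Sum>l=1..i. c l *\<^sub>R q l) = (if j \<le> i then c j * (v j \<bullet> q j) else 0)"
proof -
  have "v j \<bullet> (\<Sum>l=1..i. c l *\<^sub>R q l) = (\<Sum>l=1..i. if l = j then c j * (v j \<bullet> q j) else 0)"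
    unfolding inner_sum_right by (rule sum.cong) (use assms orth in auto)
  then show ?thesis using assms by simp
qed

lemma \<Gamma>_eq: "j \<in> {1..i} \<Longrightarrow> i \<le> N \<Longrightarrow> \<Gamma> i j * (v j \<bullet> q j) = v j \<bullet> r i"
  using orth_rb[of j i] inner_sum_diag[of j i "\<Gamma> i"] by (simp add: rb_def inner_diff_right)

lemma \<zeta>_eq: "j \<in> {1..<i} \<Longrightarrow> i \<le> N \<Longrightarrow> \<zeta> i j * (v j \<bullet> q j) = v j \<bullet> (r i - r (i - 1))"
  using orth_lower[of j i] inner_sum_diag[of j "i - 1" "\<zeta> i"]
    q_def[of i]
  by (auto simp: inner_diff_right)

text \<open>Both sides are coefficients of orthogonal projections onto the same directions:
  \<open>r i = r (i - 1) + (r i - r (i - 1))\<close>.\<close>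

lemma \<Gamma>_recursion:
  assumes "j \<in> {1..<i}" "i \<le> N" "v j \<bullet> q j \<noteq> 0"
  shows "\<Gamma> i j = \<phi> (i - 1) j"
proof -
  have "\<Gamma> i j * (v j \<bullet> q j) = (\<Gamma> (i - 1) j + \<zeta> i j) * (v j \<bullet> q j)"
    using \<Gamma>_eq[of j i] \<Gamma>_eq[of j "i - 1"] \<zeta>_eq[of j i] assms
    by (auto simp: distrib_right inner_diff_right)
  then show ?thesis using assms by (simp add: \<phi>_def)
qed

text \<open>Passing to the next iteration changes the projected residual only along the newest direction,
  since the components along the older directions cancel by \<open>\<Gamma>_recursion\<close>. This is the source of all
  short recurrences.\<close>

lemma rb_step:
  assumes "1 \<le> i" "i \<le> N" "nondeg (i - 1)"
  shows "(1 - \<Gamma> i i) *\<^sub>R q i = rb i - rb (i - 1)"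
proof -
  have eq: "{1..i} = insert i {1..i - 1}" using assms by auto
  have "(\<Sum>j=1..i - 1. \<Gamma> i j *\<^sub>R q j) = (\<Sum>j=1..i - 1. (\<Gamma> (i - 1) j + \<zeta> i j) *\<^sub>R q j)"
    using \<Gamma>_recursion[of _ i] assms by (intro sum.cong) (auto simp: \<phi>_def nondeg_def)
  also have "\<dots> = (\<Sum>j=1..i - 1. \<Gamma> (i - 1) j *\<^sub>R q j) + (\<Sum>j=1..i - 1. \<zeta> i j *\<^sub>R q j)"
    by (simp add: scaleR_add_left sum.distrib)
  finally have S: "(\<Sum>j=1..i. \<Gamma> i j *\<^sub>R q j) = \<Gamma> i i *\<^sub>R q i
      + ((\<Sum>j=1..i - 1. \<Gamma> (i - 1) j *\<^sub>R q j) + (\<Sum>j=1..i - 1. \<zeta> i j *\<^sub>R q j))"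
    unfolding eq using assms(1) by simp
  have ri: "r i = q i + r (i - 1) + (\<Sum>j=1..i - 1. \<zeta> i j *\<^sub>R q j)"
    using q_def[OF assms(1,2)] by simp
  show ?thesis unfolding rb_def S ri by (simp add: scaleR_diff_left)
qed

lemma orth_p_rb: "ty = Type_I \<Longrightarrow> j \<in> {1..i} \<Longrightarrow> i \<le> N \<Longrightarrow> p j \<bullet> rb i = 0"
  using orth_rb[of j i] by (simp add: v_def)

lemma orth_q_rb: "ty = Type_II \<Longrightarrow> j \<in> {1..i} \<Longrightarrow> i \<le> N \<Longrightarrow> q j \<bullet> rb i = 0"
  using orth_rb[of j i] by (simp add: v_def)

text \<open>The projected residual \<open>rb j\<close> lies in the span of the directions up to \<open>j + 1\<close>, by \<open>p_Suc\<close>.\<close>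

lemma rb_orth_rb:
  assumes "ty = Type_I" "j < i" "i \<le> N" shows "rb j \<bullet> rb i = 0"
proof -
  have "b j *\<^sub>R rb j = p (Suc j) + (\<Sum>l=1..j. \<phi> j l *\<^sub>R p l)" using p_Suc[of j] assms by simp
  then have "b j * (rb j \<bullet> rb i) = (p (Suc j) + (\<Sum>l=1..j. \<phi> j l *\<^sub>R p l)) \<bullet> rb i"
    by (metis inner_scaleR_left)
  also have "\<dots> = 0"
    using orth_p_rb[OF assms(1)] assms(2,3) by (simp add: inner_add_left inner_sum_left)
  finally show ?thesis using b0[of j] by simp
qed

lemma A_rb_orth_rb:
  assumes "ty = Type_II" "j < i" "i \<le> N" shows "(A *v rb j) \<bullet> rb i = 0"
proof -
  have "b j * ((A *v rb j) \<bullet> rb i) = (- q (Suc j) - (\<Sum>l=1..j. \<phi> j l *\<^sub>R q l)) \<bullet> rb i"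
    using arg_cong[OF A_rb[of j], of "\<lambda>u. u \<bullet> rb i"] assms(2,3) by simp
  also have "\<dots> = 0"
    using orth_q_rb[OF assms(1)] assms(2,3) by (simp add: inner_diff_left inner_sum_left)
  finally show ?thesis using b0[of j] by simp
qed

lemma v_A_rb_zero:
  assumes j: "1 \<le> j" "j < l" "l \<le> N" and nd: "nondeg l" and g: "gain_ok j"
  shows "v j \<bullet> (A *v rb l) = 0"
proof -
  have "nondeg (j - 1)" using nd j by (auto simp: nondeg_def)
  then have st: "(1 - \<Gamma> j j) *\<^sub>R q j = rb j - rb (j - 1)" using rb_step[of j] j by simp
  have nz: "1 - \<Gamma> j j \<noteq> 0" using g j by (auto simp: gain_ok_def)
  show ?thesis
  proof (cases ty)
    case Type_I
    have "(1 - \<Gamma> j j) * (q j \<bullet> rb l) = (rb j - rb (j - 1)) \<bullet> rb l"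
      using st by (metis inner_scaleR_left)
    then have "q j \<bullet> rb l = 0"
      using rb_orth_rb[OF Type_I, of j l] rb_orth_rb[OF Type_I, of "j - 1" l] j nz
      by (simp add: inner_diff_left)
    then show ?thesis using Type_I self_adjoint[of "p j" "rb l"] q_eq[of j] j
      by (simp add: v_def)
  next
    case Type_II
    have "(1 - \<Gamma> j j) *\<^sub>R (A *v q j) = A *v rb j - A *v rb (j - 1)"
      using st by (metis mv_simps(2,3))
    then have "(1 - \<Gamma> j j) * ((A *v q j) \<bullet> rb l) = (A *v rb j - A *v rb (j - 1)) \<bullet> rb l"
      by (metis inner_scaleR_left)
    then have "(A *v q j) \<bullet> rb l = 0"
      using A_rb_orth_rb[OF Type_II, of j l] A_rb_orth_rb[OF Type_II, of "j - 1" l] j nz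
      by (simp add: inner_diff_left)
    then show ?thesis using Type_II self_adjoint[of "q j" "rb l"] by (simp add: v_def)
  qed
qed

text \<open>The coefficient is determined by \<open>v j \<bullet> A rb l\<close>. By symmetry of \<open>A\<close> this is an inner product of \<open>rb l\<close>
  with \<open>q j\<close> or \<open>A q j\<close>, which by \<open>rb_step\<close> is a combination of earlier projected residuals (or of their
  images under \<open>A\<close>), as soon as \<open>\<Gamma> j j \<noteq> 1\<close>.\<close>

lemma \<phi>_zero:
  assumes j: "1 \<le> j" "j < l" "l < N" and nd: "nondeg l" and g: "gain_ok j"
  shows "\<phi> l j = 0"
proof -
  have "0 = v j \<bullet> (b l *\<^sub>R (A *v rb l))"
    using v_A_rb_zero[OF j(1,2) _ nd g] j by simp
  also have "\<dots> = - (\<phi> l j * (v j \<bullet> q j))"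
    using A_rb[OF j(3)] inner_sum_diag[of j l "\<phi> l"] orth[of j "Suc l"] j
    by (simp add: inner_diff_right)
  finally show ?thesis using nd j by (auto simp: nondeg_def)
qed

lemma gain_ok_mono: "gain_ok l \<Longrightarrow> i \<le> l \<Longrightarrow> gain_ok i"
  by (auto simp: gain_ok_def)

lemma nondeg_mono: "nondeg l \<Longrightarrow> i \<le> l \<Longrightarrow> nondeg i"
  by (auto simp: nondeg_def)

lemma \<Gamma>_zero:
  assumes "1 \<le> j" "j + 2 \<le> i" "i \<le> N" "nondeg (i - 1)" "gain_ok (i - 2)"
  shows "\<Gamma> i j = 0"
proof -
  have "\<Gamma> i j = \<phi> (i - 1) j"
    using assms by (intro \<Gamma>_recursion) (auto simp: nondeg_def)
  also have "\<dots> = 0"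
    using assms gain_ok_mono[of "i - 2" j] by (intro \<phi>_zero) auto
  finally show ?thesis .
qed

lemma \<zeta>_zero:
  assumes "1 \<le> j" "j + 3 \<le> i" "i \<le> N" "nondeg (i - 1)" "gain_ok (i - 2)"
  shows "\<zeta> i j = 0"
proof -
  have "\<phi> (i - 1) j = 0" using assms gain_ok_mono[of "i - 2" j] by (intro \<phi>_zero) auto
  moreover have "\<Gamma> (i - 1) j = 0"
    using assms gain_ok_mono[of "i - 2" "i - 3"] nondeg_mono[of "i - 1" "i - 2"]
    by (intro \<Gamma>_zero) (auto simp: numeral_eq_Suc)
  ultimately show ?thesis using assms by (simp add: \<phi>_def)
qed

lemma sum_truncate:
  fixes g :: "nat \<Rightarrow> real^'n"
  assumes "\<And>j. 1 \<le> j \<Longrightarrow> j < a \<Longrightarrow> g j = 0" "1 \<le> a"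
  shows "(\<Sum>j=1..i. g j) = (\<Sum>j=a..<Suc i. g j)"
  using assms by (intro sum.mono_neutral_right) auto

text \<open>Only the last two projections are nontrivial, so the update with full memory is the sweep of the
  short-term method.\<close>

lemma pq_sweep:
  assumes i: "1 \<le> i" "i \<le> N" and nd: "nondeg (i - 1)" and g: "gain_ok (i - 2)"
  defines "a \<equiv> max 1 (i - 2)"
  defines "D \<equiv> (y i - y (i - 1), r i - r (i - 1))"
  shows "(p i, q i) = sweep v p q a i D" "\<forall>j\<in>{a..i - 1}. \<zeta> i j = sweep_coeff v p q a D j"
proof -
  have a1: "1 \<le> a" by (simp add: a_def)
  have sw: "sweep v p q a i D =
      (fst D - (\<Sum>l\<in>{a..<i}. ((v l \<bullet> snd D) / (v l \<bullet> q l)) *\<^sub>R p l),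
       snd D - (\<Sum>l\<in>{a..<i}. ((v l \<bullet> snd D) / (v l \<bullet> q l)) *\<^sub>R q l))"
    "\<forall>l\<in>{a..<i}. sweep_coeff v p q a D l = (v l \<bullet> snd D) / (v l \<bullet> q l)"
    using sweep_biorthogonal[of a i v q p "fst D" "snd D"] orth i a1 by auto
  have \<zeta>: "\<zeta> i l = (v l \<bullet> snd D) / (v l \<bullet> q l)" if "l \<in> {1..<i}" for l
    using \<zeta>_eq[OF that i(2)] that nd by (auto simp: nondeg_def D_def field_simps)
  have z: "\<zeta> i l = 0" if "1 \<le> l" "l < a" for l
    using that i nd g by (intro \<zeta>_zero) (auto simp: a_def)
  have eq: "(\<Sum>j=1..i - 1. \<zeta> i j *\<^sub>R f j) = (\<Sum>l\<in>{a..<i}. ((v l \<bullet> snd D) / (v l \<bullet> q l)) *\<^sub>R f l)"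
    for f :: "nat \<Rightarrow> real^'n"
  proof -
    have "(\<Sum>j=1..i - 1. \<zeta> i j *\<^sub>R f j) = (\<Sum>j=a..<Suc (i - 1). \<zeta> i j *\<^sub>R f j)"
      using z a1 by (intro sum_truncate) auto
    also have "\<dots> = (\<Sum>l\<in>{a..<i}. ((v l \<bullet> snd D) / (v l \<bullet> q l)) *\<^sub>R f l)"
      using \<zeta> a1 i by (intro sum.cong) auto
    finally show ?thesis .
  qed
  show "(p i, q i) = sweep v p q a i D"
    unfolding sw(1) p_def[OF i] q_def[OF i] eq by (simp add: D_def)
  show "\<forall>j\<in>{a..i - 1}. \<zeta> i j = sweep_coeff v p q a D j"
    using sw(2) \<zeta> a1 i by auto
qed

lemma x_sweep:
  assumes i: "i \<le> N" and nd: "nondeg i" and g: "gain_ok (i - 2)"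
  defines "a \<equiv> max 1 (i - 1)"
  shows "\<forall>j\<in>{a..i}. \<Gamma> i j = sweep_coeff v p q a (y i, r i) j"
    "i < N \<Longrightarrow> y (Suc i) = fst (sweep v p q a (Suc i) (y i, r i))
       + b i *\<^sub>R snd (sweep v p q a (Suc i) (y i, r i))"
proof -
  have a1: "1 \<le> a" by (simp add: a_def)
  have sw: "sweep v p q a (Suc i) (y i, r i) =
      (y i - (\<Sum>l\<in>{a..<Suc i}. ((v l \<bullet> r i) / (v l \<bullet> q l)) *\<^sub>R p l),
       r i - (\<Sum>l\<in>{a..<Suc i}. ((v l \<bullet> r i) / (v l \<bullet> q l)) *\<^sub>R q l))"
    "\<forall>l\<in>{a..<Suc i}. sweep_coeff v p q a (y i, r i) l = (v l \<bullet> r i) / (v l \<bullet> q l)"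
    using sweep_biorthogonal[of a "Suc i" v q p "y i" "r i"] orth i a1 by auto
  have \<Gamma>: "\<Gamma> i l = (v l \<bullet> r i) / (v l \<bullet> q l)" if "l \<in> {1..i}" for l
    using \<Gamma>_eq[OF that i] that nd by (auto simp: nondeg_def field_simps)
  have z: "\<Gamma> i l = 0" if "1 \<le> l" "l < a" for l
    using that i nd g nondeg_mono[of i "i - 1"] by (intro \<Gamma>_zero) (auto simp: a_def)
  have eq: "(\<Sum>j=1..i. \<Gamma> i j *\<^sub>R f j) = (\<Sum>l\<in>{a..<Suc i}. ((v l \<bullet> r i) / (v l \<bullet> q l)) *\<^sub>R f l)"
    for f :: "nat \<Rightarrow> real^'n"
  proof -
    have "(\<Sum>j=1..i. \<Gamma> i j *\<^sub>R f j) = (\<Sum>j=a..<Suc i. \<Gamma> i j *\<^sub>R f j)"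
      using z a1 by (intro sum_truncate) auto
    also have "\<dots> = (\<Sum>l\<in>{a..<Suc i}. ((v l \<bullet> r i) / (v l \<bullet> q l)) *\<^sub>R f l)"
      using \<Gamma> a1 i by (intro sum.cong) auto
    finally show ?thesis .
  qed
  show "\<forall>j\<in>{a..i}. \<Gamma> i j = sweep_coeff v p q a (y i, r i) j"
    using sw(2) \<Gamma> a1 by auto
  assume "i < N"
  then show "y (Suc i) = fst (sweep v p q a (Suc i) (y i, r i))
       + b i *\<^sub>R snd (sweep v p q a (Suc i) (y i, r i))"
    using y_Suc[of i] unfolding sw(1) rb_def eq by (simp add: algebra_simps)
qed

lemma rb_truncated:
  assumes "1 \<le> i" "i < N" "nondeg i" "gain_ok (i - 1)"
  shows "b i *\<^sub>R (A *v rb i) = - q (Suc i) - \<phi> i i *\<^sub>R q i"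
proof -
  have "\<phi> i j = 0" if "1 \<le> j" "j < i" for j
    using that assms gain_ok_mono[OF assms(4), of j] by (intro \<phi>_zero) auto
  then have "(\<Sum>j=1..i. \<phi> i j *\<^sub>R q j) = (\<Sum>j=i..<Suc i. \<phi> i j *\<^sub>R q j)"
    using assms by (intro sum_truncate) auto
  then show ?thesis using A_rb[OF assms(2)] by simp
qed

abbreviation \<psi> :: "nat \<Rightarrow> real" where "\<psi> \<equiv> cycle_phi \<zeta> \<Gamma>"

text \<open>Apply \<open>A\<close> to \<open>rb_step\<close> and use that \<open>b l\<close> times \<open>A rb l\<close> is \<open>- q (l + 1) - \<phi> l l q l\<close>.\<close>

lemma three_term:
  assumes i: "1 \<le> i" "i < N" and nd: "nondeg i" and g: "gain_ok i"
  shows "(1 - \<Gamma> i i) *\<^sub>R (A *v q i) =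
    (\<psi> (i - 1) / b (i - 1)) *\<^sub>R q (i - 1) + (1 / b (i - 1) - \<psi> i / b i) *\<^sub>R q i - (1 / b i) *\<^sub>R q (Suc i)"
proof -
  have 1: "(1 - \<Gamma> i i) *\<^sub>R (A *v q i) = A *v rb i - A *v rb (i - 1)"
    using rb_step[of i] nondeg_mono[OF nd, of "i - 1"] i by (metis diff_le_self less_imp_le mv_simps(2,3))
  have 2: "A *v rb l = - (1 / b l) *\<^sub>R q (Suc l) - (\<psi> l / b l) *\<^sub>R q l" if "l \<le> i" for l
  proof -
    have "b l *\<^sub>R (A *v rb l) = - q (Suc l) - \<psi> l *\<^sub>R q l"
    proof (cases "l = 0")
      case True
      then show ?thesis using A_rb[of 0] i by (simp add: cycle_phi_def \<phi>_def)
    next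
      case False
      then show ?thesis
        using rb_truncated[of l] that i nondeg_mono[OF nd, of l] gain_ok_mono[OF g, of "l - 1"]
        by (simp add: cycle_phi_def \<phi>_def)
    qed
    then have "(1 / b l) *\<^sub>R (b l *\<^sub>R (A *v rb l)) = (1 / b l) *\<^sub>R (- q (Suc l) - \<psi> l *\<^sub>R q l)" by simp
    then show ?thesis using b0[of l] by (simp add: algebra_simps)
  qed
  show ?thesis unfolding 1 2[OF order.refl] 2[of "i - 1", OF diff_le_self]
    using i(1) by (simp add: algebra_simps)
qed

abbreviation tri :: "nat \<Rightarrow> nat \<Rightarrow> real" where "tri \<equiv> tri_entry b \<zeta> \<Gamma>"

lemma tri_inner:
  assumes a: "a + 1 < N" and c: "c + 1 < N" and nd: "nondeg (N - 1)" and g: "gain_ok (N - 1)"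
  shows "v (a + 1) \<bullet> (A *v q (c + 1)) = tri a c * (v (a + 1) \<bullet> q (a + 1))"
proof -
  define i where "i = c + 1"
  define e where "e = 1 - \<Gamma> i i"
  have i: "1 \<le> i" "i < N" using c by (auto simp: i_def)
  have e: "e \<noteq> 0" using g i by (auto simp: gain_ok_def e_def)
  have "e *\<^sub>R (A *v q i) =
    (\<psi> (i - 1) / b (i - 1)) *\<^sub>R q (i - 1) + (1 / b (i - 1) - \<psi> i / b i) *\<^sub>R q i - (1 / b i) *\<^sub>R q (Suc i)"
    unfolding e_def
    using i nondeg_mono[OF nd, of i] gain_ok_mono[OF g, of i] by (intro three_term) auto
  then have "e * (v (a + 1) \<bullet> (A *v q i)) =
     (\<psi> (i - 1) / b (i - 1)) * (v (a + 1) \<bullet> q (i - 1)) + (1 / b (i - 1) - \<psi> i / b i) * (v (a + 1) \<bullet> q i)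
      - (1 / b i) * (v (a + 1) \<bullet> q (Suc i))"
    by (metis (no_types, lifting) inner_add_right inner_diff_right inner_scaleR_right)
  also have "\<dots> = e * (tri a c * (v (a + 1) \<bullet> q (a + 1)))"
  proof -
    have z: "\<psi> 0 = 0" by (simp add: cycle_phi_def \<phi>_def)
    have o: "v (a + 1) \<bullet> q j = 0" if "j \<in> {1..N}" "j \<noteq> a + 1" for j
      using orth[of "a + 1" j] a that by auto
    consider "a + 1 = c" | "a = c" | "a = c + 1" | "a + 1 \<noteq> c" "a \<noteq> c" "a \<noteq> c + 1" by blast
    then show ?thesis
    proof cases
      case 1
      then have "tri a c = \<psi> c / (b c * e)" by (simp add: tri_entry_def Let_def i_def e_def)
      then show ?thesis using 1 o[of i] o[of "Suc i"] i e by (simp add: i_def)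
    next
      case 2
      have "\<psi> (i - 1) / b (i - 1) * (v (a + 1) \<bullet> q (i - 1)) = 0"
        using o[of "i - 1"] i 2 z by (cases "i - 1 = 0") (auto simp: i_def)
      moreover have "tri a c = 1 / e * (1 / b c - \<psi> i / b i)"
        using 2 by (simp add: tri_entry_def Let_def i_def e_def)
      ultimately show ?thesis using 2 o[of "Suc i"] i e by (auto simp: i_def)
    next
      case 3
      have "\<psi> (i - 1) / b (i - 1) * (v (a + 1) \<bullet> q (i - 1)) = 0"
        using o[of "i - 1"] i 3 z by (cases "i - 1 = 0") (auto simp: i_def)
      moreover have "tri a c = - 1 / (b i * e)"
        using 3 by (simp add: tri_entry_def Let_def i_def e_def)
      ultimately show ?thesis using 3 o[of i] i e by (auto simp: i_def)
    next
      case 4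
      have "\<psi> (i - 1) / b (i - 1) * (v (a + 1) \<bullet> q (i - 1)) = 0"
        using o[of "i - 1"] i 4 z by (cases "i - 1 = 0") (auto simp: i_def)
      then show ?thesis using 4 o[of i] o[of "Suc i"] i
        by (auto simp: tri_entry_def Let_def i_def)
    qed
  qed
  finally show ?thesis using e by (simp add: i_def)
qed

text \<open>The numbers \<open>v i \<bullet> q i\<close> have a common sign, negative for Type-I and positive for Type-II, and this
  permits the use of absolute values as weights.\<close>

lemma tri_weighted_symmetric:
  assumes pos: "\<And>u. 0 \<le> u \<bullet> (A *v u)"
    and a: "a + 1 < N" and c: "c + 1 < N" and nd: "nondeg (N - 1)" and g: "gain_ok (N - 1)"
  shows "\<bar>v (a + 1) \<bullet> q (a + 1)\<bar> * tri a c = \<bar>v (c + 1) \<bullet> q (c + 1)\<bar> * tri c a"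
proof -
  have "\<exists>s. \<forall>i\<in>{1..N}. \<bar>v i \<bullet> q i\<bar> = s * (v i \<bullet> q i)"
  proof (cases ty)
    case Type_I
    then have "\<forall>i\<in>{1..N}. \<bar>v i \<bullet> q i\<bar> = (-1) * (v i \<bullet> q i)"
      using pos by (auto simp: v_def q_eq)
    then show ?thesis by blast
  next
    case Type_II
    then have "\<forall>i\<in>{1..N}. \<bar>v i \<bullet> q i\<bar> = 1 * (v i \<bullet> q i)" by (auto simp: v_def)
    then show ?thesis by blast
  qed
  then obtain s where s: "\<And>i. i \<in> {1..N} \<Longrightarrow> \<bar>v i \<bullet> q i\<bar> = s * (v i \<bullet> q i)" by blast
  have "tri a c * (v (a + 1) \<bullet> q (a + 1)) = tri c a * (v (c + 1) \<bullet> q (c + 1))"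
    using tri_inner[OF a c nd g] tri_inner[OF c a nd g] v_A_sym[of "a + 1" "c + 1"] a c by simp
  then show ?thesis using s[of "a + 1"] s[of "c + 1"] a c by (simp add: mult.assoc mult.commute)
qed

end

section \<open>Comparison of a nonlinear cycle with its linearisation\<close>

text \<open>The three steps of an iteration as predicates on sequences numbered from the restart. Process I
  satisfies them by definition and Process II by \<open>pq_sweep\<close> and \<open>x_sweep\<close>, so one lemma about each
  predicate serves to compare the two.\<close>

definition pq_update ::
  "(nat \<Rightarrow> real^'n) \<Rightarrow> (nat \<Rightarrow> real^'n) \<Rightarrow> (nat \<Rightarrow> real^'n) \<Rightarrow> (nat \<Rightarrow> real^'n) \<Rightarrow> (nat \<Rightarrow> real^'n)
    \<Rightarrow> (nat \<Rightarrow> nat \<Rightarrow> real) \<Rightarrow> nat \<Rightarrow> bool" where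
  "pq_update v p q x r \<zeta> i \<longleftrightarrow>
     (let D = (x i - x (i - 1), r i - r (i - 1)); a = max 1 (i - 2) in
       (p i, q i) = sweep v p q a i D \<and> (\<forall>j\<in>{a..i - 1}. \<zeta> i j = sweep_coeff v p q a D j))"

definition gain_update ::
  "(nat \<Rightarrow> real^'n) \<Rightarrow> (nat \<Rightarrow> real^'n) \<Rightarrow> (nat \<Rightarrow> real^'n) \<Rightarrow> (nat \<Rightarrow> real^'n) \<Rightarrow> (nat \<Rightarrow> real^'n)
    \<Rightarrow> (nat \<Rightarrow> nat \<Rightarrow> real) \<Rightarrow> nat \<Rightarrow> bool" where
  "gain_update v p q x r \<Gamma> i \<longleftrightarrow>
     (let a = max 1 (i - 1) in \<forall>j\<in>{a..i}. \<Gamma> i j = sweep_coeff v p q a (x i, r i) j)"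

definition x_update ::
  "(nat \<Rightarrow> real^'n) \<Rightarrow> (nat \<Rightarrow> real^'n) \<Rightarrow> (nat \<Rightarrow> real^'n) \<Rightarrow> (nat \<Rightarrow> real^'n) \<Rightarrow> (nat \<Rightarrow> real^'n)
    \<Rightarrow> (nat \<Rightarrow> real) \<Rightarrow> nat \<Rightarrow> bool" where
  "x_update v p q x r b i \<longleftrightarrow>
     (let S = sweep v p q (max 1 (i - 1)) (Suc i) (x i, r i) in x (Suc i) = fst S + b i *\<^sub>R snd S)"

context small_scale begin

lemma ord_uniform:
  assumes "finite I" "\<And>i. i \<in> I \<Longrightarrow> ord e (f i)"
  shows "\<exists>C>0. \<forall>\<^sub>F w in F. \<forall>i\<in>I. norm (f i w) \<le> C * \<delta> w ^ e"
proof -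
  have "\<exists>C. \<forall>i\<in>I. C i > 0 \<and> (\<forall>\<^sub>F w in F. norm (f i w) \<le> C i * \<delta> w ^ e)"
    using assms(2) unfolding ord_def by (intro bchoice) blast
  then obtain C where C: "\<And>i. i \<in> I \<Longrightarrow> C i > 0"
    "\<And>i. i \<in> I \<Longrightarrow> \<forall>\<^sub>F w in F. norm (f i w) \<le> C i * \<delta> w ^ e" by blast
  have le: "C i \<le> 1 + sum C I" if "i \<in> I" for i
    using member_le_sum[of i I C] that C(1) assms(1) by (force intro: less_imp_le)
  have "\<forall>\<^sub>F w in F. \<forall>i\<in>I. norm (f i w) \<le> (1 + sum C I) * \<delta> w ^ e"
  proof (rule eventually_ball_finite[OF assms(1)], rule ballI)
    fix i assume i: "i \<in> I"
    show "\<forall>\<^sub>F w in F. norm (f i w) \<le> (1 + sum C I) * \<delta> w ^ e"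
      using C(2)[OF i] pos
    proof eventually_elim
      case (elim w)
      have "C i * \<delta> w ^ e \<le> (1 + sum C I) * \<delta> w ^ e"
        using le[OF i] elim(2) by (intro mult_right_mono) auto
      with elim(1) show ?case by linarith
    qed
  qed
  moreover have "1 + sum C I > 0" using C(1) by (smt (verit) sum_nonneg)
  ultimately show ?thesis by blast
qed

lemma lower_uniform:
  assumes "finite I" "\<And>i. i \<in> I \<Longrightarrow> lower e (f i)"
  shows "\<exists>c>0. \<forall>\<^sub>F w in F. \<forall>i\<in>I. c * \<delta> w ^ e \<le> \<bar>f i w\<bar>"
  using assms
proof (induction I)
  case empty
  show ?case by (intro exI[of _ 1]) simp
next
  case (insert k I)
  then obtain c where c: "c > 0" "\<forall>\<^sub>F w in F. \<forall>i\<in>I. c * \<delta> w ^ e \<le> \<bar>f i w\<bar>" by auto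
  obtain d where d: "d > 0" "\<forall>\<^sub>F w in F. d * \<delta> w ^ e \<le> \<bar>f k w\<bar>"
    using insert.prems[of k] by (auto simp: lower_def)
  have "\<forall>\<^sub>F w in F. \<forall>i\<in>insert k I. min c d * \<delta> w ^ e \<le> \<bar>f i w\<bar>"
    using c(2) d(2) pos
  proof eventually_elim
    case (elim w)
    have "min c d * \<delta> w ^ e \<le> c * \<delta> w ^ e" "min c d * \<delta> w ^ e \<le> d * \<delta> w ^ e"
      using elim(3) by (auto intro: mult_right_mono)
    with elim(1,2) show ?case by force
  qed
  then show ?case using c(1) d(1) by (intro exI[of _ "min c d"]) auto
qed

lemma near_vsel:
  assumes "near 1 (\<lambda>w. p w i) (\<lambda>w. p' w i)" "near 1 (\<lambda>w. q w i) (\<lambda>w. q' w i)"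
  shows "near 1 (\<lambda>w. vsel ty (p w) (q w) i) (\<lambda>w. vsel ty (p' w) (q' w) i)"
  using assms by (cases ty) auto

lemma near_pq_update:
  assumes dirs: "\<forall>j\<in>{1..<i}. near_directions v v' p p' q q' j"
    and x: "near 1 (\<lambda>w. x w i) (\<lambda>w. x' w i)" "near 1 (\<lambda>w. x w (i - 1)) (\<lambda>w. x' w (i - 1))"
    and r: "near 1 (\<lambda>w. r w i) (\<lambda>w. r' w i)" "near 1 (\<lambda>w. r w (i - 1)) (\<lambda>w. r' w (i - 1))"
    and ev: "\<forall>\<^sub>F w in F. pq_update (v w) (p w) (q w) (x w) (r w) (\<zeta> w) i"
      "\<forall>\<^sub>F w in F. pq_update (v' w) (p' w) (q' w) (x' w) (r' w) (\<zeta>' w) i"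
    and i: "1 \<le> i"
  shows "near 1 (\<lambda>w. p w i) (\<lambda>w. p' w i)" "near 1 (\<lambda>w. q w i) (\<lambda>w. q' w i)"
    "\<forall>j\<in>{max 1 (i - 2)..i - 1}. near 0 (\<lambda>w. \<zeta> w i j) (\<lambda>w. \<zeta>' w i j)"
proof -
  let ?a = "max 1 (i - 2)"
  have "\<forall>j\<in>{?a..<i}. near_directions v v' p p' q q' j" using dirs by auto
  note sw = near_sweep[OF this near_diff[OF x] near_diff[OF r]]
  show "near 1 (\<lambda>w. p w i) (\<lambda>w. p' w i)"
    by (rule near_cong[OF conjunct1[OF sw]]; use ev in eventually_elim)
       (simp_all add: pq_update_def Let_def prod_eq_iff)
  show "near 1 (\<lambda>w. q w i) (\<lambda>w. q' w i)"
    by (rule near_cong[OF conjunct1[OF conjunct2[OF sw]]]; use ev in eventually_elim)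
       (simp_all add: pq_update_def Let_def prod_eq_iff)
  show "\<forall>j\<in>{max 1 (i - 2)..i - 1}. near 0 (\<lambda>w. \<zeta> w i j) (\<lambda>w. \<zeta>' w i j)"
  proof
    fix j assume j: "j \<in> {?a..i - 1}"
    show "near 0 (\<lambda>w. \<zeta> w i j) (\<lambda>w. \<zeta>' w i j)"
    proof (rule near_cong)
      show "near 0
        (\<lambda>w. sweep_coeff (v w) (p w) (q w) ?a (x w i - x w (i - 1), r w i - r w (i - 1)) j)
        (\<lambda>w. sweep_coeff (v' w) (p' w) (q' w) ?a (x' w i - x' w (i - 1), r' w i - r' w (i - 1)) j)"
        using conjunct2[OF conjunct2[OF sw]] j i by auto
    qed (use ev in \<open>eventually_elim, use j in \<open>simp add: pq_update_def Let_def\<close>\<close>)+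
  qed
qed

lemma near_x_update:
  assumes dirs: "\<forall>j\<in>{1..i}. near_directions v v' p p' q q' j"
    and x: "near 1 (\<lambda>w. x w i) (\<lambda>w. x' w i)" and r: "near 1 (\<lambda>w. r w i) (\<lambda>w. r' w i)"
  shows "\<lbrakk>\<forall>\<^sub>F w in F. gain_update (v w) (p w) (q w) (x w) (r w) (\<Gamma> w) i;
      \<forall>\<^sub>F w in F. gain_update (v' w) (p' w) (q' w) (x' w) (r' w) (\<Gamma>' w) i\<rbrakk>
      \<Longrightarrow> \<forall>j\<in>{max 1 (i - 1)..i}. near 0 (\<lambda>w. \<Gamma> w i j) (\<lambda>w. \<Gamma>' w i j)"
    and "\<lbrakk>\<forall>\<^sub>F w in F. x_update (v w) (p w) (q w) (x w) (r w) (b w) i;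
      \<forall>\<^sub>F w in F. x_update (v' w) (p' w) (q' w) (x' w) (r' w) (b w) i; ord 0 (\<lambda>w. b w i)\<rbrakk>
      \<Longrightarrow> near 1 (\<lambda>w. x w (Suc i)) (\<lambda>w. x' w (Suc i))"
proof -
  let ?a = "max 1 (i - 1)"
  have "\<forall>j\<in>{?a..<Suc i}. near_directions v v' p p' q q' j" using dirs by auto
  note sw = near_sweep[OF this x r]
  show "\<forall>j\<in>{?a..i}. near 0 (\<lambda>w. \<Gamma> w i j) (\<lambda>w. \<Gamma>' w i j)"
    if ev: "\<forall>\<^sub>F w in F. gain_update (v w) (p w) (q w) (x w) (r w) (\<Gamma> w) i"
      "\<forall>\<^sub>F w in F. gain_update (v' w) (p' w) (q' w) (x' w) (r' w) (\<Gamma>' w) i"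
  proof
    fix j assume j: "j \<in> {?a..i}"
    show "near 0 (\<lambda>w. \<Gamma> w i j) (\<lambda>w. \<Gamma>' w i j)"
    proof (rule near_cong)
      show "near 0 (\<lambda>w. sweep_coeff (v w) (p w) (q w) ?a (x w i, r w i) j)
        (\<lambda>w. sweep_coeff (v' w) (p' w) (q' w) ?a (x' w i, r' w i) j)"
        using conjunct2[OF conjunct2[OF sw]] j by auto
    qed (use ev in \<open>eventually_elim, use j in \<open>simp add: gain_update_def Let_def\<close>\<close>)+
  qed
  show "near 1 (\<lambda>w. x w (Suc i)) (\<lambda>w. x' w (Suc i))"
    if ev: "\<forall>\<^sub>F w in F. x_update (v w) (p w) (q w) (x w) (r w) (b w) i"
      "\<forall>\<^sub>F w in F. x_update (v' w) (p' w) (q' w) (x' w) (r' w) (b w) i"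
      and b: "ord 0 (\<lambda>w. b w i)"
    by (rule near_cong[OF near_add[OF conjunct1[OF sw]
        near_scaleR[OF near_refl[OF b] conjunct1[OF conjunct2[OF sw]], unfolded add_0_left]]])
       (use ev in \<open>eventually_elim, simp add: x_update_def Let_def\<close>)+
qed

end

text \<open>A cycle of the method of length \<open>N\<close> inside the ball of radius \<open>\<rho>\<close>, with the fixed point moved to the
  origin. The step from iteration \<open>N\<close> to the next point is included, without any claim on where that
  point lies.\<close>

definition am_cycle ::
  "am_type \<Rightarrow> (real^'n \<Rightarrow> real^'n) \<Rightarrow> real \<Rightarrow> real \<Rightarrow> real \<Rightarrow> real \<Rightarrow> real \<Rightarrow> nat \<Rightarrow> (nat \<Rightarrow> real) \<Rightarrow>
    (nat \<Rightarrow> real^'n) \<Rightarrow> (nat \<Rightarrow> real^'n) \<Rightarrow> (nat \<Rightarrow> real^'n) \<Rightarrow>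
    (nat \<Rightarrow> nat \<Rightarrow> real) \<Rightarrow> (nat \<Rightarrow> nat \<Rightarrow> real) \<Rightarrow> bool" where
  "am_cycle ty H \<rho> \<tau> \<eta> \<beta> \<beta>' N b x p q \<zeta> \<Gamma> \<longleftrightarrow>
     (let r = (\<lambda>i. - H (x i)); v = vsel ty p q in
      (\<forall>i. \<beta> \<le> \<bar>b i\<bar> \<and> \<bar>b i\<bar> \<le> \<beta>') \<and>
      (\<forall>i\<le>N. norm (x i) \<le> \<rho> \<and> gain_update v p q x r \<Gamma> i \<and> x_update v p q x r b i) \<and>
      (\<forall>i\<in>{1..N}. norm (r i) \<le> \<eta> * norm (r 0) \<and> \<tau> * \<bar>v 1 \<bullet> q 1\<bar> \<le> \<bar>v i \<bullet> q i\<bar> \<and>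
        pq_update v p q x r \<zeta> i))"

text \<open>Here \<open>H y\<close> stands for \<open>h (xs + y)\<close>. Strong monotonicity and the quadratic error of the linearisation
  are the two properties of \<open>h\<close> on which the estimates rest.\<close>

locale linearisation =
  fixes H :: "real^'n \<Rightarrow> real^'n" and A :: "real^'n^'n" and \<rho> K \<mu> L \<tau> \<eta> \<beta> \<beta>' :: real
  assumes H0: "H 0 = 0"
    and monotone: "\<And>y z. norm y \<le> \<rho> \<Longrightarrow> norm z \<le> \<rho> \<Longrightarrow> \<mu> * (norm (y - z))\<^sup>2 \<le> (H y - H z) \<bullet> (y - z)"
    and quadratic: "\<And>y. norm y \<le> \<rho> \<Longrightarrow> norm (H y - A *v y) \<le> K * (norm y)\<^sup>2"
    and A_bound: "\<And>y. norm (A *v y) \<le> L * norm y"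
    and positive: "0 < \<rho>" "0 < K" "0 < \<mu>" "0 < L" "0 < \<tau>" "0 < \<eta>" "0 < \<beta>" "0 < \<beta>'"
    and A_pos: "\<And>u. 0 \<le> u \<bullet> (A *v u)"

locale am_family = small_scale F \<delta> + linearisation H A \<rho> K \<mu> L \<tau> \<eta> \<beta> \<beta>'
  for F :: "'w filter" and \<delta> :: "'w \<Rightarrow> real" and H :: "real^'n \<Rightarrow> real^'n" and A :: "real^'n^'n"
    and \<rho> K \<mu> L \<tau> \<eta> \<beta> \<beta>' :: real +
  fixes ty :: am_type and N :: nat
    and b :: "'w \<Rightarrow> nat \<Rightarrow> real" and x p q :: "'w \<Rightarrow> nat \<Rightarrow> real^'n"
    and \<zeta> \<Gamma> :: "'w \<Rightarrow> nat \<Rightarrow> nat \<Rightarrow> real"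
  assumes \<delta>_eq: "\<And>w. \<delta> w = norm (x w 0)"
    and cycle: "\<forall>\<^sub>F w in F. am_cycle ty H \<rho> \<tau> \<eta> \<beta> \<beta>' N (b w) (x w) (p w) (q w) (\<zeta> w) (\<Gamma> w)"
begin

definition r :: "'w \<Rightarrow> nat \<Rightarrow> real^'n" where "r w i = - H (x w i)"

definition v :: "'w \<Rightarrow> nat \<Rightarrow> real^'n" where "v w = vsel ty (p w) (q w)"

lemma r_fun: "r w = (\<lambda>i. - H (x w i))" by (simp add: r_def fun_eq_iff)

lemma cycle_facts:
  "\<forall>\<^sub>F w in F. \<beta> \<le> \<bar>b w i\<bar>" "\<forall>\<^sub>F w in F. \<bar>b w i\<bar> \<le> \<beta>'"
  "i \<le> N \<Longrightarrow> \<forall>\<^sub>F w in F. norm (x w i) \<le> \<rho>"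
  "i \<le> N \<Longrightarrow> \<forall>\<^sub>F w in F. gain_update (v w) (p w) (q w) (x w) (r w) (\<Gamma> w) i"
  "i \<le> N \<Longrightarrow> \<forall>\<^sub>F w in F. x_update (v w) (p w) (q w) (x w) (r w) (b w) i"
  "i \<in> {1..N} \<Longrightarrow> \<forall>\<^sub>F w in F. norm (r w i) \<le> \<eta> * norm (r w 0)"
  "i \<in> {1..N} \<Longrightarrow> \<forall>\<^sub>F w in F. \<tau> * \<bar>v w 1 \<bullet> q w 1\<bar> \<le> \<bar>v w i \<bullet> q w i\<bar>"
  "i \<in> {1..N} \<Longrightarrow> \<forall>\<^sub>F w in F. pq_update (v w) (p w) (q w) (x w) (r w) (\<zeta> w) i"
  using cycle by (auto elim!: eventually_mono simp: am_cycle_def Let_def r_fun v_def)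

lemma ord_b: "ord 0 (\<lambda>w. b w i)"
  by (rule ordI[of _ \<beta>']) (use cycle_facts(2) in simp)

lemma lower_b: "lower 0 (\<lambda>w. b w i)"
  unfolding lower_def using cycle_facts(1)[of i] positive by (intro exI[of _ \<beta>]) simp

lemma H_lower: "norm y \<le> \<rho> \<Longrightarrow> norm z \<le> \<rho> \<Longrightarrow> \<mu> * norm (y - z) \<le> norm (H y - H z)"
proof (cases "y = z")
  case False
  assume "norm y \<le> \<rho>" "norm z \<le> \<rho>"
  then have "\<mu> * (norm (y - z))\<^sup>2 \<le> norm (H y - H z) * norm (y - z)"
    using monotone norm_cauchy_schwarz order_trans by blast
  then have "(\<mu> * norm (y - z)) * norm (y - z) \<le> norm (H y - H z) * norm (y - z)"
    by (simp add: power2_eq_square mult.assoc)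
  then show ?thesis using False by simp
qed simp

lemma ord_quadratic:
  assumes "i \<le> N" "ord 1 (\<lambda>w. x w i)"
  shows "ord 2 (\<lambda>w. H (x w i) - A *v x w i)"
proof (rule ord_mono)
  show "ord 2 (\<lambda>w. x w i \<bullet> x w i)"
    using ord_inner[OF assms(2) assms(2)] by (simp add: numeral_2_eq_2)
  show "\<forall>\<^sub>F w in F. norm (H (x w i) - A *v x w i) \<le> K * norm (x w i \<bullet> x w i)"
    using cycle_facts(3)[OF assms(1)]
    by eventually_elim (use quadratic in \<open>simp add: power2_norm_eq_inner\<close>)
qed

lemma ord_A: "ord e f \<Longrightarrow> ord e (\<lambda>w. A *v f w)"
  by (erule ord_mono[where C = L]) (simp add: A_bound)

lemma ord_r_of_x: "i \<le> N \<Longrightarrow> ord 1 (\<lambda>w. x w i) \<Longrightarrow> ord 1 (\<lambda>w. r w i)"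
proof -
  assume *: "i \<le> N" "ord 1 (\<lambda>w. x w i)"
  have "ord 1 (\<lambda>w. H (x w i) - A *v x w i)"
    by (rule ord_decrease) (use ord_quadratic[OF *] in \<open>simp add: numeral_2_eq_2\<close>)
  from ord_add[OF this ord_A[OF *(2)]] have "ord 1 (\<lambda>w. H (x w i))" by simp
  from ord_minus[OF this] show ?thesis by (simp add: r_def)
qed

lemma ord_x0: "ord 1 (\<lambda>w. x w 0)"
  by (rule ordI[of _ 1]) (simp add: \<delta>_eq)

text \<open>The first restart test bounds the residual by that at the restart, and in the ball the residual
  controls the error.\<close>

lemma ord_x: "i \<le> N \<Longrightarrow> ord 1 (\<lambda>w. x w i)"
proof (cases "i = 0")
  case False
  assume i: "i \<le> N"
  then have iN: "i \<in> {1..N}" using False by auto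
  have "ord 1 (\<lambda>w. r w 0)" using ord_r_of_x[OF _ ord_x0] by simp
  moreover have "\<forall>\<^sub>F w in F. norm (x w i) \<le> (\<eta> / \<mu>) * norm (r w 0)"
    using cycle_facts(3)[OF i] cycle_facts(6)[OF iN]
  proof eventually_elim
    case (elim w)
    have "\<mu> * norm (x w i) \<le> \<eta> * norm (r w 0)"
      using H_lower[of "x w i" 0] elim i False positive H0 by (simp add: r_def)
    then show ?case using positive by (simp add: field_simps)
  qed
  ultimately show ?thesis by (rule ord_mono)
qed (use ord_x0 in simp)

lemma ord_r: "i \<le> N \<Longrightarrow> ord 1 (\<lambda>w. r w i)"
  by (rule ord_r_of_x[OF _ ord_x])

text \<open>The first direction is \<open>p 1 = b 0 * r 0\<close>, of length at least \<open>\<beta> \<mu> \<delta>\<close>. Strong monotonicity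
  bounds \<open>p 1 \<bullet> q 1\<close> below by \<open>\<mu> (norm (p 1))\<^sup>2\<close> in absolute value, and the length of \<open>q 1\<close> by
  \<open>\<mu> norm (p 1)\<close>.\<close>

lemma lower_first:
  assumes "1 \<le> N" shows "lower 2 (\<lambda>w. v w 1 \<bullet> q w 1)"
proof -
  define c where "c = (if ty = Type_I then \<mu> else \<mu>\<^sup>2) * (\<beta> * \<mu>)\<^sup>2"
  have N1: "1 \<in> {1..N}" and N0: "0 \<le> N" using assms by auto
  have "\<forall>\<^sub>F w in F. c * \<delta> w ^ 2 \<le> \<bar>v w 1 \<bullet> q w 1\<bar>"
    using cycle_facts(8)[OF N1] cycle_facts(5)[OF N0] cycle_facts(3)[OF N0] cycle_facts(3)[OF assms]
      cycle_facts(1)[of 0]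
  proof eventually_elim
    case (elim w)
    have x1: "x w 1 = x w 0 + b w 0 *\<^sub>R r w 0" using elim(2) by (simp add: x_update_def)
    have p: "p w 1 = x w 1 - x w 0" and q: "q w 1 = - (H (x w 1) - H (x w 0))"
      using elim(1) by (simp_all add: pq_update_def r_def)
    have n: "\<mu> * (norm (p w 1))\<^sup>2 \<le> (H (x w 1) - H (x w 0)) \<bullet> p w 1"
      "\<mu> * norm (p w 1) \<le> norm (H (x w 1) - H (x w 0))"
      unfolding p using monotone[of "x w 1" "x w 0"] H_lower[of "x w 1" "x w 0"] elim assms by auto
    have "\<mu> * \<delta> w \<le> norm (r w 0)"
      using H_lower[of "x w 0" 0] elim positive H0 by (simp add: r_def \<delta>_eq)
    then have "\<beta> * (\<mu> * \<delta> w) \<le> \<bar>b w 0\<bar> * norm (r w 0)"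
      using elim(5) positive by (intro mult_mono) (auto simp: \<delta>_eq)
    then have pn: "\<beta> * \<mu> * \<delta> w \<le> norm (p w 1)" unfolding p x1 by (simp add: mult.assoc)
    then have pn2: "(\<beta> * \<mu>)\<^sup>2 * \<delta> w ^ 2 \<le> (norm (p w 1))\<^sup>2"
      using positive power_mono[OF pn, of 2] by (simp add: power_mult_distrib \<delta>_eq)
    show ?case
    proof (cases ty)
      case Type_I
      have "c * \<delta> w ^ 2 \<le> \<mu> * (norm (p w 1))\<^sup>2"
        using mult_left_mono[OF pn2, of \<mu>] positive Type_I by (simp add: c_def)
      also have "\<dots> \<le> \<bar>v w 1 \<bullet> q w 1\<bar>"
      proof -
        have "v w 1 = p w 1" unfolding v_def by (simp add: Type_I)
        then have "v w 1 \<bullet> q w 1 = - ((H (x w 1) - H (x w 0)) \<bullet> p w 1)"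
          unfolding q by (simp add: inner_commute del: minus_diff_eq)
        with n(1) show ?thesis by linarith
      qed
      finally show ?thesis .
    next
      case Type_II
      have "c * \<delta> w ^ 2 \<le> \<mu>\<^sup>2 * (norm (p w 1))\<^sup>2"
        using mult_left_mono[OF pn2, of "\<mu>\<^sup>2"] positive Type_II by (simp add: c_def)
      also have "\<dots> \<le> (norm (H (x w 1) - H (x w 0)))\<^sup>2"
        using power_mono[OF n(2), of 2] positive by (simp add: power_mult_distrib)
      also have "\<dots> = \<bar>v w 1 \<bullet> q w 1\<bar>"
      proof -
        have "v w 1 = q w 1" unfolding v_def by (simp add: Type_II)
        then show ?thesis unfolding q by (simp add: power2_norm_eq_inner del: minus_diff_eq)
      qed
      finally show ?thesis .
    qed
  qed
  moreover have "c > 0" using positive by (simp add: c_def)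
  ultimately show ?thesis by (auto simp: lower_def)
qed

lemma lower_vq:
  assumes "i \<in> {1..N}" shows "lower 2 (\<lambda>w. v w i \<bullet> q w i)"
  by (rule lower_mono[OF lower_first positive(5) cycle_facts(7)[OF assms]]) (use assms in simp)

lemma ord_v: "ord 1 (\<lambda>w. p w j) \<Longrightarrow> ord 1 (\<lambda>w. q w j) \<Longrightarrow> ord 1 (\<lambda>w. v w j)"
  unfolding v_def by (cases ty) auto

lemma ord_pq: "i \<in> {1..N} \<Longrightarrow> ord 1 (\<lambda>w. p w i) \<and> ord 1 (\<lambda>w. q w i)"
proof (induction i rule: less_induct)
  case (less i)
  have le: "i \<le> N" "i - 1 \<le> N" "1 \<le> i" using less.prems by auto
  have "\<forall>j\<in>{1..<i}. near_directions v v p p q q j"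
    unfolding near_directions_def using less lower_vq
    by (auto intro!: near_refl ord_v simp del: One_nat_def)
  note near_pq_update[OF this near_refl near_refl near_refl near_refl
      cycle_facts(8)[OF less.prems] cycle_facts(8)[OF less.prems]]
  note n = this[OF ord_x[OF le(1)] ord_x[OF le(2)] ord_r[OF le(1)] ord_r[OF le(2)] le(3)]
  from near_ord(1)[OF n(1)] near_ord(1)[OF n(2)] show ?case by blast
qed

lemma near_self: "\<forall>j\<in>{1..N}. near_directions v v p p q q j"
  unfolding near_directions_def using ord_pq lower_vq
  by (auto intro!: near_refl ord_v simp del: One_nat_def)

text \<open>This uses no information on the point after the cycle, and so it can serve to show that the point
  lies in the ball.\<close>

lemma ord_next: "ord 1 (\<lambda>w. x w (Suc N))"
  using near_x_update(2)[OF near_self near_refl[OF ord_x] near_refl[OF ord_r]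
      cycle_facts(5) cycle_facts(5) ord_b] by (auto intro: near_ord(1))

end

locale am_comparison = am_family F \<delta> H A \<rho> K \<mu> L \<tau> \<eta> \<beta> \<beta>' ty N b x p q \<zeta> \<Gamma>
  for F :: "'w filter" and \<delta> and H :: "real^'n \<Rightarrow> real^'n"
    and A \<rho> K \<mu> L \<tau> \<eta> \<beta> \<beta>' ty N b x p q \<zeta> \<Gamma> +
  fixes \<tau>\<^sub>0 :: real and y ph qh rh vh :: "'w \<Rightarrow> nat \<Rightarrow> real^'n" and \<zeta>h \<Gamma>h :: "'w \<Rightarrow> nat \<Rightarrow> nat \<Rightarrow> real"
  assumes gain: "\<forall>\<^sub>F w in F. \<forall>j. 1 \<le> j \<longrightarrow> j < N \<longrightarrow> \<tau>\<^sub>0 \<le> \<bar>1 - \<Gamma> w j j\<bar>"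
    and \<tau>\<^sub>0: "0 < \<tau>\<^sub>0"
    and lin: "\<forall>\<^sub>F w in F. linear_cycle ty A (b w) (y w) (ph w) (qh w) (rh w) (vh w) (\<zeta>h w) (\<Gamma>h w) N"
    and y0: "\<And>w. y w 0 = x w 0"
begin

lemma rh_eq: "\<forall>\<^sub>F w in F. rh w i = - (A *v y w i)"
  using lin by eventually_elim (rule linear_cycle.r_def)

lemma vh_eq: "\<forall>\<^sub>F w in F. vh w = vsel ty (ph w) (qh w)"
  using lin by eventually_elim (rule linear_cycle.v_def)

text \<open>The only place where the two processes differ: the error of the linearisation is quadratic, so it
  has order \<open>2\<close> while the residuals have order \<open>1\<close>.\<close>

lemma near_r:
  assumes i: "i \<le> N" and x: "near 1 (\<lambda>w. x w i) (\<lambda>w. y w i)"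
  shows "near 1 (\<lambda>w. r w i) (\<lambda>w. rh w i)"
  unfolding near_def
proof
  show "ord 1 (\<lambda>w. r w i)" by (rule ord_r[OF i])
  have "ord 2 (\<lambda>w. - (H (x w i) - A *v x w i) - A *v (x w i - y w i))"
    by (rule ord_diff[OF ord_minus[OF ord_quadratic[OF i ord_x[OF i]]] ord_A])
       (use near_ord(3)[OF x] in \<open>simp add: numeral_2_eq_2\<close>)
  then have "ord (Suc 1) (\<lambda>w. - (H (x w i) - A *v x w i) - A *v (x w i - y w i))"
    by (simp add: numeral_2_eq_2)
  then show "ord (Suc 1) (\<lambda>w. r w i - rh w i)"
    by (rule ord_cong) (use rh_eq[of i] in eventually_elim,
      simp add: r_def matrix_vector_mult_diff_distrib)
qed

definition close :: "nat \<Rightarrow> bool" where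
  "close i \<longleftrightarrow> near 1 (\<lambda>w. x w i) (\<lambda>w. y w i) \<and> near 1 (\<lambda>w. r w i) (\<lambda>w. rh w i) \<and>
     (1 \<le> i \<longrightarrow> near 1 (\<lambda>w. p w i) (\<lambda>w. ph w i) \<and> near 1 (\<lambda>w. q w i) (\<lambda>w. qh w i) \<and>
       (\<forall>j\<in>{max 1 (i - 2)..i - 1}. near 0 (\<lambda>w. \<zeta> w i j) (\<lambda>w. \<zeta>h w i j))) \<and>
     (\<forall>j\<in>{max 1 (i - 1)..i}. near 0 (\<lambda>w. \<Gamma> w i j) (\<lambda>w. \<Gamma>h w i j))"

lemma near_v:
  assumes "near 1 (\<lambda>w. p w j) (\<lambda>w. ph w j)" "near 1 (\<lambda>w. q w j) (\<lambda>w. qh w j)"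
  shows "near 1 (\<lambda>w. v w j) (\<lambda>w. vh w j)"
  by (rule near_cong[OF near_vsel[where p = p and p' = ph and q = q and q' = qh and i = j and ty = ty,
        OF assms]])
     (use vh_eq in \<open>auto simp: v_def elim: eventually_mono\<close>)

lemma dirs_close:
  assumes "1 \<le> j" "j \<le> N" "near 1 (\<lambda>w. p w j) (\<lambda>w. ph w j)" "near 1 (\<lambda>w. q w j) (\<lambda>w. qh w j)"
  shows "near_directions v vh p ph q qh j"
  using assms near_v lower_vq by (auto simp: near_directions_def)

lemma lower_vqh:
  assumes "1 \<le> j" "j \<le> N" "near 1 (\<lambda>w. p w j) (\<lambda>w. ph w j)" "near 1 (\<lambda>w. q w j) (\<lambda>w. qh w j)"
  shows "lower 2 (\<lambda>w. vh w j \<bullet> qh w j)" "ord 2 (\<lambda>w. vh w j \<bullet> qh w j)"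
proof -
  have n: "near 2 (\<lambda>w. v w j \<bullet> q w j) (\<lambda>w. vh w j \<bullet> qh w j)"
    using near_inner[OF near_v[OF assms(3,4)] assms(4)] by (simp add: numeral_2_eq_2)
  show "lower 2 (\<lambda>w. vh w j \<bullet> qh w j)" by (rule near_lower[OF n lower_vq]) (use assms in auto)
  show "ord 2 (\<lambda>w. vh w j \<bullet> qh w j)" by (rule near_ord(2)[OF n])
qed

lemma nondeg_ev:
  assumes "\<And>j. 1 \<le> j \<Longrightarrow> j \<le> l \<Longrightarrow>
     near 1 (\<lambda>w. p w j) (\<lambda>w. ph w j) \<and> near 1 (\<lambda>w. q w j) (\<lambda>w. qh w j)" "l \<le> N"
  shows "\<forall>\<^sub>F w in F. linear_cycle.nondeg (qh w) (vh w) l"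
proof -
  have "\<forall>\<^sub>F w in F. \<forall>j\<in>{1..l}. vh w j \<bullet> qh w j \<noteq> 0"
    by (rule eventually_ball_finite)
       (use assms in \<open>auto intro!: lower_nonzero lower_vqh\<close>)
  with lin show ?thesis by eventually_elim (simp add: linear_cycle.nondeg_def)
qed

lemma lower_gain: "1 \<le> j \<Longrightarrow> j < N \<Longrightarrow> lower 0 (\<lambda>w. 1 - \<Gamma> w j j)"
  unfolding lower_def using \<tau>\<^sub>0 gain by (intro exI[of _ \<tau>\<^sub>0]) (auto elim!: eventually_mono)

lemma near_one: "near 0 (\<lambda>w. 1 :: real) (\<lambda>w. 1)"
  by (rule near_refl, rule ordI[of _ 1]) simp

lemma gain_ok_ev:
  assumes "\<And>j. j \<le> l \<Longrightarrow> close j" "l < N"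
  shows "\<forall>\<^sub>F w in F. linear_cycle.gain_ok (\<Gamma>h w) l"
proof -
  have "\<forall>\<^sub>F w in F. \<forall>j\<in>{1..l}. 1 - \<Gamma>h w j j \<noteq> 0"
  proof (rule eventually_ball_finite)
    show "\<forall>j\<in>{1..l}. \<forall>\<^sub>F w in F. 1 - \<Gamma>h w j j \<noteq> 0"
    proof
      fix j assume j: "j \<in> {1..l}"
      have "near 0 (\<lambda>w. \<Gamma> w j j) (\<lambda>w. \<Gamma>h w j j)" using assms(1)[of j] j by (auto simp: close_def)
      then have "near 0 (\<lambda>w. 1 - \<Gamma> w j j) (\<lambda>w. 1 - \<Gamma>h w j j)" by (rule near_diff[OF near_one])
      moreover have "lower 0 (\<lambda>w. 1 - \<Gamma> w j j)" by (rule lower_gain) (use j assms(2) in auto)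
      ultimately have "lower 0 (\<lambda>w. 1 - \<Gamma>h w j j)" by (rule near_lower)
      then show "\<forall>\<^sub>F w in F. 1 - \<Gamma>h w j j \<noteq> 0" by (rule lower_nonzero)
    qed
  qed simp
  with lin show ?thesis by eventually_elim (auto simp: linear_cycle.gain_ok_def)
qed

text \<open>Strong induction along the cycle. Closeness of the earlier directions and coefficients shows that
  Process II is not degenerate up to that point (for \<open>\<delta>\<close> small enough), so its update is given by the
  same sweeps as in the method, and \<open>near\<close> passes to the new quantities.\<close>

lemma close: "i \<le> N \<Longrightarrow> close i"
proof (induction i rule: less_induct)
  case (less i)
  have dirs: "near 1 (\<lambda>w. p w j) (\<lambda>w. ph w j) \<and> near 1 (\<lambda>w. q w j) (\<lambda>w. qh w j)"
    if "1 \<le> j" "j < i" for j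
    using less.IH[of j] that less.prems by (auto simp: close_def)
  have nd: "\<forall>\<^sub>F w in F. linear_cycle.nondeg (qh w) (vh w) (i - 1)"
    by (rule nondeg_ev) (use dirs less.prems in auto)
  have g: "\<forall>\<^sub>F w in F. linear_cycle.gain_ok (\<Gamma>h w) (i - 2)"
  proof (cases "i \<le> 2")
    case True
    from lin show ?thesis by eventually_elim (use True in \<open>simp add: linear_cycle.gain_ok_def\<close>)
  next
    case False
    then show ?thesis using less by (intro gain_ok_ev) auto
  qed
  have x: "near 1 (\<lambda>w. x w i) (\<lambda>w. y w i)"
  proof (cases i)
    case 0
    show ?thesis unfolding 0 y0 by (rule near_refl[OF ord_x0])
  next
    case (Suc k)
    have k: "close k" using less Suc by auto
    have xu: "\<forall>\<^sub>F w in F. x_update (vh w) (ph w) (qh w) (y w) (rh w) (b w) k"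
      using lin nd g
    proof eventually_elim
      case (elim w)
      interpret linear_cycle ty A "b w" "y w" "ph w" "qh w" "rh w" "vh w" "\<zeta>h w" "\<Gamma>h w" N by (rule elim(1))
      show ?case unfolding x_update_def Let_def
        using x_sweep(2)[of k] elim(2,3) gain_ok_mono[of "i - 2" "k - 2"] less.prems Suc by simp
    qed
    have d: "\<forall>j\<in>{1..k}. near_directions v vh p ph q qh j"
      using dirs_close dirs less.prems Suc by auto
    have xr: "near 1 (\<lambda>w. x w k) (\<lambda>w. y w k)" "near 1 (\<lambda>w. r w k) (\<lambda>w. rh w k)"
      using k by (auto simp: close_def)
    have xu0: "\<forall>\<^sub>F w in F. x_update (v w) (p w) (q w) (x w) (r w) (b w) k"
      using cycle_facts(5)[of k] less.prems Suc by simp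
    show ?thesis unfolding Suc by (rule near_x_update(2)[OF d xr xu0 xu ord_b])
  qed
  have r: "near 1 (\<lambda>w. r w i) (\<lambda>w. rh w i)" by (rule near_r[OF less.prems x])
  have pq: "near 1 (\<lambda>w. p w i) (\<lambda>w. ph w i) \<and> near 1 (\<lambda>w. q w i) (\<lambda>w. qh w i) \<and>
       (\<forall>j\<in>{max 1 (i - 2)..i - 1}. near 0 (\<lambda>w. \<zeta> w i j) (\<lambda>w. \<zeta>h w i j))" if i: "1 \<le> i"
  proof -
    have pu: "\<forall>\<^sub>F w in F. pq_update (vh w) (ph w) (qh w) (y w) (rh w) (\<zeta>h w) i"
      using lin nd g
    proof eventually_elim
      case (elim w)
      interpret linear_cycle ty A "b w" "y w" "ph w" "qh w" "rh w" "vh w" "\<zeta>h w" "\<Gamma>h w" N by (rule elim(1))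
      show ?case unfolding pq_update_def Let_def
        using pq_sweep[OF i less.prems elim(2,3)] by simp
    qed
    have prev: "near 1 (\<lambda>w. x w (i - 1)) (\<lambda>w. y w (i - 1))" "near 1 (\<lambda>w. r w (i - 1)) (\<lambda>w. rh w (i - 1))"
      using less.IH[of "i - 1"] i less.prems by (auto simp: close_def)
    have pu0: "\<forall>\<^sub>F w in F. pq_update (v w) (p w) (q w) (x w) (r w) (\<zeta> w) i"
      using cycle_facts(8)[of i] i less.prems by auto
    have d: "\<forall>j\<in>{1..<i}. near_directions v vh p ph q qh j"
      using dirs_close dirs less.prems by auto
    show ?thesis using near_pq_update[OF d x prev(1) r prev(2) pu0 pu i] by blast
  qed
  have dirs': "near 1 (\<lambda>w. p w j) (\<lambda>w. ph w j) \<and> near 1 (\<lambda>w. q w j) (\<lambda>w. qh w j)"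
    if "1 \<le> j" "j \<le> i" for j
    using that dirs[of j] pq by (cases "j = i") auto
  have nd': "\<forall>\<^sub>F w in F. linear_cycle.nondeg (qh w) (vh w) i"
    by (rule nondeg_ev) (use dirs' less.prems in auto)
  have gu: "\<forall>\<^sub>F w in F. gain_update (vh w) (ph w) (qh w) (y w) (rh w) (\<Gamma>h w) i"
    using lin nd' g
  proof eventually_elim
    case (elim w)
    interpret linear_cycle ty A "b w" "y w" "ph w" "qh w" "rh w" "vh w" "\<zeta>h w" "\<Gamma>h w" N by (rule elim(1))
    show ?case unfolding gain_update_def Let_def
      using x_sweep(1)[OF less.prems elim(2,3)] by simp
  qed
  have d: "\<forall>j\<in>{1..i}. near_directions v vh p ph q qh j"
    using dirs_close dirs' less.prems by auto
  have "\<forall>j\<in>{max 1 (i - 1)..i}. near 0 (\<lambda>w. \<Gamma> w i j) (\<lambda>w. \<Gamma>h w i j)"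
    by (rule near_x_update(1)[OF d x r cycle_facts(4)[OF less.prems] gu])
  with x r pq show ?case by (auto simp: close_def)
qed

lemma near_phi: "i < N \<Longrightarrow> near 0 (\<lambda>w. cycle_phi (\<zeta> w) (\<Gamma> w) i) (\<lambda>w. cycle_phi (\<zeta>h w) (\<Gamma>h w) i)"
proof (cases "i = 0")
  case True
  then show ?thesis by (simp add: cycle_phi_def near_def)
next
  case False
  assume i: "i < N"
  have "near 0 (\<lambda>w. \<Gamma> w i i) (\<lambda>w. \<Gamma>h w i i)" using close[of i] i False by (auto simp: close_def)
  moreover have "near 0 (\<lambda>w. \<zeta> w (Suc i) i) (\<lambda>w. \<zeta>h w (Suc i) i)"
    using close[of "Suc i"] i False by (auto simp: close_def)
  ultimately show ?thesis using False by (simp add: cycle_phi_def near_add)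
qed

lemma near_tri:
  assumes "a + 1 < N" "c + 1 < N"
  shows "near 0 (\<lambda>w. tri_entry (b w) (\<zeta> w) (\<Gamma> w) a c) (\<lambda>w. tri_entry (b w) (\<zeta>h w) (\<Gamma>h w) a c)"
proof -
  have G: "near 0 (\<lambda>w. \<Gamma> w (c + 1) (c + 1)) (\<lambda>w. \<Gamma>h w (c + 1) (c + 1))"
    using close[of "c + 1"] assms by (auto simp: close_def)
  have e: "near 0 (\<lambda>w. 1 - \<Gamma> w (c + 1) (c + 1)) (\<lambda>w. 1 - \<Gamma>h w (c + 1) (c + 1))"
    by (rule near_diff[OF near_one G])
  have le: "lower 0 (\<lambda>w. 1 - \<Gamma> w (c + 1) (c + 1))" by (rule lower_gain) (use assms in auto)
  have nb: "near 0 (\<lambda>w. b w i) (\<lambda>w. b w i)" for i by (rule near_refl[OF ord_b])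
  note div = near_divide[where b = 0 and e = 0, unfolded add_0_left]
  have be: "near 0 (\<lambda>w. b w i * (1 - \<Gamma> w (c + 1) (c + 1))) (\<lambda>w. b w i * (1 - \<Gamma>h w (c + 1) (c + 1)))" for i
    using near_mult[OF nb e] by simp
  have lbe: "lower 0 (\<lambda>w. b w i * (1 - \<Gamma> w (c + 1) (c + 1)))" for i
  proof -
    have "\<forall>\<^sub>F w in F. \<beta> * \<bar>1 - \<Gamma> w (c + 1) (c + 1)\<bar> \<le> \<bar>b w i * (1 - \<Gamma> w (c + 1) (c + 1))\<bar>"
      using cycle_facts(1)[of i] by eventually_elim (simp add: abs_mult mult_right_mono)
    then show ?thesis by (rule lower_mono[OF le positive(7)])
  qed
  consider "a + 1 = c" | "a = c" | "a = c + 1" | "a + 1 \<noteq> c" "a \<noteq> c" "a \<noteq> c + 1" by blast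
  then show ?thesis
  proof cases
    case 1
    then show ?thesis
      using div[OF near_phi be lbe, of "c" "c"] assms by (simp add: tri_entry_def Let_def)
  next
    case 2
    have "near 0 (\<lambda>w. 1 / b w c - cycle_phi (\<zeta> w) (\<Gamma> w) (c + 1) / b w (c + 1))
      (\<lambda>w. 1 / b w c - cycle_phi (\<zeta>h w) (\<Gamma>h w) (c + 1) / b w (c + 1))"
      using assms by (intro near_diff div near_one nb lower_b near_phi) auto
    from near_mult[OF div[OF near_one e le] this] 2 show ?thesis
      by (simp add: tri_entry_def Let_def)
  next
    case 3
    then show ?thesis
      using near_minus[OF div[OF near_one be lbe, of "c + 1"]] by (simp add: tri_entry_def Let_def)
  next
    case 4
    then show ?thesis by (simp add: tri_entry_def Let_def near_def)
  qed
qed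

text \<open>The weights lie between \<open>c \<delta>\<^sup>2\<close> and \<open>D \<delta>\<^sup>2\<close>, so the condition number of the scaling does not depend on
  \<open>\<delta>\<close>, and the difference of the entries, of order \<open>1\<close>, is the only factor that tends to zero.\<close>

lemma spectrum_close:
  assumes N: "2 \<le> N" "N \<le> CARD('n) + 1"
  shows "\<exists>C>0. \<forall>\<^sub>F w in F.
    \<forall>lam \<in> spectrum (Matrix.mat (N - 1) (N - 1)
        (\<lambda>(a, c). complex_of_real (tri_entry (b w) (\<zeta> w) (\<Gamma> w) a c))).
    \<exists>lamh \<in> spectrum (Matrix.mat (N - 1) (N - 1)
        (\<lambda>(a, c). complex_of_real (tri_entry (b w) (\<zeta>h w) (\<Gamma>h w) a c))).
      cmod (lamh - lam) \<le> C * \<delta> w"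
proof -
  define n where "n = N - 1"
  have n: "0 < n" "n \<le> DIM(real^'n)" "N = Suc n" using N by (auto simp: n_def)
  let ?I = "{..<n} \<times> {..<n}"
  have "\<exists>C>0. \<forall>\<^sub>F w in F. \<forall>ac\<in>?I. norm (tri_entry (b w) (\<zeta> w) (\<Gamma> w) (fst ac) (snd ac)
      - tri_entry (b w) (\<zeta>h w) (\<Gamma>h w) (fst ac) (snd ac)) \<le> C * \<delta> w ^ Suc 0"
    by (rule ord_uniform) (use near_ord(3)[OF near_tri] n in auto)
  then obtain C where C: "C > 0" and Cev: "\<forall>\<^sub>F w in F. \<forall>ac\<in>?I. norm (tri_entry (b w) (\<zeta> w) (\<Gamma> w) (fst ac) (snd ac)
      - tri_entry (b w) (\<zeta>h w) (\<Gamma>h w) (fst ac) (snd ac)) \<le> C * \<delta> w ^ Suc 0" by blast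
  have pqc: "near 1 (\<lambda>w. p w j) (\<lambda>w. ph w j)" "near 1 (\<lambda>w. q w j) (\<lambda>w. qh w j)" if "j \<in> {1..n}" for j
    using close[of j] that n by (auto simp: close_def)
  have "\<exists>c>0. \<forall>\<^sub>F w in F. \<forall>j\<in>{1..n}. c * \<delta> w ^ 2 \<le> \<bar>vh w j \<bullet> qh w j\<bar>"
    by (rule lower_uniform) (use pqc n lower_vqh(1) in auto)
  then obtain c where c: "c > 0" and cev: "\<forall>\<^sub>F w in F. \<forall>j\<in>{1..n}. c * \<delta> w ^ 2 \<le> \<bar>vh w j \<bullet> qh w j\<bar>"
    by blast
  have "\<exists>D>0. \<forall>\<^sub>F w in F. \<forall>j\<in>{1..n}. norm (vh w j \<bullet> qh w j) \<le> D * \<delta> w ^ 2"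
    by (rule ord_uniform) (use pqc n lower_vqh(2) in auto)
  then obtain D where D: "D > 0" and Dev: "\<forall>\<^sub>F w in F. \<forall>j\<in>{1..n}. norm (vh w j \<bullet> qh w j) \<le> D * \<delta> w ^ 2"
    by blast
  have nd: "\<forall>\<^sub>F w in F. linear_cycle.nondeg (qh w) (vh w) n"
    by (rule nondeg_ev) (use pqc n in auto)
  have g: "\<forall>\<^sub>F w in F. linear_cycle.gain_ok (\<Gamma>h w) n"
    by (rule gain_ok_ev) (use close n in auto)
  have "\<forall>\<^sub>F w in F. \<forall>lam \<in> spectrum (Matrix.mat n n
        (\<lambda>(a, c). complex_of_real (tri_entry (b w) (\<zeta> w) (\<Gamma> w) a c))).
    \<exists>lamh \<in> spectrum (Matrix.mat n n
        (\<lambda>(a, c). complex_of_real (tri_entry (b w) (\<zeta>h w) (\<Gamma>h w) a c))).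
      cmod (lamh - lam) \<le> (real n * sqrt (D / c) * C) * \<delta> w"
    using Cev cev Dev lin nd g pos
  proof eventually_elim
    case (elim w)
    interpret lc: linear_cycle ty A "b w" "y w" "ph w" "qh w" "rh w" "vh w" "\<zeta>h w" "\<Gamma>h w" N by (rule elim(4))
    let ?t = "tri_entry (b w) (\<zeta> w) (\<Gamma> w)" and ?t' = "tri_entry (b w) (\<zeta>h w) (\<Gamma>h w)"
    define d where "d a = \<bar>vh w (a + 1) \<bullet> qh w (a + 1)\<bar>" for a
    show ?case
    proof
      fix lam assume "lam \<in> spectrum (Matrix.mat n n (\<lambda>(a, c). complex_of_real (?t a c)))"
      then obtain u where u: "\<exists>a<n. u a \<noteq> 0"
        "\<And>a. a < n \<Longrightarrow> mat_app n (\<lambda>a c. complex_of_real (?t a c)) u a = lam * u a"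
        unfolding spectrum_mat_iff by blast
      have "\<exists>e z. (\<exists>a<n. z a \<noteq> 0) \<and> (\<forall>a<n. mat_app n ?t' z a = e * z a) \<and>
        cmod (complex_of_real e - lam) \<le> real n * sqrt (D / c) * (C * \<delta> w)"
      proof (rule eigenvalue_perturbation_weighted_symmetric[where 'a = "real^'n", OF n(1,2)])
        show "0 < c * \<delta> w ^ 2" using c elim(7) by simp
        show "c * \<delta> w ^ 2 \<le> d a \<and> d a \<le> D / c * (c * \<delta> w ^ 2)" if "a < n" for a
          using elim(2,3) that c by (simp add: d_def)
        show "d a * ?t' a e = d e * ?t' e a" if "a < n" "e < n" for a e
          unfolding d_def using lc.tri_weighted_symmetric[OF A_pos, of a e] that n elim(5,6) by simp
        show "\<bar>?t' a e - ?t a e\<bar> \<le> C * \<delta> w" if "a < n" "e < n" for a e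
          using elim(1) that by (simp add: abs_minus_commute)
      qed (use u in auto)
      then obtain e z where z: "\<exists>a<n. z a \<noteq> 0" "\<And>a. a < n \<Longrightarrow> mat_app n ?t' z a = e * z a"
        "cmod (complex_of_real e - lam) \<le> real n * sqrt (D / c) * (C * \<delta> w)" by blast
      have "complex_of_real e \<in> spectrum (Matrix.mat n n (\<lambda>(a, c). complex_of_real (?t' a c)))"
        unfolding spectrum_mat_iff
      proof (intro exI[of _ "\<lambda>a. complex_of_real (z a)"] conjI allI impI)
        show "mat_app n (\<lambda>a c. complex_of_real (?t' a c)) (\<lambda>a. complex_of_real (z a)) a
            = complex_of_real e * complex_of_real (z a)" if "a < n" for a
          using arg_cong[OF z(2)[OF that], of complex_of_real] by (simp add: mat_app_def)
      qed (use z(1) in auto)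
      then show "\<exists>lamh \<in> spectrum (Matrix.mat n n (\<lambda>(a, c). complex_of_real (?t' a c))).
        cmod (lamh - lam) \<le> (real n * sqrt (D / c) * C) * \<delta> w"
        using z(3) by (intro bexI[of _ "complex_of_real e"]) (simp_all add: mult.assoc)
    qed
  qed
  moreover have "real n * sqrt (D / c) * C > 0" using n C c D by simp
  ultimately show ?thesis unfolding n_def[symmetric] by blast
qed

end

section \<open>Uniform bounds over all cycles\<close>

text \<open>Statements that hold eventually in this filter are those that hold for all members of \<open>W\<close> with
  sufficiently small positive \<open>\<delta>\<close>, with one threshold for all of them. This is the uniformity asked
  for in the theorem.\<close>

definition scale_filter :: "'w set \<Rightarrow> ('w \<Rightarrow> real) \<Rightarrow> 'w filter" where
  "scale_filter W \<delta> = inf (filtercomap \<delta> (at_right 0)) (principal W)"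

lemma eventually_scale_filter:
  "eventually P (scale_filter W \<delta>) \<longleftrightarrow> (\<exists>\<epsilon>>0. \<forall>w\<in>W. 0 < \<delta> w \<longrightarrow> \<delta> w < \<epsilon> \<longrightarrow> P w)"
proof -
  have "eventually P (scale_filter W \<delta>) \<longleftrightarrow>
      (\<exists>Q. (\<exists>b>0. \<forall>y>0. y < b \<longrightarrow> Q y) \<and> (\<forall>w. Q (\<delta> w) \<longrightarrow> w \<in> W \<longrightarrow> P w))"
    by (simp add: scale_filter_def eventually_inf_principal eventually_filtercomap
        eventually_at_right_field)
  also have "\<dots> \<longleftrightarrow> (\<exists>\<epsilon>>0. \<forall>w\<in>W. 0 < \<delta> w \<longrightarrow> \<delta> w < \<epsilon> \<longrightarrow> P w)"
  proof
    assume "\<exists>\<epsilon>>0. \<forall>w\<in>W. 0 < \<delta> w \<longrightarrow> \<delta> w < \<epsilon> \<longrightarrow> P w"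
    then obtain \<epsilon> where "\<epsilon> > 0" "\<forall>w\<in>W. 0 < \<delta> w \<longrightarrow> \<delta> w < \<epsilon> \<longrightarrow> P w" by blast
    then show "\<exists>Q. (\<exists>b>0. \<forall>y>0. y < b \<longrightarrow> Q y) \<and> (\<forall>w. Q (\<delta> w) \<longrightarrow> w \<in> W \<longrightarrow> P w)"
      by (intro exI[of _ "\<lambda>y. 0 < y \<and> y < \<epsilon>"]) auto
  qed blast
  finally show ?thesis .
qed

lemma eventually_scale_filterI:
  "(\<And>w. w \<in> W \<Longrightarrow> P w) \<Longrightarrow> eventually P (scale_filter W \<delta>)"
  unfolding eventually_scale_filter by (intro exI[of _ 1]) auto

lemma small_scale_filter: "small_scale (scale_filter W \<delta>) \<delta>"
proof
  show "\<forall>\<^sub>F w in scale_filter W \<delta>. 0 < \<delta> w"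
    unfolding eventually_scale_filter by (intro exI[of _ 1]) auto
  have "filterlim \<delta> (at_right 0) (filtercomap \<delta> (at_right 0))" by (rule filterlim_filtercomap)
  then have "filterlim \<delta> (nhds 0) (filtercomap \<delta> (at_right 0))"
    by (rule filterlim_mono) (auto simp: at_within_le_nhds)
  then show "(\<delta> \<longlongrightarrow> 0) (scale_filter W \<delta>)"
    unfolding scale_filter_def by (rule filterlim_mono) auto
qed

context linearisation
begin

text \<open>Here \<open>W\<close> consists of all cycles of length \<open>N\<close>, whatever the starting point of the method and the
  number of earlier iterations.\<close>

lemma next_iterate_bound:
  "\<exists>C>0. \<exists>\<epsilon>>0. \<forall>b x p q \<zeta> \<Gamma>. am_cycle ty H \<rho> \<tau> \<eta> \<beta> \<beta>' N b x p q \<zeta> \<Gamma> \<longrightarrow>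
     0 < norm (x 0) \<longrightarrow> norm (x 0) < \<epsilon> \<longrightarrow> norm (x (Suc N)) \<le> C * norm (x 0)"
proof -
  define W where "W = {(b, x, p, q, \<zeta>, \<Gamma>). am_cycle ty H \<rho> \<tau> \<eta> \<beta> \<beta>' N b x p q \<zeta> \<Gamma>}"
  define \<delta> :: "(nat \<Rightarrow> real) \<times> (nat \<Rightarrow> real^'n) \<times> (nat \<Rightarrow> real^'n) \<times> (nat \<Rightarrow> real^'n) \<times>
      (nat \<Rightarrow> nat \<Rightarrow> real) \<times> (nat \<Rightarrow> nat \<Rightarrow> real) \<Rightarrow> real" where
    "\<delta> = (\<lambda>(b, x, p, q, \<zeta>, \<Gamma>). norm (x 0))"
  interpret small_scale "scale_filter W \<delta>" \<delta> by (rule small_scale_filter)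
  interpret am_family "scale_filter W \<delta>" \<delta> H A \<rho> K \<mu> L \<tau> \<eta> \<beta> \<beta>' ty N
    "\<lambda>(b, x, p, q, \<zeta>, \<Gamma>). b" "\<lambda>(b, x, p, q, \<zeta>, \<Gamma>). x" "\<lambda>(b, x, p, q, \<zeta>, \<Gamma>). p"
    "\<lambda>(b, x, p, q, \<zeta>, \<Gamma>). q" "\<lambda>(b, x, p, q, \<zeta>, \<Gamma>). \<zeta>" "\<lambda>(b, x, p, q, \<zeta>, \<Gamma>). \<Gamma>"
    by unfold_locales
       (auto simp: \<delta>_def W_def intro!: eventually_scale_filterI)
  obtain C \<epsilon> where C: "C > 0" "\<epsilon> > 0" and bd: "\<forall>w\<in>W. 0 < \<delta> w \<longrightarrow> \<delta> w < \<epsilon> \<longrightarrow>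
      norm ((case w of (b, x, p, q, \<zeta>, \<Gamma>) \<Rightarrow> x) (Suc N)) \<le> C * \<delta> w ^ 1"
    using ord_next unfolding ord_def eventually_scale_filter by blast
  show ?thesis
  proof (rule exI[of _ C], rule conjI[OF C(1)], rule exI[of _ \<epsilon>], rule conjI[OF C(2)], intro allI impI)
    fix b x p q \<zeta> \<Gamma>
    assume "am_cycle ty H \<rho> \<tau> \<eta> \<beta> \<beta>' N b x p q \<zeta> \<Gamma>" "0 < norm (x 0)" "norm (x 0) < \<epsilon>"
    then show "norm (x (Suc N)) \<le> C * norm (x 0)"
      using bspec[OF bd, of "(b, x, p, q, \<zeta>, \<Gamma>)"] by (simp add: W_def \<delta>_def)
  qed
qed

lemma tridiagonal_spectrum_bound:
  assumes N: "2 \<le> N" "N \<le> CARD('n) + 1" and \<tau>\<^sub>0: "0 < \<tau>\<^sub>0"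
  shows "\<exists>C>0. \<exists>\<epsilon>>0. \<forall>b x p q \<zeta> \<Gamma> y ph qh rh vh \<zeta>h \<Gamma>h lam.
     am_cycle ty H \<rho> \<tau> \<eta> \<beta> \<beta>' N b x p q \<zeta> \<Gamma> \<longrightarrow>
     linear_cycle ty A b y ph qh rh vh \<zeta>h \<Gamma>h N \<longrightarrow> y 0 = x 0 \<longrightarrow>
     (\<forall>j. 1 \<le> j \<longrightarrow> j < N \<longrightarrow> \<tau>\<^sub>0 \<le> \<bar>1 - \<Gamma> j j\<bar>) \<longrightarrow>
     0 < norm (x 0) \<longrightarrow> norm (x 0) < \<epsilon> \<longrightarrow>
     lam \<in> spectrum (Matrix.mat (N - 1) (N - 1) (\<lambda>(a, c). complex_of_real (tri_entry b \<zeta> \<Gamma> a c))) \<longrightarrow>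
     (\<exists>lamh \<in> spectrum (Matrix.mat (N - 1) (N - 1)
         (\<lambda>(a, c). complex_of_real (tri_entry b \<zeta>h \<Gamma>h a c))). cmod (lamh - lam) \<le> C * norm (x 0))"
proof -
  define W where "W = {(b, x, p, q, \<zeta>, \<Gamma>, y, ph, qh, rh, vh, \<zeta>h, \<Gamma>h).
     am_cycle ty H \<rho> \<tau> \<eta> \<beta> \<beta>' N b x p q \<zeta> \<Gamma> \<and>
     linear_cycle ty A b y ph qh rh vh \<zeta>h \<Gamma>h N \<and> y 0 = x 0 \<and>
     (\<forall>j. 1 \<le> j \<longrightarrow> j < N \<longrightarrow> \<tau>\<^sub>0 \<le> \<bar>1 - \<Gamma> j j\<bar>)}"
  define \<delta> :: "(nat \<Rightarrow> real) \<times> (nat \<Rightarrow> real^'n) \<times> (nat \<Rightarrow> real^'n) \<times> (nat \<Rightarrow> real^'n) \<times>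
      (nat \<Rightarrow> nat \<Rightarrow> real) \<times> (nat \<Rightarrow> nat \<Rightarrow> real) \<times>
      (nat \<Rightarrow> real^'n) \<times> (nat \<Rightarrow> real^'n) \<times> (nat \<Rightarrow> real^'n) \<times> (nat \<Rightarrow> real^'n) \<times> (nat \<Rightarrow> real^'n) \<times>
      (nat \<Rightarrow> nat \<Rightarrow> real) \<times> (nat \<Rightarrow> nat \<Rightarrow> real) \<Rightarrow> real" where
    "\<delta> = (\<lambda>(b, x, _). norm (x 0))"
  interpret small_scale "scale_filter W \<delta>" \<delta> by (rule small_scale_filter)
  interpret am_family "scale_filter W \<delta>" \<delta> H A \<rho> K \<mu> L \<tau> \<eta> \<beta> \<beta>' ty N
    "\<lambda>(b, x, p, q, \<zeta>, \<Gamma>, _). b" "\<lambda>(b, x, p, q, \<zeta>, \<Gamma>, _). x" "\<lambda>(b, x, p, q, \<zeta>, \<Gamma>, _). p"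
    "\<lambda>(b, x, p, q, \<zeta>, \<Gamma>, _). q" "\<lambda>(b, x, p, q, \<zeta>, \<Gamma>, _). \<zeta>" "\<lambda>(b, x, p, q, \<zeta>, \<Gamma>, _). \<Gamma>"
    by unfold_locales
       (auto simp: \<delta>_def W_def intro!: eventually_scale_filterI)
  \<comment> \<open>The comparison asks for a common initial point at every index, hence the replacement of \<open>y\<close> outside \<open>W\<close>.\<close>
  let ?y = "\<lambda>(b, x, p, q, \<zeta>, \<Gamma>, y, ph, qh, rh, vh, \<zeta>h, \<Gamma>h).
    (if y 0 = x 0 then y else x) :: nat \<Rightarrow> real^'n"
  interpret am_comparison "scale_filter W \<delta>" \<delta> H A \<rho> K \<mu> L \<tau> \<eta> \<beta> \<beta>' ty N
    "\<lambda>(b, x, p, q, \<zeta>, \<Gamma>, _). b" "\<lambda>(b, x, p, q, \<zeta>, \<Gamma>, _). x" "\<lambda>(b, x, p, q, \<zeta>, \<Gamma>, _). p"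
    "\<lambda>(b, x, p, q, \<zeta>, \<Gamma>, _). q" "\<lambda>(b, x, p, q, \<zeta>, \<Gamma>, _). \<zeta>" "\<lambda>(b, x, p, q, \<zeta>, \<Gamma>, _). \<Gamma>" \<tau>\<^sub>0
    ?y "\<lambda>(b, x, p, q, \<zeta>, \<Gamma>, y, ph, qh, rh, vh, \<zeta>h, \<Gamma>h). ph"
    "\<lambda>(b, x, p, q, \<zeta>, \<Gamma>, y, ph, qh, rh, vh, \<zeta>h, \<Gamma>h). qh"
    "\<lambda>(b, x, p, q, \<zeta>, \<Gamma>, y, ph, qh, rh, vh, \<zeta>h, \<Gamma>h). rh"
    "\<lambda>(b, x, p, q, \<zeta>, \<Gamma>, y, ph, qh, rh, vh, \<zeta>h, \<Gamma>h). vh"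
    "\<lambda>(b, x, p, q, \<zeta>, \<Gamma>, y, ph, qh, rh, vh, \<zeta>h, \<Gamma>h). \<zeta>h"
    "\<lambda>(b, x, p, q, \<zeta>, \<Gamma>, y, ph, qh, rh, vh, \<zeta>h, \<Gamma>h). \<Gamma>h"
    by unfold_locales
       (use \<tau>\<^sub>0 in \<open>auto simp: W_def intro!: eventually_scale_filterI\<close>)
  obtain C \<epsilon> where C: "C > 0" "\<epsilon> > 0" and bd: "\<forall>w\<in>W. 0 < \<delta> w \<longrightarrow> \<delta> w < \<epsilon> \<longrightarrow>
    (\<forall>lam \<in> spectrum (Matrix.mat (N - 1) (N - 1) (\<lambda>(a, c). complex_of_real
        (tri_entry ((\<lambda>(b, x, p, q, \<zeta>, \<Gamma>, _). b) w) ((\<lambda>(b, x, p, q, \<zeta>, \<Gamma>, _). \<zeta>) w)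
          ((\<lambda>(b, x, p, q, \<zeta>, \<Gamma>, _). \<Gamma>) w) a c))).
    \<exists>lamh \<in> spectrum (Matrix.mat (N - 1) (N - 1) (\<lambda>(a, c). complex_of_real
        (tri_entry ((\<lambda>(b, x, p, q, \<zeta>, \<Gamma>, _). b) w)
          ((\<lambda>(b, x, p, q, \<zeta>, \<Gamma>, y, ph, qh, rh, vh, \<zeta>h, \<Gamma>h). \<zeta>h) w)
          ((\<lambda>(b, x, p, q, \<zeta>, \<Gamma>, y, ph, qh, rh, vh, \<zeta>h, \<Gamma>h). \<Gamma>h) w) a c))).
      cmod (lamh - lam) \<le> C * \<delta> w)"
    using spectrum_close[OF N] unfolding eventually_scale_filter by blast
  show ?thesis
  proof (rule exI[of _ C], rule conjI[OF C(1)], rule exI[of _ \<epsilon>], rule conjI[OF C(2)], intro allI impI)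
    fix b x p q \<zeta> \<Gamma> y ph qh rh vh \<zeta>h \<Gamma>h lam
    assume *: "am_cycle ty H \<rho> \<tau> \<eta> \<beta> \<beta>' N b x p q \<zeta> \<Gamma>" "linear_cycle ty A b y ph qh rh vh \<zeta>h \<Gamma>h N"
      "y 0 = x 0" "\<forall>j. 1 \<le> j \<longrightarrow> j < N \<longrightarrow> \<tau>\<^sub>0 \<le> \<bar>1 - \<Gamma> j j\<bar>" "0 < norm (x 0)" "norm (x 0) < \<epsilon>"
      and lam: "lam \<in> spectrum (Matrix.mat (N - 1) (N - 1)
        (\<lambda>(a, c). complex_of_real (tri_entry b \<zeta> \<Gamma> a c)))"
    have "(b, x, p, q, \<zeta>, \<Gamma>, y, ph, qh, rh, vh, \<zeta>h, \<Gamma>h) \<in> W" using * by (simp add: W_def)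
    from bspec[OF bd this] *(5,6) lam
    show "\<exists>lamh \<in> spectrum (Matrix.mat (N - 1) (N - 1)
         (\<lambda>(a, c). complex_of_real (tri_entry b \<zeta>h \<Gamma>h a c))). cmod (lamh - lam) \<le> C * norm (x 0)"
      unfolding \<delta>_def prod.case by blast
  qed
qed

end

text \<open>The bounds are obtained for each length of a cycle separately; there are only finitely many lengths.\<close>

lemma common_bounds:
  fixes Q :: "nat \<Rightarrow> real \<Rightarrow> real \<Rightarrow> bool"
  assumes "\<And>N. N \<in> S \<Longrightarrow> \<exists>C>0. \<exists>\<epsilon>>0. Q N C \<epsilon>" "finite S"
    and mono: "\<And>N C \<epsilon> C' \<epsilon>'. Q N C \<epsilon> \<Longrightarrow> C \<le> C' \<Longrightarrow> \<epsilon>' \<le> \<epsilon> \<Longrightarrow> Q N C' \<epsilon>'"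
  shows "\<exists>C>0. \<exists>\<epsilon>>0. \<forall>N\<in>S. Q N C \<epsilon>"
  using assms(2,1)
proof (induction S)
  case empty
  show ?case by (rule exI[of _ 1], rule conjI, simp, rule exI[of _ 1], simp)
next
  case (insert k S)
  obtain C \<epsilon> where 1: "C > 0" "\<epsilon> > 0" "\<forall>N\<in>S. Q N C \<epsilon>" using insert by auto
  obtain D \<delta> where 2: "D > 0" "\<delta> > 0" "Q k D \<delta>" using insert.prems[of k] by auto
  show ?case
  proof (rule exI[of _ "max C D"], rule conjI, use 1 in simp, rule exI[of _ "min \<epsilon> \<delta>"], rule conjI,
      use 1 2 in simp, rule ballI)
    fix N assume "N \<in> insert k S"
    then show "Q N (max C D) (min \<epsilon> \<delta>)"
      using mono[of N C \<epsilon> "max C D" "min \<epsilon> \<delta>"] mono[of N D \<delta> "max C D" "min \<epsilon> \<delta>"] 1 2 by auto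
  qed
qed

section \<open>From the method to its cycles\<close>

text \<open>Mean value theorem for \<open>h \<bullet> (y - z)\<close> along the segment from \<open>z\<close> to \<open>y\<close>.\<close>

lemma strong_monotonicity:
  assumes const: "local_constants h xs \<rho> \<kappa> \<mu> L" and yz: "y \<in> cball xs \<rho>" "z \<in> cball xs \<rho>"
  shows "\<mu> * (norm (y - z))\<^sup>2 \<le> (h y - h z) \<bullet> (y - z)"
proof -
  define c where "c t = z + t *\<^sub>R (y - z)" for t :: real
  have c: "c t \<in> cball xs \<rho>" if "0 \<le> t" "t \<le> 1" for t
  proof -
    have "c t = (1 - t) *\<^sub>R z + t *\<^sub>R y" by (simp add: c_def algebra_simps)
    then show ?thesis using convexD[OF convex_cball yz(2,1), of "1 - t" t] that by simp
  qed
  have der: "((\<lambda>t. h (c t) \<bullet> (y - z)) has_derivative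
      (\<lambda>s. (jacobian h (at (c t)) *v (s *\<^sub>R (y - z))) \<bullet> (y - z))) (at t within {0..1})"
    if "0 \<le> t" "t \<le> 1" for t
  proof -
    have "h differentiable (at (c t))" using const c[OF that] by (simp add: local_constants_def)
    then have "(h has_derivative (*v) (jacobian h (at (c t)))) (at (c t))"
      using jacobian_works by blast
    moreover have "(c has_derivative (\<lambda>s. s *\<^sub>R (y - z))) (at t within {0..1})"
      unfolding c_def by (auto intro!: derivative_eq_intros)
    ultimately have "((\<lambda>t. h (c t)) has_derivative (\<lambda>s. jacobian h (at (c t)) *v (s *\<^sub>R (y - z))))
        (at t within {0..1})"
      by (rule has_derivative_compose[rotated])
    then show ?thesis by (rule has_derivative_inner_left)
  qed
  obtain t where t: "t \<in> {0<..<1}" "h (c 1) \<bullet> (y - z) - h (c 0) \<bullet> (y - z)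
      = (jacobian h (at (c t)) *v ((1 - 0) *\<^sub>R (y - z))) \<bullet> (y - z)"
  proof -
    have "\<exists>t\<in>{0<..<1}. h (c 1) \<bullet> (y - z) - h (c 0) \<bullet> (y - z)
      = (jacobian h (at (c t)) *v ((1 - 0) *\<^sub>R (y - z))) \<bullet> (y - z)"
      by (rule mvt_simple[where f = "\<lambda>t. h (c t) \<bullet> (y - z)"
          and f' = "\<lambda>t s. (jacobian h (at (c t)) *v (s *\<^sub>R (y - z))) \<bullet> (y - z)"])
         (use der in auto)
    then show ?thesis using that by blast
  qed
  have "(h y - h z) \<bullet> (y - z) = h (c 1) \<bullet> (y - z) - h (c 0) \<bullet> (y - z)"
    by (simp add: c_def inner_diff_left)
  also have "\<dots> = (jacobian h (at (c t)) *v (y - z)) \<bullet> (y - z)" using t(2) by simp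
  also have "\<dots> = (y - z) \<bullet> (jacobian h (at (c t)) *v (y - z))" by (rule inner_commute)
  finally have "(h y - h z) \<bullet> (y - z) = (y - z) \<bullet> (jacobian h (at (c t)) *v (y - z))" .
  moreover have "\<mu> * (norm (y - z))\<^sup>2 \<le> (y - z) \<bullet> (jacobian h (at (c t)) *v (y - z))"
    using const c[of t] t(1) by (simp add: local_constants_def)
  ultimately show ?thesis by simp
qed

lemma symmetric_linearisation:
  fixes g h :: "real^'n \<Rightarrow> real^'n"
  assumes h: "\<And>x. h x = x - g x" and d: "h differentiable (at xs)"
    and sym: "transpose (jacobian g (at xs)) = jacobian g (at xs)"
  shows "(jacobian h (at xs) *v u) \<bullet> z = u \<bullet> (jacobian h (at xs) *v z)"
proof -
  let ?A = "jacobian h (at xs)" and ?G = "jacobian g (at xs)"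
  have g: "g = (\<lambda>x. x - h x)" using h by auto
  have "(h has_derivative (*v) ?A) (at xs)" using d jacobian_works by blast
  then have dg: "(g has_derivative (\<lambda>u. u - ?A *v u)) (at xs)"
    unfolding g by (intro derivative_intros)
  then have "(g has_derivative (*v) ?G) (at xs)"
    using jacobian_works differentiableI by blast
  then have "(*v) ?G = (\<lambda>u. u - ?A *v u)" using dg by (rule has_derivative_unique)
  from fun_cong[OF this] have G: "?A *v u = u - ?G *v u" for u by simp
  have "(?G *v u) \<bullet> z = u \<bullet> (?G *v z)"
    using dot_lmul_matrix[of u ?G z] transpose_matrix_vector[of ?G u] sym by simp
  then show ?thesis by (simp add: G inner_diff_left inner_diff_right)
qed

lemma st_am_iteration_step:
  assumes it: "st_am_iteration ty g bt m \<tau> \<eta> x p q M \<zeta> \<Gamma> k"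
  shows "\<forall>j\<in>{max 1 (M k - 1)..M k}. \<Gamma> k j
      = sweep_coeff (vsel ty p q) p q (k - M k + max 1 (M k - 1)) (x k, g (x k) - x k) (k - M k + j)"
    "x (k + 1)
      = fst (sweep (vsel ty p q) p q (k - M k + max 1 (M k - 1)) (k + 1) (x k, g (x k) - x k))
        + bt k *\<^sub>R snd (sweep (vsel ty p q) p q (k - M k + max 1 (M k - 1)) (k + 1) (x k, g (x k) - x k))"
proof -
  note parts = it[unfolded st_am_iteration_def Let_def split_beta, THEN conjunct2, THEN conjunct2]
  show "\<forall>j\<in>{max 1 (M k - 1)..M k}. \<Gamma> k j
      = sweep_coeff (vsel ty p q) p q (k - M k + max 1 (M k - 1)) (x k, g (x k) - x k) (k - M k + j)"
    by (rule parts[THEN conjunct1])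
  show "x (k + 1)
      = fst (sweep (vsel ty p q) p q (k - M k + max 1 (M k - 1)) (k + 1) (x k, g (x k) - x k))
        + bt k *\<^sub>R snd (sweep (vsel ty p q) p q (k - M k + max 1 (M k - 1)) (k + 1) (x k, g (x k) - x k))"
    by (rule parts[THEN conjunct2])
qed

lemma st_am_iteration_no_restart:
  assumes it: "st_am_iteration ty g bt m \<tau> \<eta> x p q M \<zeta> \<Gamma> k" and nz: "M k \<noteq> 0"
  shows "k \<noteq> 0" "M k = M (k - 1) + 1" "M k \<le> m"
    "norm (g (x k) - x k) \<le> \<eta> * norm (g (x (k - M k)) - x (k - M k))"
    "\<tau> * \<bar>vsel ty p q (k - M k + 1) \<bullet> q (k - M k + 1)\<bar> \<le> \<bar>vsel ty p q k \<bullet> q k\<bar>"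
    "(p k, q k) = sweep (vsel ty p q) p q (k - M k + max 1 (M k - 2)) k
        (x k - x (k - 1), (g (x k) - x k) - (g (x (k - 1)) - x (k - 1)))"
    "\<forall>j\<in>{max 1 (M k - 2)..M k - 1}. \<zeta> k j = sweep_coeff (vsel ty p q) p q (k - M k + max 1 (M k - 2))
        (x k - x (k - 1), (g (x k) - x k) - (g (x (k - 1)) - x (k - 1))) (k - M k + j)"
proof -
  have reset: "a = b \<and> \<not> c" if "a = (if c then 0 else b)" "a \<noteq> 0" for a b :: nat and c
    using that by (simp split: if_splits)
  note it' = it[unfolded st_am_iteration_def Let_def]
  note r = reset[OF it'[THEN conjunct2, THEN conjunct1] nz]
  note m2 = r[THEN conjunct1]
  note m1 = reset[OF m2 nz]
  have "M k = (if k = 0 then 0 else M (k - 1) + 1)" by (rule m1[THEN conjunct1])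
  then show "k \<noteq> 0" "M k = M (k - 1) + 1" using nz by (cases "k = 0"; simp)+
  have nr: "\<not> (M k > m \<or> norm (g (x k) - x k) > \<eta> * norm (g (x (k - M k)) - x (k - M k)))"
    by (rule m1[THEN conjunct2, folded m1[THEN conjunct1]])
  then show "M k \<le> m" "norm (g (x k) - x k) \<le> \<eta> * norm (g (x (k - M k)) - x (k - M k))"
    by simp_all
  have "\<not> (M k > 0 \<and> \<bar>vsel ty p q k \<bullet> q k\<bar>
      < \<tau> * \<bar>vsel ty p q (k - M k + 1) \<bullet> q (k - M k + 1)\<bar>)"
    by (rule r[THEN conjunct2, folded m2])
  then show "\<tau> * \<bar>vsel ty p q (k - M k + 1) \<bullet> q (k - M k + 1)\<bar> \<le> \<bar>vsel ty p q k \<bullet> q k\<bar>"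
    using nz by simp
  note pq = mp[OF it'[THEN conjunct1, folded m2] nz[THEN neq0_conv[THEN iffD1]]]
  show "(p k, q k) = sweep (vsel ty p q) p q (k - M k + max 1 (M k - 2)) k
        (x k - x (k - 1), (g (x k) - x k) - (g (x (k - 1)) - x (k - 1)))"
    by (rule pq[THEN conjunct1])
  show "\<forall>j\<in>{max 1 (M k - 2)..M k - 1}. \<zeta> k j = sweep_coeff (vsel ty p q) p q (k - M k + max 1 (M k - 2))
        (x k - x (k - 1), (g (x k) - x k) - (g (x (k - 1)) - x (k - 1))) (k - M k + j)"
    by (rule pq[THEN conjunct2])
qed

text \<open>A positive counter has grown by one from the preceding iteration, so the last restart is \<open>M k\<close>
  iterations back.\<close>

lemma counter_in_cycle:
  assumes "\<And>j. j \<le> k \<Longrightarrow> st_am_iteration ty g bt m \<tau> \<eta> x p q M \<zeta> \<Gamma> j"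
  shows "M k \<le> k \<and> (\<forall>i\<le>M k. M (k - M k + i) = i)"
  using assms
proof (induction k)
  case 0
  then show ?case using st_am_iteration_no_restart(1)[of ty g bt m \<tau> \<eta> x p q M \<zeta> \<Gamma> 0] by (cases "M 0") auto
next
  case (Suc k)
  show ?case
  proof (cases "M (Suc k) = 0")
    case False
    then have M: "M (Suc k) = Suc (M k)" using st_am_iteration_no_restart(2)[OF Suc.prems[OF order.refl]] by simp
    have IH: "M k \<le> k" "\<forall>i\<le>M k. M (k - M k + i) = i" using Suc by auto
    show ?thesis using M IH by (auto simp: le_Suc_eq)
  qed simp
qed

lemma vsel_shift: "vsel ty (\<lambda>i. p (s + i)) (\<lambda>i. q (s + i)) = (\<lambda>i. vsel ty p q (s + i))"
  by (cases ty) auto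

lemma iteration_in_cycle:
  fixes g :: "real^'n \<Rightarrow> real^'n" and xs :: "real^'n"
  assumes it: "st_am_iteration ty g bt m \<tau> \<eta> x p q M \<zeta> \<Gamma> (s + i)" and M: "M (s + i) = i"
  defines "r \<equiv> \<lambda>j. g (x (s + j)) - x (s + j)"
  defines "y \<equiv> \<lambda>j. x (s + j) - xs"
  defines "P \<equiv> \<lambda>j. p (s + j)" and "Q \<equiv> \<lambda>j. q (s + j)"
  defines "V \<equiv> vsel ty P Q"
  shows "gain_update V P Q y r (\<lambda>a. \<Gamma> (s + a)) i" (is ?gain)
    "x_update V P Q y r (\<lambda>a. bt (s + a)) i" (is ?step)
    "i \<noteq> 0 \<Longrightarrow> norm (r i) \<le> \<eta> * norm (r 0)"
    "i \<noteq> 0 \<Longrightarrow> \<tau> * \<bar>V 1 \<bullet> Q 1\<bar> \<le> \<bar>V i \<bullet> Q i\<bar>"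
    "i \<noteq> 0 \<Longrightarrow> pq_update V P Q y r (\<lambda>a. \<zeta> (s + a)) i"
proof -
  let ?v = "vsel ty p q"
  have V: "V = (\<lambda>j. ?v (s + j))" by (simp add: V_def P_def Q_def vsel_shift)
  let ?r = "\<lambda>i. g (x i) - x i"
  have y: "(y i, r i) = (x (s + i) - xs, ?r (s + i))" by (simp add: y_def r_def)
  have si: "s + i - i = s" by simp
  note step = st_am_iteration_step[OF it, unfolded M si]
  show ?gain
    unfolding gain_update_def Let_def y V sweep_coeff_translate P_def Q_def
    using step(1) unfolding sweep_coeff_shift .
  have yS: "y (Suc i) = x (s + i + 1) - xs" and sS: "s + i + 1 = s + Suc i" by (simp_all add: y_def)
  show ?step
    unfolding x_update_def Let_def y V sweep_translate P_def Q_def yS step(2) fst_conv snd_conv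
    unfolding sS sweep_shift by simp
  assume i: "i \<noteq> 0"
  then have nz: "M (s + i) \<noteq> 0" using M by simp
  note pq = st_am_iteration_no_restart[OF it nz, unfolded M si]
  show "norm (r i) \<le> \<eta> * norm (r 0)" using pq(4) by (simp add: r_def)
  show "\<tau> * \<bar>V 1 \<bullet> Q 1\<bar> \<le> \<bar>V i \<bullet> Q i\<bar>" using pq(5) by (simp add: V Q_def)
  have D: "(y i - y (i - 1), r i - r (i - 1)) = (x (s + i) - x (s + i - 1),
      (g (x (s + i)) - x (s + i)) - (g (x (s + i - 1)) - x (s + i - 1)))"
    using i by (simp add: y_def r_def)
  show "pq_update V P Q y r (\<lambda>a. \<zeta> (s + a)) i"
    unfolding pq_update_def Let_def D V P_def Q_def
    using pq(6,7) unfolding sweep_shift sweep_coeff_shift by (rule conjI)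
qed

lemma am_cycle_of_run:
  fixes g h :: "real^'n \<Rightarrow> real^'n"
  assumes h: "\<And>x. h x = x - g x"
    and it: "\<And>j. j \<le> k \<Longrightarrow> st_am_iteration ty g bt m \<tau> \<eta> x p q M \<zeta> \<Gamma> j"
    and bt: "\<And>j. \<beta> \<le> \<bar>bt j\<bar> \<and> \<bar>bt j\<bar> \<le> \<beta>'"
    and ball: "\<And>j. j \<le> k \<Longrightarrow> norm (x j - xs) \<le> \<rho>"
  defines "s \<equiv> k - M k"
  shows "am_cycle ty (\<lambda>y. h (xs + y)) \<rho> \<tau> \<eta> \<beta> \<beta>' (M k) (\<lambda>i. bt (s + i)) (\<lambda>i. x (s + i) - xs)
    (\<lambda>i. p (s + i)) (\<lambda>i. q (s + i)) (\<lambda>i. \<zeta> (s + i)) (\<lambda>i. \<Gamma> (s + i))"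
proof -
  have M: "M k \<le> k" "\<And>i. i \<le> M k \<Longrightarrow> M (s + i) = i"
    using counter_in_cycle[where k = k, OF it] by (auto simp: s_def)
  have le: "s + i \<le> k" if "i \<le> M k" for i using that M(1) by (simp add: s_def)
  have r: "(\<lambda>i. - h (xs + (x (s + i) - xs))) = (\<lambda>j. g (x (s + j)) - x (s + j))"
    by (simp add: h)
  note facts = iteration_in_cycle(1,2,5)[where xs = xs, OF it[OF le] M(2)]
    iteration_in_cycle(3,4)[OF it[OF le] M(2)]
  have r': "- h (xs + (x (s + i) - xs)) = g (x (s + i)) - x (s + i)" for i by (simp add: h)
  show ?thesis
    unfolding am_cycle_def Let_def r'
    using bt ball[OF le] facts
    by (simp add: Suc_le_eq)
qed

lemma linear_cycle_of_process_II:
  fixes A :: "real^'n^'n"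
  assumes P: "process_II ty A xs bt M x xh ph qh \<zeta>h \<Gamma>h K"
    and sym: "\<And>u z. (A *v u) \<bullet> z = u \<bullet> (A *v z)" and bt: "\<And>j. bt j \<noteq> 0"
    and M: "M K \<le> K" "\<And>i. i \<le> M K \<Longrightarrow> M (K - M K + i) = i"
  defines "s \<equiv> K - M K"
  defines "y \<equiv> \<lambda>i. xh (s + i) - xs"
  shows "linear_cycle ty A (\<lambda>i. bt (s + i)) y (\<lambda>i. ph (s + i)) (\<lambda>i. qh (s + i))
      (\<lambda>i. - (A *v y i)) (vsel ty (\<lambda>i. ph (s + i)) (\<lambda>i. qh (s + i)))
      (\<lambda>i. \<zeta>h (s + i)) (\<lambda>i. \<Gamma>h (s + i)) (M K)"
    and "xh s = x s"
proof -
  note P' = P[unfolded process_II_def Let_def]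
  have M': "M (s + i) = i" if "i \<le> M K" for i using M(2)[OF that] by (simp add: s_def)
  have le: "s + i \<le> K" if "i \<le> M K" for i using that M(1) by (simp add: s_def)
  show "xh s = x s" using P' M'[of 0] le[of 0] by simp
  let ?r = "\<lambda>i. - (A *v (xh i - xs))"
  have body: "ph (s + i) = (xh (s + i) - xh (s + i - 1)) - (\<Sum>j=1..i - 1. \<zeta>h (s + i) j *\<^sub>R ph (s + j))"
    "qh (s + i) = (?r (s + i) - ?r (s + i - 1)) - (\<Sum>j=1..i - 1. \<zeta>h (s + i) j *\<^sub>R qh (s + j))"
    "\<forall>w\<in>span (vsel ty ph qh ` {s + 1..s + i - 1}). w \<bullet> qh (s + i) = 0"
    "\<forall>w\<in>span (vsel ty ph qh ` {s + 1..s + i}).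
       w \<bullet> (?r (s + i) - (\<Sum>j=1..i. \<Gamma>h (s + i) j *\<^sub>R qh (s + j))) = 0"
    if i: "1 \<le> i" "i \<le> M K" for i
  proof -
    have Mi: "M (s + i) = i" and le1: "1 \<le> M (s + i)" and si: "s + i - i = s" using i M' by auto
    note body = mp[OF mp[OF spec[OF P'[THEN conjunct2, THEN conjunct2], of "s + i"] le[OF i(2)]] le1,
        unfolded Mi si]
    show "ph (s + i) = (xh (s + i) - xh (s + i - 1)) - (\<Sum>j=1..i - 1. \<zeta>h (s + i) j *\<^sub>R ph (s + j))"
      by (rule body[THEN conjunct1])
    show "qh (s + i) = (?r (s + i) - ?r (s + i - 1)) - (\<Sum>j=1..i - 1. \<zeta>h (s + i) j *\<^sub>R qh (s + j))"
      by (rule body[THEN conjunct2, THEN conjunct1])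
    show "\<forall>w\<in>span (vsel ty ph qh ` {s + 1..s + i - 1}). w \<bullet> qh (s + i) = 0"
      by (rule body[THEN conjunct2, THEN conjunct2, THEN conjunct1])
    show "\<forall>w\<in>span (vsel ty ph qh ` {s + 1..s + i}).
       w \<bullet> (?r (s + i) - (\<Sum>j=1..i. \<Gamma>h (s + i) j *\<^sub>R qh (s + j))) = 0"
      by (rule body[THEN conjunct2, THEN conjunct2, THEN conjunct2])
  qed
  show "linear_cycle ty A (\<lambda>i. bt (s + i)) y (\<lambda>i. ph (s + i)) (\<lambda>i. qh (s + i))
      (\<lambda>i. - (A *v y i)) (vsel ty (\<lambda>i. ph (s + i)) (\<lambda>i. qh (s + i)))
      (\<lambda>i. \<zeta>h (s + i)) (\<lambda>i. \<Gamma>h (s + i)) (M K)"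
  proof
    show "(A *v u) \<bullet> z = u \<bullet> (A *v z)" for u z by (rule sym)
    show "bt (s + i) \<noteq> 0" for i by (rule bt)
    show "y (Suc i) = y i + bt (s + i) *\<^sub>R - (A *v y i)
        - (\<Sum>j=1..i. \<Gamma>h (s + i) j *\<^sub>R (ph (s + j) + bt (s + i) *\<^sub>R qh (s + j)))" if "i < M K" for i
    proof -
      have M1: "M (s + i + 1) \<noteq> 0" and less: "s + i < K" and Mi: "M (s + i) = i"
        and si: "s + i - i = s"
        using M'[of "Suc i"] M'[of i] le[of "Suc i"] that by auto
      note mp[OF mp[OF spec[OF P'[THEN conjunct2, THEN conjunct1], of "s + i"] less] M1,
          unfolded Mi si]
      then show ?thesis by (simp add: y_def)
    qed
    fix i assume i: "1 \<le> i" "i \<le> M K"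
    have y1: "y (i - 1) = xh (s + i - 1) - xs" using i by (simp add: y_def)
    show "ph (s + i) = y i - y (i - 1) - (\<Sum>j=1..i - 1. \<zeta>h (s + i) j *\<^sub>R ph (s + j))"
      using body(1)[OF i] unfolding y1 by (simp add: y_def)
    show "qh (s + i) = - (A *v y i) - - (A *v y (i - 1)) - (\<Sum>j=1..i - 1. \<zeta>h (s + i) j *\<^sub>R qh (s + j))"
      using body(2)[OF i] unfolding y1 by (simp add: y_def)
  next
    fix i j assume ij: "1 \<le> j" "j < i" "i \<le> M K"
    have "vsel ty ph qh (s + j) \<in> span (vsel ty ph qh ` {s + 1..s + i - 1})"
      using ij by (intro span_base imageI) auto
    then show "vsel ty (\<lambda>i. ph (s + i)) (\<lambda>i. qh (s + i)) j \<bullet> qh (s + i) = 0"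
      using body(3)[of i] ij by (simp add: vsel_shift)
  next
    fix i j assume ij: "1 \<le> j" "j \<le> i" "i \<le> M K"
    have "vsel ty ph qh (s + j) \<in> span (vsel ty ph qh ` {s + 1..s + i})"
      using ij by (intro span_base imageI) auto
    then show "vsel ty (\<lambda>i. ph (s + i)) (\<lambda>i. qh (s + i)) j \<bullet>
        (- (A *v y i) - (\<Sum>l=1..i. \<Gamma>h (s + i) l *\<^sub>R qh (s + l))) = 0"
      using body(4)[of i] ij by (simp add: vsel_shift y_def)
  qed simp_all
qed

lemma tridiag_eq:
  assumes "M k = n" "n \<le> k" "\<And>i. i \<le> n \<Longrightarrow> M (k - n + i) = i"
  shows "tridiag bt M \<zeta> \<Gamma> k = Matrix.mat n n (\<lambda>(a, c). complex_of_real
     (tri_entry (\<lambda>i. bt (k - n + i)) (\<lambda>i. \<zeta> (k - n + i)) (\<lambda>i. \<Gamma> (k - n + i)) a c))"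
  unfolding tridiag_def assms(1)
proof (rule cong_mat)
  fix a c assume "a < n" "c < n"
  then have M: "M (Suc (k - n + c)) = Suc c" "M (k - n + c) = c"
    using assms(3)[of c] assms(3)[of "Suc c"] by auto
  show "(case (a, c) of (a, c) \<Rightarrow>
     let i = c + 1; j = k - n + i; e = 1 - \<Gamma> j (M j) in
     complex_of_real
      (if a + 1 = c then phi M \<zeta> \<Gamma> (j - 1) / (bt (j - 1) * e)
       else if a = c then 1 / e * (1 / bt (j - 1) - phi M \<zeta> \<Gamma> j / bt j)
       else if a = c + 1 then - 1 / (bt j * e)
       else 0)) = (case (a, c) of (a, c) \<Rightarrow> complex_of_real
     (tri_entry (\<lambda>i. bt (k - n + i)) (\<lambda>i. \<zeta> (k - n + i)) (\<lambda>i. \<Gamma> (k - n + i)) a c))"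
    by (simp add: tri_entry_def Let_def phi_def cycle_phi_def M)
qed simp_all

section \<open>The eigenvalue estimate\<close>

theorem theorem6p5:
  fixes g h :: "real^'n \<Rightarrow> real^'n"
    and xs :: "real^'n" and U :: "(real^'n) set"
    and \<rho> \<kappa> \<mu> L \<tau> \<eta> \<beta> \<beta>' \<eta>\<^sub>0 \<tau>\<^sub>0 :: real
    and m :: nat and ty :: am_type
  assumes h: "\<And>x. h x = x - g x"
    and H: "assumption_H h xs U"
    and sym: "\<And>x. x \<in> U \<Longrightarrow> transpose (jacobian g (at x)) = jacobian g (at x)"
    and const: "local_constants h xs \<rho> \<kappa> \<mu> L"
    and m: "0 < m" "m \<le> CARD('n)"
    and \<tau>: "0 < \<tau>" "\<tau> < 1"
    and \<eta>: "0 < \<eta>"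
    and \<beta>: "0 < \<beta>" "0 < \<beta>'"
    and pos: "0 < \<eta>\<^sub>0" "0 < \<tau>\<^sub>0"
  shows "\<exists>\<epsilon>>0. \<exists>C>0.
    \<forall>(bt :: nat \<Rightarrow> real) x p q M \<zeta> \<Gamma> xh ph qh \<zeta>h \<Gamma>h k lam.
      norm (x 0 - xs) \<le> \<epsilon> \<longrightarrow>
      (\<forall>j. \<beta> \<le> \<bar>bt j\<bar> \<and> \<bar>bt j\<bar> \<le> \<beta>') \<longrightarrow>
      restarted_st_am ty g bt m \<tau> \<eta> x p q M \<zeta> \<Gamma> (k + 1) \<longrightarrow>
      process_II ty (jacobian h (at xs)) xs bt M x xh ph qh \<zeta>h \<Gamma>h (k + 1) \<longrightarrow>
      M (k + 1) \<ge> 2 \<longrightarrow>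
      (\<forall>j\<le>k + 1. norm (h (x j)) \<le> \<eta>\<^sub>0 * norm (h (x 0))) \<longrightarrow>
      (\<forall>j. 1 \<le> j \<and> j \<le> k \<and> M j \<ge> 1 \<longrightarrow> \<bar>1 - \<Gamma> j (M j)\<bar> \<ge> \<tau>\<^sub>0) \<longrightarrow>
      lam \<in> spectrum (tridiag bt M \<zeta> \<Gamma> k) \<longrightarrow>
      Min ((\<lambda>lamh. cmod (lamh - lam)) ` spectrum (tridiag bt M \<zeta>h \<Gamma>h k))
        \<le> \<kappa> * (C * norm (x (k - M k) - xs))"
proof -
  let ?A = "jacobian h (at xs)" and ?H = "\<lambda>y. h (xs + y)"
  have H': "h xs = 0" "xs \<in> U" "h differentiable (at xs)" using H by (auto simp: assumption_H_def)
  have c: "0 < \<rho>" "0 < \<kappa>" "0 < \<mu>" "0 < L" using const by (auto simp: local_constants_def)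
  have Asym: "(?A *v u) \<bullet> z = u \<bullet> (?A *v z)" for u z
    by (rule symmetric_linearisation[OF h H'(3) sym[OF H'(2)]])
  have Ab: "norm (?A *v y) \<le> L * norm y" "\<mu> * (norm y)\<^sup>2 \<le> y \<bullet> (?A *v y)" for y
    using const c by (auto simp: local_constants_def)
  have quad: "norm (?H y - ?A *v y) \<le> \<kappa> / 2 * (norm y)\<^sup>2" if "norm y \<le> \<rho>" for y
  proof -
    have "xs + y \<in> cball xs \<rho>" using that by (simp add: dist_norm)
    then have "norm (h (xs + y) - ?A *v (xs + y - xs)) \<le> 1/2 * \<kappa> * (norm (xs + y - xs))^2"
      using const unfolding local_constants_def by blast
    then show ?thesis by simp
  qed
  interpret linearisation ?H ?A \<rho> "\<kappa> / 2" \<mu> L \<tau> \<eta> \<beta> \<beta>'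
  proof
    fix y z :: "real^'n" assume "norm y \<le> \<rho>" "norm z \<le> \<rho>"
    then show "\<mu> * (norm (y - z))\<^sup>2 \<le> (h (xs + y) - h (xs + z)) \<bullet> (y - z)"
      using strong_monotonicity[OF const, of "xs + y" "xs + z"] by (simp add: dist_norm)
  next
    show "0 \<le> u \<bullet> (?A *v u)" for u
      using Ab(2)[of u] c by (smt (verit) mult_nonneg_nonneg zero_le_power2)
  qed (use H'(1) c \<tau> \<eta> \<beta> quad Ab(1) in auto)
  \<comment> \<open>In the ball, residual and error are comparable.\<close>
  define L' where "L' = L + \<kappa> / 2 * \<rho>"
  have h_upper: "norm (h (xs + y)) \<le> L' * norm y" if "norm y \<le> \<rho>" for y
  proof -
    have "norm (?H y) \<le> norm (?H y - ?A *v y) + norm (?A *v y)" using norm_triangle_sub[of "?H y" "?A *v y"] by simp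
    also have "\<dots> \<le> \<kappa> / 2 * (norm y * norm y) + L * norm y"
      using quad[OF that] Ab(1)[of y] by (simp add: power2_eq_square)
    also have "\<dots> \<le> \<kappa> / 2 * (\<rho> * norm y) + L * norm y"
      using that c by (intro add_mono mult_left_mono mult_right_mono) auto
    finally show ?thesis by (simp add: L'_def algebra_simps)
  qed
  have h_lower: "\<mu> * norm y \<le> norm (h (xs + y))" if "norm y \<le> \<rho>" for y
  proof (cases "y = 0")
    case False
    have "\<mu> * (norm y)\<^sup>2 \<le> h (xs + y) \<bullet> y" using monotone[OF that, of 0] c H'(1) by simp
    also have "\<dots> \<le> norm (h (xs + y)) * norm y" by (rule norm_cauchy_schwarz)
    finally show ?thesis using False by (simp add: power2_eq_square mult.assoc[symmetric])
  qed simp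
  have L'0: "L' > 0" using c by (simp add: L'_def add_pos_pos)
  define R where "R = max 1 (\<eta>\<^sub>0 * L' / \<mu>)"
  have R1: "R \<ge> 1" by (simp add: R_def)
  obtain C1 \<epsilon>1 where C1: "C1 > 0" "\<epsilon>1 > 0" and next_bound: "\<And>N b x p q \<zeta> \<Gamma>. N \<le> m \<Longrightarrow>
     am_cycle ty ?H \<rho> \<tau> \<eta> \<beta> \<beta>' N b x p q \<zeta> \<Gamma> \<Longrightarrow>
     0 < norm (x 0) \<Longrightarrow> norm (x 0) < \<epsilon>1 \<Longrightarrow> norm (x (Suc N)) \<le> C1 * norm (x 0)"
  proof -
    have "\<exists>C>0. \<exists>\<epsilon>>0. \<forall>N\<in>{..m}. \<forall>b x p q \<zeta> \<Gamma>. am_cycle ty ?H \<rho> \<tau> \<eta> \<beta> \<beta>' N b x p q \<zeta> \<Gamma> \<longrightarrow>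
     0 < norm (x 0) \<longrightarrow> norm (x 0) < \<epsilon> \<longrightarrow> norm (x (Suc N)) \<le> C * norm (x 0)"
    proof (rule common_bounds[OF next_iterate_bound])
      fix N C \<epsilon> C' \<epsilon>'
      assume *: "\<forall>b x p q \<zeta> \<Gamma>. am_cycle ty ?H \<rho> \<tau> \<eta> \<beta> \<beta>' N b x p q \<zeta> \<Gamma> \<longrightarrow>
     0 < norm (x 0) \<longrightarrow> norm (x 0) < \<epsilon> \<longrightarrow> norm (x (Suc N)) \<le> C * norm (x 0)" "C \<le> C'" "\<epsilon>' \<le> \<epsilon>"
      show "\<forall>b x p q \<zeta> \<Gamma>. am_cycle ty ?H \<rho> \<tau> \<eta> \<beta> \<beta>' N b x p q \<zeta> \<Gamma> \<longrightarrow>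
     0 < norm (x 0) \<longrightarrow> norm (x 0) < \<epsilon>' \<longrightarrow> norm (x (Suc N)) \<le> C' * norm (x 0)"
        using *(1) mult_right_mono[OF *(2) norm_ge_zero] *(3) by (meson order_trans order_less_le_trans)
    qed simp
    then obtain C \<epsilon> where *: "C > 0" "\<epsilon> > 0" "\<forall>N\<in>{..m}. \<forall>b x p q \<zeta> \<Gamma>.
     am_cycle ty ?H \<rho> \<tau> \<eta> \<beta> \<beta>' N b x p q \<zeta> \<Gamma> \<longrightarrow>
     0 < norm (x 0) \<longrightarrow> norm (x 0) < \<epsilon> \<longrightarrow> norm (x (Suc N)) \<le> C * norm (x 0)" by blast
    show ?thesis by (rule that[OF *(1,2)], rule *(3)[rule_format]) auto
  qed
  let ?good = "\<lambda>N C \<epsilon>. \<forall>b x p q \<zeta> \<Gamma> y ph qh rh vh \<zeta>h \<Gamma>h lam.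
     am_cycle ty ?H \<rho> \<tau> \<eta> \<beta> \<beta>' N b x p q \<zeta> \<Gamma> \<longrightarrow>
     linear_cycle ty ?A b y ph qh rh vh \<zeta>h \<Gamma>h N \<longrightarrow> y 0 = x 0 \<longrightarrow>
     (\<forall>j. 1 \<le> j \<longrightarrow> j < N \<longrightarrow> \<tau>\<^sub>0 \<le> \<bar>1 - \<Gamma> j j\<bar>) \<longrightarrow>
     0 < norm (x 0) \<longrightarrow> norm (x 0) < \<epsilon> \<longrightarrow>
     lam \<in> spectrum (Matrix.mat (N - 1) (N - 1) (\<lambda>(a, c). complex_of_real (tri_entry b \<zeta> \<Gamma> a c))) \<longrightarrow>
     (\<exists>lamh \<in> spectrum (Matrix.mat (N - 1) (N - 1)
         (\<lambda>(a, c). complex_of_real (tri_entry b \<zeta>h \<Gamma>h a c))). cmod (lamh - lam) \<le> C * norm (x 0))"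
  obtain C2 \<epsilon>2 where C2: "C2 > 0" "\<epsilon>2 > 0" and spectra_close: "\<forall>N\<in>{2..m}. ?good N C2 \<epsilon>2"
  proof -
    have "\<exists>C>0. \<exists>\<epsilon>>0. \<forall>N\<in>{2..m}. ?good N C \<epsilon>"
    proof (rule common_bounds)
      show "\<exists>C>0. \<exists>\<epsilon>>0. ?good N C \<epsilon>" if "N \<in> {2..m}" for N
        by (rule tridiagonal_spectrum_bound) (use that m pos in auto)
      show "?good N C' \<epsilon>'" if *: "?good N C \<epsilon>" "C \<le> C'" "\<epsilon>' \<le> \<epsilon>" for N C \<epsilon> C' \<epsilon>'
      proof (intro allI impI)
        fix b x p q \<zeta> \<Gamma> y ph qh rh vh \<zeta>h \<Gamma>h lam
        assume a: "am_cycle ty ?H \<rho> \<tau> \<eta> \<beta> \<beta>' N b x p q \<zeta> \<Gamma>"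
          "linear_cycle ty ?A b y ph qh rh vh \<zeta>h \<Gamma>h N" "y 0 = x 0"
          "\<forall>j. 1 \<le> j \<longrightarrow> j < N \<longrightarrow> \<tau>\<^sub>0 \<le> \<bar>1 - \<Gamma> j j\<bar>" "0 < norm (x 0)" "norm (x 0) < \<epsilon>'"
          "lam \<in> spectrum (Matrix.mat (N - 1) (N - 1) (\<lambda>(a, c). complex_of_real (tri_entry b \<zeta> \<Gamma> a c)))"
        have "norm (x 0) < \<epsilon>" using a(6) *(3) by simp
        from *(1)[rule_format, OF a(1-3) a(4)[rule_format] a(5) this a(7)]
        obtain lamh where "lamh \<in> spectrum (Matrix.mat (N - 1) (N - 1)
            (\<lambda>(a, c). complex_of_real (tri_entry b \<zeta>h \<Gamma>h a c)))" "cmod (lamh - lam) \<le> C * norm (x 0)"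
          by blast
        moreover have "C * norm (x 0) \<le> C' * norm (x 0)" using *(2) by (rule mult_right_mono) simp
        ultimately show "\<exists>lamh \<in> spectrum (Matrix.mat (N - 1) (N - 1)
         (\<lambda>(a, c). complex_of_real (tri_entry b \<zeta>h \<Gamma>h a c))). cmod (lamh - lam) \<le> C' * norm (x 0)"
          by (meson order_trans)
      qed
    qed simp
    then show ?thesis using that by blast
  qed
  \<comment> \<open>With \<open>R * \<epsilon>\<close> as the bound for all errors, the iterates lie in the ball, so do the points that
    follow a cycle, and both uniform bounds apply.\<close>
  define \<epsilon> where "\<epsilon> = Min {\<rho> / R, \<rho> / (C1 * R), \<epsilon>1 / (2 * R), \<epsilon>2 / (2 * R)}"
  have \<epsilon>0: "\<epsilon> > 0" using c C1 C2 R1 by (simp add: \<epsilon>_def)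
  have \<epsilon>: "R * \<epsilon> \<le> \<rho>" "C1 * (R * \<epsilon>) \<le> \<rho>" "R * \<epsilon> < \<epsilon>1" "R * \<epsilon> < \<epsilon>2"
  proof -
    have "\<epsilon> \<le> \<rho> / R" "\<epsilon> \<le> \<rho> / (C1 * R)" "\<epsilon> \<le> \<epsilon>1 / (2 * R)" "\<epsilon> \<le> \<epsilon>2 / (2 * R)"
      by (simp_all add: \<epsilon>_def)
    then show "R * \<epsilon> \<le> \<rho>" "C1 * (R * \<epsilon>) \<le> \<rho>" "R * \<epsilon> < \<epsilon>1" "R * \<epsilon> < \<epsilon>2"
      using R1 C1 C2 by (auto simp: field_simps)
  qed
  show ?thesis
  proof (rule exI[of _ \<epsilon>], rule conjI[OF \<epsilon>0], rule exI[of _ "C2 / \<kappa>"], rule conjI,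
      use C2 c in simp, intro allI impI)
    fix bt x p q M \<zeta> \<Gamma> xh ph qh \<zeta>h \<Gamma>h k lam
    assume x0: "norm (x 0 - xs) \<le> \<epsilon>"
      and bt: "\<forall>j. \<beta> \<le> \<bar>bt j\<bar> \<and> \<bar>bt j\<bar> \<le> \<beta>'"
      and run: "restarted_st_am ty g bt m \<tau> \<eta> x p q M \<zeta> \<Gamma> (k + 1)"
      and pII: "process_II ty (jacobian h (at xs)) xs bt M x xh ph qh \<zeta>h \<Gamma>h (k + 1)"
      and M2: "M (k + 1) \<ge> 2"
      and res: "\<forall>j\<le>k + 1. norm (h (x j)) \<le> \<eta>\<^sub>0 * norm (h (x 0))"
      and gain: "\<forall>j. 1 \<le> j \<and> j \<le> k \<and> M j \<ge> 1 \<longrightarrow> \<bar>1 - \<Gamma> j (M j)\<bar> \<ge> \<tau>\<^sub>0"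
      and lam: "lam \<in> spectrum (tridiag bt M \<zeta> \<Gamma> k)"
    have it: "st_am_iteration ty g bt m \<tau> \<eta> x p q M \<zeta> \<Gamma> j" and nz: "g (x j) - x j \<noteq> 0" if "j \<le> k + 1" for j
      using run that by (auto simp: restarted_st_am_def)
    have R_x0: "R * norm (x 0 - xs) \<le> R * \<epsilon>" using x0 R1 by (intro mult_left_mono) auto
    have x_pos: "0 < norm (x j - xs)" if "j \<le> k + 1" for j
      using nz[OF that] H'(1) h[of "x j"] by auto
    have Mle: "M j \<le> m" if "j \<le> k + 1" for j
      using st_am_iteration_no_restart(3)[OF it[OF that]] by (cases "M j = 0") auto
    have stay: "norm (x j - xs) \<le> R * norm (x 0 - xs)" if "j \<le> k + 1" for j
      using that
    proof (induction j rule: less_induct)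
      case (less j)
      show ?case
      proof (cases j)
        case 0
        then show ?thesis using R1 mult_right_mono[OF R1 norm_ge_zero[of "x 0 - xs"]] by simp
      next
        case (Suc i)
        have IH: "norm (x l - xs) \<le> R * \<epsilon>" if "l \<le> i" for l
          by (rule order_trans[OF less.IH R_x0]) (use less.prems Suc that in auto)
        have ball: "norm (x l - xs) \<le> \<rho>" if "l \<le> i" for l using IH[OF that] \<epsilon>(1) by simp
        have iti: "st_am_iteration ty g bt m \<tau> \<eta> x p q M \<zeta> \<Gamma> l" if "l \<le> i" for l
          using it that less.prems Suc by simp
        let ?s = "i - M i"
        have Mi: "M i \<le> i" using counter_in_cycle[OF iti] by blast
        note cyc = am_cycle_of_run[where h = h and xs = xs and \<rho> = \<rho> and k = i, OF h iti _ ball]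
        have "norm (x (?s + Suc (M i)) - xs) \<le> C1 * norm (x (?s + 0) - xs)"
          by (rule next_bound[OF _ cyc])
             (use Mle[of i] less.prems Suc bt x_pos[of ?s] IH[of ?s] \<epsilon>(3) in auto)
        also have "\<dots> \<le> C1 * (R * \<epsilon>)" using IH[of ?s] C1(1) by simp
        also have "\<dots> \<le> \<rho>" by (rule \<epsilon>(2))
        \<comment> \<open>Only now may the residual at \<open>x j\<close> be compared with the error, which restores the factor \<open>R\<close>.\<close>
        finally have inball: "norm (x j - xs) \<le> \<rho>" using Mi Suc by simp
        have "\<mu> * norm (x j - xs) \<le> norm (h (x j))" using h_lower[OF inball] by simp
        also have "\<dots> \<le> \<eta>\<^sub>0 * norm (h (x 0))" using res less.prems by simp
        also have "\<dots> \<le> \<eta>\<^sub>0 * (L' * norm (x 0 - xs))"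
          using h_upper[OF ball[of 0]] pos(1) by (intro mult_left_mono) auto
        finally have "norm (x j - xs) \<le> (\<eta>\<^sub>0 * L' / \<mu>) * norm (x 0 - xs)"
          using c(3) by (simp add: field_simps)
        also have "\<dots> \<le> R * norm (x 0 - xs)" by (rule mult_right_mono) (auto simp: R_def)
        finally show ?thesis .
      qed
    qed
    have small: "norm (x j - xs) \<le> R * \<epsilon>" if "j \<le> k + 1" for j
      by (rule order_trans[OF stay[OF that] R_x0])
    have ball: "norm (x j - xs) \<le> \<rho>" if "j \<le> k + 1" for j using small[OF that] \<epsilon>(1) by simp
    define N n s where "N = M (k + 1)" and "n = M k" and "s = k - n"
    have Nn: "N = Suc n" using st_am_iteration_no_restart(2)[OF it[OF order.refl]] M2 by (simp add: N_def n_def)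
    have MN: "N \<le> k + 1" "\<And>i. i \<le> N \<Longrightarrow> M (k + 1 - N + i) = i"
      using counter_in_cycle[where k = "k + 1", OF it] by (auto simp: N_def)
    have s: "k + 1 - N = s" using Nn by (simp add: s_def)
    have nk: "n \<le> k" using MN(1) Nn by simp
    have Ms: "M (s + i) = i" if "i \<le> N" for i by (rule MN(2)[OF that, unfolded s])
    have cyc: "am_cycle ty ?H \<rho> \<tau> \<eta> \<beta> \<beta>' N (\<lambda>i. bt (s + i)) (\<lambda>i. x (s + i) - xs)
      (\<lambda>i. p (s + i)) (\<lambda>i. q (s + i)) (\<lambda>i. \<zeta> (s + i)) (\<lambda>i. \<Gamma> (s + i))"
      by (rule am_cycle_of_run[where h = h and xs = xs and \<rho> = \<rho> and k = "k + 1",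
            OF h it spec[OF bt] ball, folded N_def, unfolded s])
    have bt0: "bt j \<noteq> 0" for j using bt \<beta> by (metis abs_zero not_le)
    note linc = linear_cycle_of_process_II[OF pII Asym bt0, folded N_def, OF MN, unfolded s]
    have g': "\<forall>j. 1 \<le> j \<longrightarrow> j < N \<longrightarrow> \<tau>\<^sub>0 \<le> \<bar>1 - \<Gamma> (s + j) j\<bar>"
    proof (intro allI impI)
      fix j assume j: "1 \<le> j" "j < N"
      then have Mj: "M (s + j) = j" using Ms by simp
      have "s + j \<le> k" using j Nn nk by (simp add: s_def)
      then have "1 \<le> s + j \<and> s + j \<le> k \<and> M (s + j) \<ge> 1" using j Mj by simp
      from gain[rule_format, OF this] show "\<tau>\<^sub>0 \<le> \<bar>1 - \<Gamma> (s + j) j\<bar>" unfolding Mj .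
    qed
    have tri: "tridiag bt M Z G k = Matrix.mat (N - 1) (N - 1) (\<lambda>(a, c). complex_of_real
     (tri_entry (\<lambda>i. bt (s + i)) (\<lambda>i. Z (s + i)) (\<lambda>i. G (s + i)) a c))" for Z G
      using tridiag_eq[of M k n bt Z G] Ms nk Nn by (simp add: n_def[symmetric] s_def[symmetric])
    have "\<exists>lamh \<in> spectrum (tridiag bt M \<zeta>h \<Gamma>h k). cmod (lamh - lam) \<le> C2 * norm (x (s + 0) - xs)"
      unfolding tri
    proof (rule spectra_close[rule_format, of N, OF _ cyc linc(1)])
      show "N \<in> {2..m}" using M2 Mle[of "k + 1"] by (simp add: N_def)
      show "xh (s + 0) - xs = x (s + 0) - xs" using linc(2) by simp
      show "\<tau>\<^sub>0 \<le> \<bar>1 - \<Gamma> (s + j) j\<bar>" if "1 \<le> j" "j < N" for j using g' that by blast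
      show "0 < norm (x (s + 0) - xs)" using x_pos[of s] by (simp add: s_def)
      show "norm (x (s + 0) - xs) < \<epsilon>2" by (rule order_le_less_trans[OF _ \<epsilon>(4)]) (use small[of s] in \<open>simp add: s_def\<close>)
      show "lam \<in> spectrum (Matrix.mat (N - 1) (N - 1) (\<lambda>(a, c). complex_of_real
          (tri_entry (\<lambda>i. bt (s + i)) (\<lambda>i. \<zeta> (s + i)) (\<lambda>i. \<Gamma> (s + i)) a c)))"
        using lam unfolding tri .
    qed
    then obtain lamh where lamh: "lamh \<in> spectrum (tridiag bt M \<zeta>h \<Gamma>h k)"
      "cmod (lamh - lam) \<le> C2 * norm (x s - xs)" by auto
    have "finite (spectrum (tridiag bt M \<zeta>h \<Gamma>h k))"
      by (rule card_finite_spectrum(1)[of _ "M k"]) (simp add: tridiag_def)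
    then have "Min ((\<lambda>lamh. cmod (lamh - lam)) ` spectrum (tridiag bt M \<zeta>h \<Gamma>h k)) \<le> cmod (lamh - lam)"
      using lamh(1) by (intro Min_le) auto
    also have "\<dots> \<le> C2 * norm (x s - xs)" by (rule lamh(2))
    also have "\<dots> = \<kappa> * (C2 / \<kappa> * norm (x (k - M k) - xs))"
      using c(2) by (simp add: s_def n_def)
    finally show "Min ((\<lambda>lamh. cmod (lamh - lam)) ` spectrum (tridiag bt M \<zeta>h \<Gamma>h k))
        \<le> \<kappa> * (C2 / \<kappa> * norm (x (k - M k) - xs))" .
  qed
qed

end
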